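(* Let $K$ be an algebraically closed field and let $A=KQ/I$ be a monomial algebra. Let $\mathcal{F}$ be the set of all minimal paths among the paths in $I$. Then $A$ is $1$-Gorenstein if and only if every nonzero path $p$ in $A$ with the property that there exists a nonzero path $q$ in $A$ such that $qp\in\mathcal{F}$ is a perfect path.
   Context: A monomial algebra is a finite-dimensional algebra $A=KQ/I$ where $Q$ is a finite quiver and $I$ is an admissible ideal of $KQ$ generated by paths of length at least two. Paths compose from right to left: $pq$ is defined when $s(p)=t(q)$, where $s$ and $t$ denote starting and ending vertex. A path $p$ in a set $\mathcal{S}$ of paths is minimal in $\mathcal S$ if no proper subpath of $p$ lies in $\mathcal{S}$. A path is nonzero in $A$ if it does not belong to $I$. A pair $(p,q)$ of nonzero paths in $A$ is perfect if: (P1) $p$ and $q$ are nontrivial (of length $\geq 1$), $s(p)=t(q)$ and $pq=0$ in $A$; (P2) if $pq'=0$ in $A$ for a nonzero path $q'$ with $t(q')=s(p)$, then $q'=qq''$ for some path $q''$; (P3) if $p'q=0$ in $A$ for a nonzero path $p'$ with $s(p')=t(q)$, then $p'=p''p$ for some path $p''$. A nonzero path $p$ is a perfect path if there is a sequence $p=p_1,p_2,\dots,p_n,p_{n+1}=p$ ($n\ge1$) of nonzero paths such that $(p_i,p_{i+1})$ is a perfect pair for all $1\le i\le n$. An algebra $A$ is $1$-Gorenstein if $A$ has injective dimension at most $1$ both as a left and as a right $A$-module. *)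

theory Defs
  imports
    "HOL-Algebra.Ideal_Product"
    "HOL-Algebra.QuotRing"
    "HOL-Algebra.Module"
    "HOL-Computational_Algebra.Polynomial"
    "Graph_Theory.Arc_Walk"
begin

section \<open>Paths in a quiver\<close>

text \<open>
  A finite quiver is a \<open>fin_digraph\<close> (loops and multiple arrows allowed). A path is a pair of its
  starting vertex and the list of its arrows in the order in which they are traversed; the trivial
  path at \<open>v\<close> is \<open>(v, [])\<close>. Composition is from right to left, so that in \<open>qcomp p q\<close>
  the path \<open>q\<close> is traversed first.
\<close>

type_synonym ('v, 'e) qpath = "'v \<times> 'e list"

definition qsource :: "('v, 'e) qpath \<Rightarrow> 'v" where
  "qsource p = fst p"

definition qtarget :: "('v, 'e) pre_digraph \<Rightarrow> ('v, 'e) qpath \<Rightarrow> 'v" where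
  "qtarget Q p = pre_digraph.awlast Q (fst p) (snd p)"

definition qlength :: "('v, 'e) qpath \<Rightarrow> nat" where
  "qlength p = length (snd p)"

definition qpaths :: "('v, 'e) pre_digraph \<Rightarrow> ('v, 'e) qpath set" where
  "qpaths Q = {(u, es). \<exists>v. pre_digraph.awalk Q u es v}"

definition qcomp :: "('v, 'e) qpath \<Rightarrow> ('v, 'e) qpath \<Rightarrow> ('v, 'e) qpath" where
  "qcomp p q = (qsource q, snd q @ snd p)"

definition composable :: "('v, 'e) pre_digraph \<Rightarrow> ('v, 'e) qpath \<Rightarrow> ('v, 'e) qpath \<Rightarrow> bool" where
  "composable Q p q \<longleftrightarrow> p \<in> qpaths Q \<and> q \<in> qpaths Q \<and> qsource p = qtarget Q q"

definition subpath :: "('v, 'e) pre_digraph \<Rightarrow> ('v, 'e) qpath \<Rightarrow> ('v, 'e) qpath \<Rightarrow> bool" where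
  "subpath Q p r \<longleftrightarrow>
     (\<exists>a b. composable Q a p \<and> composable Q p b \<and> r = qcomp a (qcomp p b))"

definition minimal_paths ::
  "('v, 'e) pre_digraph \<Rightarrow> ('v, 'e) qpath set \<Rightarrow> ('v, 'e) qpath set" where
  "minimal_paths Q S = {p \<in> S. \<not> (\<exists>r\<in>S. subpath Q r p \<and> r \<noteq> p)}"


section \<open>The path algebra and admissible monomial ideals\<close>

text \<open>
  An element of the path algebra is the family of its coefficients: a finitely supported function
  on paths, extended by zero to all pairs that are not paths.
\<close>

definition path_algebra ::
  "('v, 'e) pre_digraph \<Rightarrow> (('v, 'e) qpath \<Rightarrow> 'k::field) ring" where
  "path_algebra Q = \<lparr>
     carrier = {f. finite {p. f p \<noteq> 0} \<and> {p. f p \<noteq> 0} \<subseteq> qpaths Q},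
     monoid.mult = (\<lambda>f g r. \<Sum>(p, q) \<in> {(p, q). composable Q p q \<and> qcomp p q = r}. f p * g q),
     one = (\<lambda>p. if p \<in> qpaths Q \<and> qlength p = 0 then 1 else 0),
     zero = (\<lambda>p. 0),
     add = (\<lambda>f g p. f p + g p)\<rparr>"

definition path_vec :: "('v, 'e) qpath \<Rightarrow> ('v, 'e) qpath \<Rightarrow> 'k::field" where
  "path_vec p = (\<lambda>r. if r = p then 1 else 0)"

definition arrow_ideal ::
  "('v, 'e) pre_digraph \<Rightarrow> (('v, 'e) qpath \<Rightarrow> 'k::field) set" where
  "arrow_ideal Q = genideal (path_algebra Q) (path_vec ` {p \<in> qpaths Q. qlength p = 1})"

definition admissible_ideal ::
  "('v, 'e) pre_digraph \<Rightarrow> (('v, 'e) qpath \<Rightarrow> 'k::field) set \<Rightarrow> bool" where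
  "admissible_ideal Q I \<longleftrightarrow>
     ideal I (path_algebra Q) \<and>
     I \<subseteq> arrow_ideal Q [^]\<^bsub>ideals_set (path_algebra Q)\<^esub> (2::nat) \<and>
     (\<exists>m::nat. m \<ge> 2 \<and> arrow_ideal Q [^]\<^bsub>ideals_set (path_algebra Q)\<^esub> m \<subseteq> I)"

definition monomial_ideal ::
  "('v, 'e) pre_digraph \<Rightarrow> (('v, 'e) qpath \<Rightarrow> 'k::field) set \<Rightarrow> bool" where
  "monomial_ideal Q I \<longleftrightarrow>
     admissible_ideal Q I \<and>
     (\<exists>S. S \<subseteq> {p \<in> qpaths Q. qlength p \<ge> 2} \<and> I = genideal (path_algebra Q) (path_vec ` S))"


section \<open>Perfect paths\<close>

definition zero_path ::
  "('v, 'e) pre_digraph \<Rightarrow> (('v, 'e) qpath \<Rightarrow> 'k::field) set \<Rightarrow> ('v, 'e) qpath \<Rightarrow> bool" where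
  "zero_path Q I p \<longleftrightarrow> p \<in> qpaths Q \<and> path_vec p \<in> I"

definition nonzero_path ::
  "('v, 'e) pre_digraph \<Rightarrow> (('v, 'e) qpath \<Rightarrow> 'k::field) set \<Rightarrow> ('v, 'e) qpath \<Rightarrow> bool" where
  "nonzero_path Q I p \<longleftrightarrow> p \<in> qpaths Q \<and> path_vec p \<notin> I"

definition perfect_pair ::
  "('v, 'e) pre_digraph \<Rightarrow> (('v, 'e) qpath \<Rightarrow> 'k::field) set \<Rightarrow>
   ('v, 'e) qpath \<Rightarrow> ('v, 'e) qpath \<Rightarrow> bool" where
  "perfect_pair Q I p q \<longleftrightarrow>
     nonzero_path Q I p \<and> nonzero_path Q I q \<and>
     qlength p \<ge> 1 \<and> qlength q \<ge> 1 \<and> composable Q p q \<and> zero_path Q I (qcomp p q) \<and>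
     (\<forall>q'. nonzero_path Q I q' \<and> composable Q p q' \<and> zero_path Q I (qcomp p q') \<longrightarrow>
        (\<exists>q''. composable Q q q'' \<and> q' = qcomp q q'')) \<and>
     (\<forall>p'. nonzero_path Q I p' \<and> composable Q p' q \<and> zero_path Q I (qcomp p' q) \<longrightarrow>
        (\<exists>p''. composable Q p'' p \<and> p' = qcomp p'' p))"

definition perfect_path ::
  "('v, 'e) pre_digraph \<Rightarrow> (('v, 'e) qpath \<Rightarrow> 'k::field) set \<Rightarrow> ('v, 'e) qpath \<Rightarrow> bool" where
  "perfect_path Q I p \<longleftrightarrow>
     nonzero_path Q I p \<and>
     (\<exists>(n::nat) ps. n \<ge> 1 \<and> ps 1 = p \<and> ps (n + 1) = p \<and>
        (\<forall>i\<in>{1..n + 1}. nonzero_path Q I (ps i)) \<and>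
        (\<forall>i\<in>{1..n}. perfect_pair Q I (ps i) (ps (i + 1))))"


section \<open>Modules over noncommutative rings and injective dimension\<close>

text \<open>The library locale \<open>module\<close> requires a commutative ring; the axioms below are the same.\<close>

locale left_module = R?: ring R + M?: abelian_group M for R (structure) and M (structure) +
  assumes smult_closed: "\<lbrakk>a \<in> carrier R; x \<in> carrier M\<rbrakk> \<Longrightarrow> a \<odot>\<^bsub>M\<^esub> x \<in> carrier M"
    and smult_l_distr: "\<lbrakk>a \<in> carrier R; b \<in> carrier R; x \<in> carrier M\<rbrakk> \<Longrightarrow>
      (a \<oplus> b) \<odot>\<^bsub>M\<^esub> x = a \<odot>\<^bsub>M\<^esub> x \<oplus>\<^bsub>M\<^esub> b \<odot>\<^bsub>M\<^esub> x"
    and smult_r_distr: "\<lbrakk>a \<in> carrier R; x \<in> carrier M; y \<in> carrier M\<rbrakk> \<Longrightarrow>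
      a \<odot>\<^bsub>M\<^esub> (x \<oplus>\<^bsub>M\<^esub> y) = a \<odot>\<^bsub>M\<^esub> x \<oplus>\<^bsub>M\<^esub> a \<odot>\<^bsub>M\<^esub> y"
    and smult_assoc: "\<lbrakk>a \<in> carrier R; b \<in> carrier R; x \<in> carrier M\<rbrakk> \<Longrightarrow>
      (a \<otimes> b) \<odot>\<^bsub>M\<^esub> x = a \<odot>\<^bsub>M\<^esub> (b \<odot>\<^bsub>M\<^esub> x)"
    and smult_one: "x \<in> carrier M \<Longrightarrow> \<one> \<odot>\<^bsub>M\<^esub> x = x"

definition lmod_hom :: "'a ring \<Rightarrow> ('a, 'm) module \<Rightarrow> ('a, 'n) module \<Rightarrow> ('m \<Rightarrow> 'n) set" where
  "lmod_hom R M N = {f. f \<in> carrier M \<rightarrow> carrier N \<and>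
     (\<forall>x\<in>carrier M. \<forall>y\<in>carrier M. f (x \<oplus>\<^bsub>M\<^esub> y) = f x \<oplus>\<^bsub>N\<^esub> f y) \<and>
     (\<forall>a\<in>carrier R. \<forall>x\<in>carrier M. f (a \<odot>\<^bsub>M\<^esub> x) = a \<odot>\<^bsub>N\<^esub> f x)}"

text \<open>
  The extension property is tested on modules whose elements have the same type \<open>'u\<close> as those of
  \<open>E\<close>. As soon as the type \<open>'a\<close> of ring elements embeds into \<open>'u\<close>, there are copies of all left
  ideals of \<open>R\<close> among the test modules, so that by Baer's criterion this is injectivity
  with respect to all modules. Below it is only used with such a type \<open>'u\<close>.
\<close>

definition injective_module :: "'a ring \<Rightarrow> ('a, 'u) module \<Rightarrow> bool" where
  "injective_module R E \<longleftrightarrow>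
     left_module R E \<and>
     (\<forall>(M :: ('a, 'u) module) (N :: ('a, 'u) module) i f.
        left_module R M \<and> left_module R N \<and>
        i \<in> lmod_hom R M N \<and> inj_on i (carrier M) \<and> f \<in> lmod_hom R M E \<longrightarrow>
        (\<exists>g\<in>lmod_hom R N E. \<forall>x\<in>carrier M. g (i x) = f x))"

text \<open>An injective resolution: the sequence \<open>0 \<rightarrow> M \<rightarrow> E 0 \<rightarrow> E 1 \<rightarrow> \<dots>\<close> is exact.\<close>

definition injective_resolution ::
  "'a ring \<Rightarrow> ('a, 'm) module \<Rightarrow> (nat \<Rightarrow> ('a, 'u) module) \<Rightarrow>
   ('m \<Rightarrow> 'u) \<Rightarrow> (nat \<Rightarrow> 'u \<Rightarrow> 'u) \<Rightarrow> bool" where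
  "injective_resolution R M E e d \<longleftrightarrow>
     left_module R M \<and>
     (\<forall>i. injective_module R (E i)) \<and>
     e \<in> lmod_hom R M (E 0) \<and> inj_on e (carrier M) \<and>
     (\<forall>i. d i \<in> lmod_hom R (E i) (E (Suc i))) \<and>
     e ` carrier M = a_kernel (E 0) (E 1) (d 0) \<and>
     (\<forall>i. d i ` carrier (E i) = a_kernel (E (Suc i)) (E (Suc (Suc i))) (d (Suc i)))"

text \<open>
  HOL definitions cannot quantify over types, so the terms of a resolution are taken from one type
  that is large enough for every module with elements of type \<open>'m\<close> over every ring with elements
  of type \<open>'a\<close>: if an infinite cardinal \<open>\<kappa>\<close> bounds the cardinalities of \<open>'a\<close> and \<open>'m\<close>, then
  the injective hull of a module with at most \<open>2\<^sup>\<kappa>\<close> elements again has at most \<open>2\<^sup>\<kappa>\<close> elements,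
  and so do all terms of the minimal injective resolution.
\<close>

type_synonym ('a, 'm) module_univ = "('a \<times> 'm \<times> nat) set"

definition inj_dim_le :: "'a ring \<Rightarrow> ('a, 'm) module \<Rightarrow> nat \<Rightarrow> bool" where
  "inj_dim_le R M n \<longleftrightarrow>
     (\<exists>(E :: nat \<Rightarrow> ('a, ('a, 'm) module_univ) module) e d.
        injective_resolution R M E e d \<and> (\<forall>i>n. carrier (E i) = {\<zero>\<^bsub>E i\<^esub>}))"

definition regular_module :: "'a ring \<Rightarrow> ('a, 'a) module" where
  "regular_module R = \<lparr>carrier = carrier R, monoid.mult = monoid.mult R, one = one R,
     zero = zero R, add = add R, module.smult = monoid.mult R\<rparr>"

definition opposite_ring :: "'a ring \<Rightarrow> 'a ring" where
  "opposite_ring R = \<lparr>carrier = carrier R, monoid.mult = (\<lambda>x y. y \<otimes>\<^bsub>R\<^esub> x), one = one R,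
     zero = zero R, add = add R\<rparr>"

text \<open>Right modules over \<open>R\<close> are left modules over the opposite ring.\<close>

definition one_gorenstein :: "'a ring \<Rightarrow> bool" where
  "one_gorenstein R \<longleftrightarrow>
     inj_dim_le R (regular_module R) 1 \<and>
     inj_dim_le (opposite_ring R) (regular_module (opposite_ring R)) 1"

end

theory Submission
  imports Defs
begin

text \<open>The nonzero paths form a basis of \<open>A\<close> that is closed under multiplication up to zero, so \<open>A\<close> is
  governed by a finite cancellative category with zero. If \<open>A\<close> has injective dimension at most one
  on the left, then \<open>Ext\<^sup>1(Ap, A) = 0\<close> for every path \<open>p\<close>. Since the left annihilator of \<open>p\<close> is generated
  by the minimal paths \<open>q\<close> with \<open>qp = 0\<close>, this forces \<open>q\<close> to be unique and every \<open>x\<close> annihilated by the left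
  annihilator of \<open>q\<close> to lie in \<open>qA\<close>. Together with the uniqueness on the other side, \<open>qp \<in> F\<close> makes
  \<open>(q, p)\<close> a perfect pair, and \<open>q\<close> has a predecessor again. As there are finitely many paths
  and the left entry of a perfect pair determines the right one, going backwards closes up to a cycle.

  Conversely, perfect paths give the same two conditions for every arrow. Take the quotient of
  \<open>Hom\<^sub>K(A, A)\<close> by \<open>A\<close> as the second term of the resolution. Injectivity of a module \<open>E\<close> needs to be
  tested only on the radicals of the indecomposable projectives, which are direct sums of modules \<open>A\<alpha>\<close>
  with \<open>\<alpha>\<close> an arrow, so that one has to find \<open>y\<close> with \<open>\<alpha>y = x\<^sub>\<alpha>\<close> for given \<open>x\<^sub>\<alpha>\<close> killed by the
  annihilator of \<open>\<alpha>\<close>; the obstruction for the quotient lies in \<open>Ext\<^sup>1(A\<alpha>, A)\<close> and vanishes.\<close>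

section \<open>Finite categories with zero\<close>

text \<open>The category axioms are self-dual, so a statement about one side is proved once and
  reread in the opposite category. The criterion is not visibly self-dual: it speaks of the right
  factor \<open>p\<close> of a relation \<open>qp\<close>. Hence the converse has to treat an arrow
  both as the right and as the left factor of a relation; the successor of the other factor in its
  cycle supplies in the one case what its predecessor supplies in the other. Arrows always occur: if
  \<open>a\<close> is an arrow and \<open>q\<close> is minimal with \<open>qa = 0\<close>, then
  \<open>qa\<close> lies in F.

  Vanishing of \<open>Ext^1(Ap, A)\<close> is used in the form that every homomorphism from the left
  annihilator of \<open>p\<close> to \<open>A\<close> is right multiplication by an element of
  \<open>A\<close>. \<open>Hom_K(A, A)\<close> can be the first term of the resolution because it is
  a power of the injective module \<open>Hom_K(A, K)\<close> and contains \<open>A\<close> as the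
  right multiplications. Its quotient has to live in the type \<open>module_univ\<close> fixed by
  the definition of injective dimension; therefore passing to quotients and changing types are one
  construction, \<open>push_module\<close>.\<close>

text \<open>\<open>nz x y\<close> says that the product \<open>m x y\<close> is defined and nonzero (otherwise the value of \<open>m\<close> is
  irrelevant); objects are represented by their identities, which are the elements of length \<open>0\<close>.
  Below, \<open>zr x y\<close> says that the product is defined but zero. All axioms are stable under
  passing to the opposite category.\<close>

locale zero_category =
  fixes N :: "'b set" and nz :: "'b \<Rightarrow> 'b \<Rightarrow> bool" and m :: "'b \<Rightarrow> 'b \<Rightarrow> 'b"
    and s t :: "'b \<Rightarrow> 'b" and len :: "'b \<Rightarrow> nat"
  assumes finite_N: "finite N"
    and nz_memL: "nz x y \<Longrightarrow> x \<in> N"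
    and nz_memR: "nz x y \<Longrightarrow> y \<in> N"
    and m_mem: "nz x y \<Longrightarrow> m x y \<in> N"
    and nz_comp: "nz x y \<Longrightarrow> s x = t y"
    and s_mem: "x \<in> N \<Longrightarrow> s x \<in> N"
    and t_mem: "x \<in> N \<Longrightarrow> t x \<in> N"
    and nz_s: "x \<in> N \<Longrightarrow> nz x (s x)"
    and nz_t: "x \<in> N \<Longrightarrow> nz (t x) x"
    and m_s: "x \<in> N \<Longrightarrow> m x (s x) = x"
    and m_t: "x \<in> N \<Longrightarrow> m (t x) x = x"
    and nz_assoc: "nz x y \<and> nz (m x y) z \<longleftrightarrow> nz y z \<and> nz x (m y z)"
    and comp_assoc: "nz x y \<Longrightarrow> nz (m x y) z \<Longrightarrow> m (m x y) z = m x (m y z)"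
    and lcancel: "nz x y \<Longrightarrow> nz x y' \<Longrightarrow> m x y = m x y' \<Longrightarrow> y = y'"
    and rcancel: "nz x y \<Longrightarrow> nz x' y \<Longrightarrow> m x y = m x' y \<Longrightarrow> x = x'"
    and overlap: "nz x y \<Longrightarrow> nz z w \<Longrightarrow> m x y = m z w \<Longrightarrow>
      (\<exists>u. nz z u \<and> nz u y \<and> x = m z u \<and> w = m u y) \<or>
      (\<exists>u. nz x u \<and> nz u w \<and> z = m x u \<and> y = m u w)"
    and len_m: "nz x y \<Longrightarrow> len (m x y) = len x + len y"
    and len_0_s: "x \<in> N \<Longrightarrow> len x = 0 \<Longrightarrow> s x = x"
    and len_0_t: "x \<in> N \<Longrightarrow> len x = 0 \<Longrightarrow> t x = x"
    and len_s: "x \<in> N \<Longrightarrow> len (s x) = 0"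
    and len_t: "x \<in> N \<Longrightarrow> len (t x) = 0"
    and first_arrow: "x \<in> N \<Longrightarrow> 0 < len x \<Longrightarrow> \<exists>y a. nz y a \<and> len a = 1 \<and> x = m y a"
    and last_arrow: "x \<in> N \<Longrightarrow> 0 < len x \<Longrightarrow> \<exists>y a. nz a y \<and> len a = 1 \<and> x = m a y"
begin

lemma zero_category_op: "zero_category N (\<lambda>x y. nz y x) (\<lambda>x y. m y x) t s len"
  apply unfold_locales
  subgoal by (rule finite_N)
  subgoal by (rule nz_memR)
  subgoal by (rule nz_memL)
  subgoal by (rule m_mem)
  subgoal by (rule nz_comp[symmetric])
  subgoal by (rule t_mem)
  subgoal by (rule s_mem)
  subgoal by (rule nz_t)
  subgoal by (rule nz_s)
  subgoal by (rule m_t)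
  subgoal by (rule m_s)
  subgoal using nz_assoc by metis
  subgoal using nz_assoc comp_assoc by metis
  subgoal by (rule rcancel)
  subgoal by (rule lcancel)
  subgoal using overlap by metis
  subgoal by (simp add: len_m)
  subgoal by (rule len_0_t)
  subgoal by (rule len_0_s)
  subgoal by (rule len_t)
  subgoal by (rule len_s)
  subgoal by (rule last_arrow)
  subgoal by (rule first_arrow)
  done

text \<open>Endpoints of products are not axioms: associativity moves the identity
  \<open>s y\<close> from \<open>y\<close> to \<open>m x y\<close>, where composability reads off
  the source.\<close>

lemma s_m: assumes "nz x y" shows "s (m x y) = s y"
proof -
  have y: "y \<in> N" using nz_memR assms .
  have "nz (m x y) (s y)" using nz_assoc[of x y "s y"] assms nz_s[OF y] m_s[OF y] by simp
  then have "s (m x y) = t (s y)" by (rule nz_comp)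
  also have "\<dots> = s y" using len_0_t s_mem[OF y] len_s[OF y] by simp
  finally show ?thesis .
qed

lemma t_m: assumes "nz x y" shows "t (m x y) = t x"
  using zero_category.s_m[OF zero_category_op] assms .

section \<open>Zero products, minimal annihilators and perfect pairs\<close>

definition zr :: "'b \<Rightarrow> 'b \<Rightarrow> bool" where
  "zr x y \<longleftrightarrow> x \<in> N \<and> y \<in> N \<and> s x = t y \<and> \<not> nz x y"

text \<open>The \<open>q\<close> with \<open>lmin q p\<close> are the minimal monomial generators of
  the left annihilator of \<open>p\<close> among the elements with source \<open>t p\<close>. Only
  left factors are split off, since left multiples of a generator belong to the annihilator
  anyway.\<close>

definition lmin :: "'b \<Rightarrow> 'b \<Rightarrow> bool" where
  "lmin q p \<longleftrightarrow> zr q p \<and> (\<forall>d q1. nz d q1 \<and> q = m d q1 \<and> zr q1 p \<longrightarrow> q1 = q)"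

definition rmin :: "'b \<Rightarrow> 'b \<Rightarrow> bool" where
  "rmin q p \<longleftrightarrow> zr q p \<and> (\<forall>d p1. nz p1 d \<and> p = m p1 d \<and> zr q p1 \<longrightarrow> p1 = p)"

definition perfect :: "'b \<Rightarrow> 'b \<Rightarrow> bool" where
  "perfect p q \<longleftrightarrow> zr p q \<and>
     (\<forall>q'. zr p q' \<longrightarrow> (\<exists>u. nz q u \<and> q' = m q u)) \<and>
     (\<forall>p'. zr p' q \<longrightarrow> (\<exists>u. nz u p \<and> p' = m u p))"

definition perfect_cyclic :: "'b \<Rightarrow> bool" where
  "perfect_cyclic p \<longleftrightarrow> (\<exists>(n::nat) ps. n \<ge> 1 \<and> ps 1 = p \<and> ps (n + 1) = p \<and>
     (\<forall>i\<in>{1..n}. perfect (ps i) (ps (i + 1))))"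

text \<open>A homomorphism \<open>Aq -> A\<close> is given by the image \<open>x\<close> of
  \<open>q\<close>, which must be killed by whatever kills \<open>q\<close>; it extends to the
  projective \<open>Ae\<close> with \<open>e = s q\<close> exactly if \<open>x\<close> lies in
  \<open>qA\<close>. This is that extension property for monomials \<open>x\<close>. The clause
  \<open>t x = t q\<close> accounts for the identities that kill \<open>q\<close> because they do
  not compose with it.\<close>

definition zero_divisor_closed :: "'b \<Rightarrow> bool" where
  "zero_divisor_closed q \<longleftrightarrow>
     (\<forall>x\<in>N. t x = t q \<and> (\<forall>r. zr r q \<longrightarrow> zr r x) \<longrightarrow> (\<exists>u. nz q u \<and> x = m q u))"

text \<open>An element of length 0 is an identity, and its products do not vanish. This supplies the
  nontriviality in (P1), which \<open>perfect\<close> contains implicitly.\<close>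

lemma zr_lenL: assumes "zr x y" shows "0 < len x"
proof (rule ccontr)
  assume "\<not> 0 < len x"
  then have "x = t y" using assms len_0_s[of x] by (auto simp: zr_def)
  then show False using assms nz_t[of y] by (auto simp: zr_def)
qed

lemma zr_lenR: assumes "zr x y" shows "0 < len y"
proof (rule ccontr)
  assume "\<not> 0 < len y"
  then have "y = s x" using assms len_0_t[of y] by (auto simp: zr_def)
  then show False using assms nz_s[of x] by (auto simp: zr_def)
qed

lemma zr_extendL: assumes "nz d q" "zr q p" shows "zr (m d q) p"
  using assms nz_assoc[of d q p] by (auto simp: zr_def m_mem s_m)

lemma len_factorL: assumes "nz x y" "len (m x y) = len y" shows "m x y = y"
proof -
  have "len x = 0" using assms len_m by simp
  then have "x = t y" using len_0_s nz_comp[OF assms(1)] nz_memL[OF assms(1)] by simp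
  then show ?thesis using m_t nz_memR[OF assms(1)] by simp
qed

text \<open>Stripping off a left factor shortens \<open>c\<close>, so the process stops at a minimal
  element.\<close>

lemma lmin_exists: assumes "zr c p" shows "\<exists>q d. lmin q p \<and> nz d q \<and> c = m d q"
  using assms
proof (induction "len c" arbitrary: c rule: less_induct)
  case less
  show ?case
  proof (cases "lmin c p")
    case True
    then show ?thesis using nz_t[of c] m_t[of c] by (metis less.prems zr_def)
  next
    case False
    then obtain d q where dq: "nz d q" "c = m d q" "zr q p" "q \<noteq> c"
      using less.prems by (auto simp: lmin_def)
    then have "len q < len c" using len_m[OF dq(1)] len_factorL[OF dq(1)] by fastforce
    then obtain q' d' where q': "lmin q' p" "nz d' q'" "q = m d' q'" using less.hyps dq(3) by blast
    then have "nz d d' \<and> nz (m d d') q'" using nz_assoc[of d d' q'] dq by simp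
    then show ?thesis using q' dq comp_assoc[of d d' q'] by metis
  qed
qed

lemma rmin_op: "zero_category.lmin N (\<lambda>x y. nz y x) (\<lambda>x y. m y x) t s p q \<longleftrightarrow> rmin q p"
  unfolding zero_category.lmin_def[OF zero_category_op] zero_category.zr_def[OF zero_category_op]
    rmin_def zr_def by metis

lemma zr_op: "zero_category.zr N (\<lambda>x y. nz y x) t s p q \<longleftrightarrow> zr q p"
  unfolding zero_category.zr_def[OF zero_category_op] zr_def by metis

lemma rmin_exists: assumes "zr p c" shows "\<exists>q d. rmin p q \<and> nz q d \<and> c = m q d"
  using zero_category.lmin_exists[OF zero_category_op] assms rmin_op zr_op by blast

text \<open>By (P3) for both pairs each left entry is a right factor of the other, and additivity of
  length forces them to agree.\<close>

lemma perfect_leftD: assumes "perfect p q" "perfect p' q" shows "p = p'"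
proof -
  obtain u v where u: "nz u p" "p' = m u p" and v: "nz v p'" "p = m v p'"
    using assms unfolding perfect_def by meson
  have "len p' = len u + len p" "len p = len v + len p'" using len_m u v by metis+
  then have "m v p' = p'" using len_factorL[OF v(1)] len_m[OF v(1)] by linarith
  then show ?thesis using v(2) by metis
qed

lemma perfect_op: "zero_category.perfect N (\<lambda>x y. nz y x) (\<lambda>x y. m y x) t s p q \<longleftrightarrow> perfect q p"
  unfolding zero_category.perfect_def[OF zero_category_op] zr_op perfect_def by metis

lemma perfect_rightD: assumes "perfect p q" "perfect p q'" shows "q = q'"
  using zero_category.perfect_leftD[OF zero_category_op] assms perfect_op by blast

lemma perfect_lmin: assumes "perfect p q" shows "lmin p q"
  unfolding lmin_def
proof (intro conjI allI impI)
  show "zr p q" using assms by (simp add: perfect_def)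
  fix d q1 assume a: "nz d q1 \<and> p = m d q1 \<and> zr q1 q"
  then obtain u where u: "nz u p" "q1 = m u p" using assms unfolding perfect_def by meson
  have "len q1 = len u + len p" "len p = len d + len q1" using a u len_m by metis+
  then show "q1 = p" using a len_factorL[of d q1] by simp
qed

lemma perfect_lmin_unique: assumes "perfect p q" "lmin p' q" shows "p' = p"
proof -
  obtain u where u: "nz u p" "p' = m u p"
    using assms unfolding lmin_def perfect_def by blast
  then have "p = p'" using assms unfolding lmin_def perfect_def by blast
  then show ?thesis by simp
qed

text \<open>If nothing killed \<open>q\<close> on the left, closedness would apply vacuously to the
  identity \<open>t q\<close> and make it a multiple of \<open>q\<close>, which has positive
  length.\<close>

lemma zr_pred: assumes "zr q p" "zero_divisor_closed q" shows "\<exists>z. zr z q"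
proof (rule ccontr)
  assume "\<nexists>z. zr z q"
  moreover have qN: "q \<in> N" using assms by (simp add: zr_def)
  moreover have "t (t q) = t q" using len_0_t t_mem[OF qN] len_t[OF qN] by simp
  ultimately obtain u where u: "nz q u" "t q = m q u"
    using assms(2) t_mem[OF qN] unfolding zero_divisor_closed_def by blast
  then have "len (t q) = len q + len u" using len_m by metis
  then show False using zr_lenL[OF assms(1)] len_t[OF qN] by simp
qed

text \<open>The predecessor is the unique minimal left annihilator \<open>z\<close> of
  \<open>q\<close>. Uniqueness gives (P3). For (P2), whatever \<open>z\<close> kills is killed by
  all left multiples of \<open>z\<close>, hence by everything that kills \<open>q\<close>, and
  closedness makes it a multiple of \<open>q\<close>.\<close>

lemma perfect_pred:
  assumes uniq: "\<And>p q q'. lmin q p \<Longrightarrow> lmin q' p \<Longrightarrow> q = q'"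
    and closed: "zero_divisor_closed q" and q: "zr q p"
  shows "\<exists>z. perfect z q"
proof -
  obtain c where c: "zr c q" using zr_pred[OF q closed] ..
  then obtain z where z: "lmin z q" using lmin_exists by blast
  have l: "\<exists>u. nz u z \<and> p' = m u z" if "zr p' q" for p'
    using lmin_exists[OF that] uniq[OF z] by blast
  have "\<exists>u. nz q u \<and> q' = m q u" if q': "zr z q'" for q'
  proof -
    have "zr r q'" if "zr r q" for r
      using l[OF that] q' zr_extendL by blast
    moreover have "t q' = t q" using q' z by (simp add: lmin_def zr_def)
    moreover have "q' \<in> N" using q' by (simp add: zr_def)
    ultimately show ?thesis using closed by (simp add: zero_divisor_closed_def)
  qed
  then show ?thesis using l z by (auto simp: perfect_def lmin_def)
qed

text \<open>Walking back along predecessors in a finite set must repeat. Since a left entry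
  determines its right entry, a repetition \<open>a i = a j\<close> propagates along the pairs down
  to index 0, so the cycle passes through \<open>p\<close> itself and not only through some
  ancestor.\<close>

lemma perfect_cyclicI:
  assumes pred: "\<And>p q. perfect q p \<Longrightarrow> \<exists>z. perfect z q" and "perfect q p"
  shows "perfect_cyclic p"
proof -
  define f where "f p = (SOME q. perfect q p)" for p
  have f: "perfect (f p) p" if "\<exists>q. perfect q p" for p
    using someI_ex[OF that] by (simp add: f_def)
  define a where "a i = (f ^^ i) p" for i
  have ex: "\<exists>q. perfect q (a i)" for i
  proof (induction i)
    case 0 then show ?case using assms(2) by (auto simp: a_def)
  next
    case (Suc i) then show ?case using f[of "a i"] pred by (fastforce simp: a_def)
  qed
  have step: "perfect (a (Suc i)) (a i)" for i
    using f[OF ex[of i]] by (simp add: a_def)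
  have "a i \<in> N" for i using step[of i] by (simp add: perfect_def zr_def)
  then have "\<not> inj a" using finite_N by (meson finite_imageD finite_subset image_subsetI infinite_UNIV_nat)
  then obtain i j where ij: "i < j" "a i = a j" unfolding inj_def by (metis linorder_neqE_nat)
  have shift: "a (i - k) = a (j - k)" if "k \<le> i" for k
    using that
  proof (induction k)
    case (Suc k)
    have "perfect (a (i - k)) (a (i - Suc k))" "perfect (a (j - k)) (a (j - Suc k))"
      using step[of "i - Suc k"] step[of "j - Suc k"] Suc.prems ij(1)
      by (simp_all add: Suc_diff_Suc)
    then show ?case using Suc perfect_rightD by auto
  qed (use ij in simp)
  define n where "n = j - i"
  have n: "n \<ge> 1" "a n = p" using ij shift[of i] by (simp_all add: n_def a_def)
  \<comment> \<open>\<open>a\<close> runs backwards and starts at 0, the required sequence runs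
    forwards and starts at 1; position \<open>k\<close> corresponds to
    \<open>n + 1 - k\<close>.\<close>
  have "\<forall>k\<in>{1..n}. perfect (a (n + 1 - k)) (a (n + 1 - (k + 1)))"
    using step by (auto simp: Suc_diff_le)
  then show ?thesis unfolding perfect_cyclic_def
    by (intro exI[of _ n] exI[of _ "\<lambda>k. a (n + 1 - k)"]) (use n in \<open>auto simp: a_def\<close>)
qed

lemma perfect_cyclic_neighbours:
  assumes "perfect_cyclic p"
  shows "\<exists>q. perfect q p \<and> perfect_cyclic q" "\<exists>q. perfect p q"
proof -
  obtain n ps where n: "(n::nat) \<ge> 1" "ps 1 = p" "ps (n + 1) = p"
    and ps: "\<And>i. i \<in> {1..n} \<Longrightarrow> perfect (ps i) (ps (i + 1))"
    using assms unfolding perfect_cyclic_def by blast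
  show "\<exists>q. perfect p q" using ps[of 1] n by auto
  \<comment> \<open>The same cycle rotated by one step, so that the predecessor \<open>ps n\<close>
    of \<open>p\<close> becomes the starting point.\<close>
  define ps' where "ps' i = (if i = 1 then ps n else ps (i - 1))" for i :: nat
  have "perfect (ps' i) (ps' (i + 1))" if "i \<in> {1..n}" for i
  proof (cases "i = 1")
    case True
    then show ?thesis using ps[of n] n by (simp add: ps'_def)
  next
    case False
    then have "i - 1 \<in> {1..n}" "i - 1 + 1 = i" using that by auto
    then have "perfect (ps (i - 1)) (ps i)" using ps[of "i - 1"] by simp
    then show ?thesis using False that by (simp add: ps'_def)
  qed
  then have "perfect_cyclic (ps n)" unfolding perfect_cyclic_def
    by (intro exI[of _ n] exI[of _ ps']) (use n in \<open>auto simp: ps'_def\<close>)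
  then show "\<exists>q. perfect q p \<and> perfect_cyclic q" using ps[of n] n by auto
qed

text \<open>The uniqueness on the right supplies (P2) for the first pair \<open>(q, p)\<close>; all
  earlier pairs come from \<open>perfect_pred\<close>, which works with the conditions on the
  left.\<close>

theorem perfect_cyclic_of_unique:
  assumes uniq: "\<And>p q q'. lmin q p \<Longrightarrow> lmin q' p \<Longrightarrow> q = q'"
    and closed: "\<And>p q. lmin q p \<Longrightarrow> zero_divisor_closed q"
    and uniq_op: "\<And>p p' q. rmin q p \<Longrightarrow> rmin q p' \<Longrightarrow> p = p'"
    and "lmin q p" "rmin q p"
  shows "perfect_cyclic p"
proof (rule perfect_cyclicI)
  show "\<exists>z. perfect z q" if "perfect q p" for p q
  proof (rule perfect_pred)
    show "zero_divisor_closed q" using closed perfect_lmin[OF that] .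
    show "zr q p" using that by (simp add: perfect_def)
  qed (rule uniq)
  show "perfect q p" unfolding perfect_def
  proof (intro conjI allI impI)
    show "zr q p" using \<open>lmin q p\<close> by (simp add: lmin_def)
    show "\<exists>u. nz p u \<and> q' = m p u" if "zr q q'" for q'
    proof -
      obtain r d where "rmin q r" "nz r d" "q' = m r d" using rmin_exists[OF \<open>zr q q'\<close>] by blast
      moreover have "p = r" using \<open>rmin q p\<close> \<open>rmin q r\<close> by (rule uniq_op)
      ultimately show ?thesis by blast
    qed
    show "\<exists>u. nz u q \<and> p' = m u q" if "zr p' p" for p'
    proof -
      obtain r d where "lmin r p" "nz d r" "p' = m d r" using lmin_exists[OF \<open>zr p' p\<close>] by blast
      moreover have "q = r" using \<open>lmin q p\<close> \<open>lmin r p\<close> by (rule uniq)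
      ultimately show ?thesis by blast
    qed
  qed
qed

section \<open>The condition on arrows, a combinatorial form of
  \<open>Ext^1(Aa, A) = 0\<close>\<close>

definition arrow_condition :: bool where
  "arrow_condition \<longleftrightarrow> (\<forall>a p. len a = 1 \<and> lmin p a \<longrightarrow>
     (\<forall>p'. lmin p' a \<longrightarrow> p' = p) \<and> zero_divisor_closed p)"

text \<open>(P2) gives this with \<open>z\<close> as the single test element: it kills
  \<open>p\<close>, so it kills \<open>x\<close>.\<close>

lemma perfect_zero_divisor_closed: assumes "perfect z p" shows "zero_divisor_closed p"
  using assms by (auto simp: zero_divisor_closed_def perfect_def)

text \<open>A left factor of an arrow that is killed has positive length and is therefore the whole
  arrow. This is why the hypothesis of the criterion reaches every arrow with a nonzero
  annihilator.\<close>

lemma arrow_lmin_rmin: assumes "len a = 1" "lmin p a" shows "rmin p a"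
  unfolding rmin_def
proof (intro conjI allI impI)
  show "zr p a" using assms by (simp add: lmin_def)
  fix d p1 assume p1: "nz p1 d \<and> a = m p1 d \<and> zr p p1"
  then have "len p1 > 0" using zr_lenR by blast
  then have "len d = 0" using p1 len_m[of p1 d] assms by auto
  then have "d = s p1" using p1 len_0_t[of d] nz_comp[of p1 d] nz_memR by auto
  then show "p1 = a" using p1 m_s[of p1] nz_memL by auto
qed

text \<open>The arrow \<open>a\<close> lies on a cycle. Its predecessor there must be
  \<open>p\<close>, and the predecessor of \<open>p\<close> makes \<open>p\<close> closed.\<close>

lemma arrow_condition:
  assumes "\<And>p q. lmin q p \<Longrightarrow> rmin q p \<Longrightarrow> perfect_cyclic p"
  shows arrow_condition
  unfolding arrow_condition_def
proof (intro allI impI)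
  fix a p assume a: "len a = 1 \<and> lmin p a"
  then have "perfect_cyclic a" using arrow_lmin_rmin assms by blast
  then obtain q where q: "perfect q a" "perfect_cyclic q" using perfect_cyclic_neighbours by blast
  then have "q = p" using a perfect_lmin_unique by blast
  then have "zero_divisor_closed p"
    using q perfect_cyclic_neighbours(1)[of q] perfect_zero_divisor_closed by blast
  then show "(\<forall>p'. lmin p' a \<longrightarrow> p' = p) \<and> zero_divisor_closed p"
    using q \<open>q = p\<close> perfect_lmin_unique by blast
qed

text \<open>Not the formal dual of the previous lemma, since the hypothesis concerns right factors.
  Now the arrow \<open>b\<close> is the left factor and the cycle runs through \<open>q\<close>: its
  predecessor must be \<open>b\<close>, which gives uniqueness, and its successor gives closedness
  in the opposite category.\<close>

lemma arrow_condition_op: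
  assumes "\<And>p q. lmin q p \<Longrightarrow> rmin q p \<Longrightarrow> perfect_cyclic p"
  shows "zero_category.arrow_condition N (\<lambda>x y. nz y x) (\<lambda>x y. m y x) t s len"
proof -
  interpret op: zero_category N "\<lambda>x y. nz y x" "\<lambda>x y. m y x" t s len by (rule zero_category_op)
  show ?thesis unfolding op.arrow_condition_def
  proof (intro allI impI)
    fix b q assume b: "len b = 1 \<and> op.lmin q b"
    then have r: "rmin b q" "lmin b q"
      using op.arrow_lmin_rmin[of b q] rmin_op zero_category.rmin_op[OF op.zero_category_op]
      by (metis, metis op.rmin_def lmin_def zr_op)
    then have "perfect_cyclic q" using assms by blast
    then obtain p z where p: "perfect p q" and z: "perfect q z" using perfect_cyclic_neighbours by blast
    then have "p = b" using r perfect_lmin_unique by blast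
    then have "\<forall>p'. op.lmin p' b \<longrightarrow> p' = q"
      using p op.perfect_lmin_unique perfect_op by blast
    moreover have "op.zero_divisor_closed q"
      using z op.perfect_zero_divisor_closed perfect_op by blast
    ultimately show "(\<forall>p'. op.lmin p' b \<longrightarrow> p' = q) \<and> op.zero_divisor_closed q" by blast
  qed
qed

end

section \<open>Modules and injective dimension\<close>

lemma left_moduleI:
  assumes "ring R"
    and "\<And>x y. x \<in> carrier M \<Longrightarrow> y \<in> carrier M \<Longrightarrow> x \<oplus>\<^bsub>M\<^esub> y \<in> carrier M"
    and "\<zero>\<^bsub>M\<^esub> \<in> carrier M"
    and "\<And>x y z. x \<in> carrier M \<Longrightarrow> y \<in> carrier M \<Longrightarrow> z \<in> carrier M \<Longrightarrow>
      (x \<oplus>\<^bsub>M\<^esub> y) \<oplus>\<^bsub>M\<^esub> z = x \<oplus>\<^bsub>M\<^esub> (y \<oplus>\<^bsub>M\<^esub> z)"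
    and "\<And>x y. x \<in> carrier M \<Longrightarrow> y \<in> carrier M \<Longrightarrow> x \<oplus>\<^bsub>M\<^esub> y = y \<oplus>\<^bsub>M\<^esub> x"
    and "\<And>x. x \<in> carrier M \<Longrightarrow> \<zero>\<^bsub>M\<^esub> \<oplus>\<^bsub>M\<^esub> x = x"
    and "\<And>x. x \<in> carrier M \<Longrightarrow> \<exists>y\<in>carrier M. y \<oplus>\<^bsub>M\<^esub> x = \<zero>\<^bsub>M\<^esub>"
    and "\<And>a x. a \<in> carrier R \<Longrightarrow> x \<in> carrier M \<Longrightarrow> a \<odot>\<^bsub>M\<^esub> x \<in> carrier M"
    and "\<And>a b x. a \<in> carrier R \<Longrightarrow> b \<in> carrier R \<Longrightarrow> x \<in> carrier M \<Longrightarrow>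
      (a \<oplus>\<^bsub>R\<^esub> b) \<odot>\<^bsub>M\<^esub> x = a \<odot>\<^bsub>M\<^esub> x \<oplus>\<^bsub>M\<^esub> b \<odot>\<^bsub>M\<^esub> x"
    and "\<And>a x y. a \<in> carrier R \<Longrightarrow> x \<in> carrier M \<Longrightarrow> y \<in> carrier M \<Longrightarrow>
      a \<odot>\<^bsub>M\<^esub> (x \<oplus>\<^bsub>M\<^esub> y) = a \<odot>\<^bsub>M\<^esub> x \<oplus>\<^bsub>M\<^esub> a \<odot>\<^bsub>M\<^esub> y"
    and "\<And>a b x. a \<in> carrier R \<Longrightarrow> b \<in> carrier R \<Longrightarrow> x \<in> carrier M \<Longrightarrow>
      (a \<otimes>\<^bsub>R\<^esub> b) \<odot>\<^bsub>M\<^esub> x = a \<odot>\<^bsub>M\<^esub> (b \<odot>\<^bsub>M\<^esub> x)"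
    and "\<And>x. x \<in> carrier M \<Longrightarrow> \<one>\<^bsub>R\<^esub> \<odot>\<^bsub>M\<^esub> x = x"
  shows "left_module R M"
  by (intro left_module.intro left_module_axioms.intro abelian_groupI) (use assms in auto)

lemma lmod_homI:
  assumes "\<And>x. x \<in> carrier M \<Longrightarrow> f x \<in> carrier N"
    and "\<And>x y. x \<in> carrier M \<Longrightarrow> y \<in> carrier M \<Longrightarrow> f (x \<oplus>\<^bsub>M\<^esub> y) = f x \<oplus>\<^bsub>N\<^esub> f y"
    and "\<And>a x. a \<in> carrier R \<Longrightarrow> x \<in> carrier M \<Longrightarrow> f (a \<odot>\<^bsub>M\<^esub> x) = a \<odot>\<^bsub>N\<^esub> f x"
  shows "f \<in> lmod_hom R M N"
  using assms by (auto simp: lmod_hom_def)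

lemma lmod_homD:
  assumes "f \<in> lmod_hom R M N"
  shows "x \<in> carrier M \<Longrightarrow> f x \<in> carrier N"
    and "x \<in> carrier M \<Longrightarrow> y \<in> carrier M \<Longrightarrow> f (x \<oplus>\<^bsub>M\<^esub> y) = f x \<oplus>\<^bsub>N\<^esub> f y"
    and "a \<in> carrier R \<Longrightarrow> x \<in> carrier M \<Longrightarrow> f (a \<odot>\<^bsub>M\<^esub> x) = a \<odot>\<^bsub>N\<^esub> f x"
  using assms by (auto simp: lmod_hom_def)

lemma lmod_hom_comp:
  assumes "f \<in> lmod_hom R M N" "g \<in> lmod_hom R N P"
  shows "(\<lambda>x. g (f x)) \<in> lmod_hom R M P"
  using assms by (auto simp: lmod_hom_def Pi_iff)

context left_module
begin

lemma smult_zero: assumes "a \<in> carrier R" shows "a \<odot>\<^bsub>M\<^esub> \<zero>\<^bsub>M\<^esub> = \<zero>\<^bsub>M\<^esub>"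
proof -
  have "a \<odot>\<^bsub>M\<^esub> \<zero>\<^bsub>M\<^esub> = a \<odot>\<^bsub>M\<^esub> \<zero>\<^bsub>M\<^esub> \<oplus>\<^bsub>M\<^esub> a \<odot>\<^bsub>M\<^esub> \<zero>\<^bsub>M\<^esub>"
    using smult_r_distr[OF assms M.zero_closed M.zero_closed] by simp
  then show ?thesis using M.add.r_cancel_one'[of "a \<odot>\<^bsub>M\<^esub> \<zero>\<^bsub>M\<^esub>" "a \<odot>\<^bsub>M\<^esub> \<zero>\<^bsub>M\<^esub>"] smult_closed[OF assms M.zero_closed]
    by simp
qed

lemma zero_smult: assumes "x \<in> carrier M" shows "\<zero>\<^bsub>R\<^esub> \<odot>\<^bsub>M\<^esub> x = \<zero>\<^bsub>M\<^esub>"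
proof -
  have "\<zero>\<^bsub>R\<^esub> \<odot>\<^bsub>M\<^esub> x = \<zero>\<^bsub>R\<^esub> \<odot>\<^bsub>M\<^esub> x \<oplus>\<^bsub>M\<^esub> \<zero>\<^bsub>R\<^esub> \<odot>\<^bsub>M\<^esub> x"
    using smult_l_distr[OF R.zero_closed R.zero_closed assms] by simp
  then show ?thesis using M.add.r_cancel_one'[of "\<zero>\<^bsub>R\<^esub> \<odot>\<^bsub>M\<^esub> x" "\<zero>\<^bsub>R\<^esub> \<odot>\<^bsub>M\<^esub> x"] smult_closed[OF R.zero_closed assms]
    by simp
qed

lemma minus_one_smult: assumes "x \<in> carrier M" shows "(\<ominus>\<^bsub>R\<^esub> \<one>\<^bsub>R\<^esub>) \<odot>\<^bsub>M\<^esub> x = \<ominus>\<^bsub>M\<^esub> x"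
proof (rule M.minus_equality[symmetric])
  show "(\<ominus>\<^bsub>R\<^esub> \<one>\<^bsub>R\<^esub>) \<odot>\<^bsub>M\<^esub> x \<oplus>\<^bsub>M\<^esub> x = \<zero>\<^bsub>M\<^esub>"
    using smult_l_distr[of "\<ominus>\<^bsub>R\<^esub> \<one>\<^bsub>R\<^esub>" "\<one>\<^bsub>R\<^esub>" x] assms
    by (simp add: smult_one zero_smult R.l_neg)
qed (use assms smult_closed in auto)

lemma smult_minus: assumes "a \<in> carrier R" "x \<in> carrier M"
  shows "a \<odot>\<^bsub>M\<^esub> (\<ominus>\<^bsub>M\<^esub> x) = \<ominus>\<^bsub>M\<^esub> (a \<odot>\<^bsub>M\<^esub> x)"
proof (rule M.minus_equality[symmetric])
  show "a \<odot>\<^bsub>M\<^esub> (\<ominus>\<^bsub>M\<^esub> x) \<oplus>\<^bsub>M\<^esub> a \<odot>\<^bsub>M\<^esub> x = \<zero>\<^bsub>M\<^esub>"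
    using smult_r_distr[of a "\<ominus>\<^bsub>M\<^esub> x" x] assms by (simp add: M.l_neg smult_zero)
qed (use assms smult_closed in auto)

lemma smult_diff: assumes "a \<in> carrier R" "x \<in> carrier M" "y \<in> carrier M"
  shows "a \<odot>\<^bsub>M\<^esub> (x \<ominus>\<^bsub>M\<^esub> y) = a \<odot>\<^bsub>M\<^esub> x \<ominus>\<^bsub>M\<^esub> a \<odot>\<^bsub>M\<^esub> y"
  unfolding a_minus_def using assms by (simp add: smult_r_distr smult_minus)

end

lemma lmod_hom_zero:
  assumes "left_module R M" "left_module R N" "f \<in> lmod_hom R M N"
  shows "f \<zero>\<^bsub>M\<^esub> = \<zero>\<^bsub>N\<^esub>"
proof -
  interpret M: left_module R M by fact
  interpret N: left_module R N by fact
  have "f (\<zero>\<^bsub>R\<^esub> \<odot>\<^bsub>M\<^esub> \<zero>\<^bsub>M\<^esub>) = \<zero>\<^bsub>R\<^esub> \<odot>\<^bsub>N\<^esub> f \<zero>\<^bsub>M\<^esub>"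
    by (intro lmod_homD(3)[OF assms(3)]) auto
  then show ?thesis using lmod_homD(1)[OF assms(3)] by (simp add: M.smult_zero N.zero_smult)
qed

lemma lmod_hom_minus:
  assumes "left_module R M" "left_module R N" "f \<in> lmod_hom R M N" "x \<in> carrier M"
  shows "f (\<ominus>\<^bsub>M\<^esub> x) = \<ominus>\<^bsub>N\<^esub> f x"
proof -
  interpret M: left_module R M by fact
  interpret N: left_module R N by fact
  have "f ((\<ominus>\<^bsub>R\<^esub> \<one>\<^bsub>R\<^esub>) \<odot>\<^bsub>M\<^esub> x) = (\<ominus>\<^bsub>R\<^esub> \<one>\<^bsub>R\<^esub>) \<odot>\<^bsub>N\<^esub> f x"
    by (intro lmod_homD(3)[OF assms(3)]) (use assms in auto)
  then show ?thesis using assms(4) lmod_homD(1)[OF assms(3)]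
    by (simp add: M.minus_one_smult N.minus_one_smult)
qed

lemma lmod_hom_diff:
  assumes "left_module R M" "left_module R N" "f \<in> lmod_hom R M N" "x \<in> carrier M" "y \<in> carrier M"
  shows "f (x \<ominus>\<^bsub>M\<^esub> y) = f x \<ominus>\<^bsub>N\<^esub> f y"
proof -
  interpret M: left_module R M by fact
  show ?thesis unfolding a_minus_def
    using lmod_homD(2)[OF assms(3,4)] lmod_hom_minus[OF assms(1-3)] assms(4,5) by simp
qed

lemma a_kernel_eq: "a_kernel M N f = {x \<in> carrier M. f x = \<zero>\<^bsub>N\<^esub>}"
  by (simp add: a_kernel_def kernel_def)

text \<open>The module structure carried over to the image of a map; used both to pass to quotients and
  to move modules to another type.\<close>

definition module_congruence :: "'a ring \<Rightarrow> ('a, 'm) module \<Rightarrow> ('m \<Rightarrow> 'n) \<Rightarrow> bool" where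
  "module_congruence R M h \<longleftrightarrow>
     (\<forall>x\<in>carrier M. \<forall>x'\<in>carrier M. \<forall>y\<in>carrier M. \<forall>y'\<in>carrier M. h x = h x' \<longrightarrow> h y = h y' \<longrightarrow>
        h (x \<oplus>\<^bsub>M\<^esub> y) = h (x' \<oplus>\<^bsub>M\<^esub> y')) \<and>
     (\<forall>a\<in>carrier R. \<forall>x\<in>carrier M. \<forall>x'\<in>carrier M. h x = h x' \<longrightarrow> h (a \<odot>\<^bsub>M\<^esub> x) = h (a \<odot>\<^bsub>M\<^esub> x'))"

definition push_module :: "('a, 'm) module \<Rightarrow> ('m \<Rightarrow> 'n) \<Rightarrow> ('a, 'n) module" where
  "push_module M h = \<lparr>carrier = h ` carrier M, monoid.mult = undefined, one = undefined,
     zero = h \<zero>\<^bsub>M\<^esub>,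
     add = (\<lambda>x y. h (inv_into (carrier M) h x \<oplus>\<^bsub>M\<^esub> inv_into (carrier M) h y)),
     module.smult = (\<lambda>a x. h (a \<odot>\<^bsub>M\<^esub> inv_into (carrier M) h x))\<rparr>"

lemma module_congruence_add:
  "module_congruence R M h \<Longrightarrow> x \<in> carrier M \<Longrightarrow> x' \<in> carrier M \<Longrightarrow> y \<in> carrier M \<Longrightarrow> y' \<in> carrier M \<Longrightarrow>
   h x = h x' \<Longrightarrow> h y = h y' \<Longrightarrow> h (x \<oplus>\<^bsub>M\<^esub> y) = h (x' \<oplus>\<^bsub>M\<^esub> y')"
  unfolding module_congruence_def by blast

lemma module_congruence_smult:
  "module_congruence R M h \<Longrightarrow> a \<in> carrier R \<Longrightarrow> x \<in> carrier M \<Longrightarrow> x' \<in> carrier M \<Longrightarrow>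
   h x = h x' \<Longrightarrow> h (a \<odot>\<^bsub>M\<^esub> x) = h (a \<odot>\<^bsub>M\<^esub> x')"
  unfolding module_congruence_def by blast

lemma module_congruence_inj: "inj_on h (carrier M) \<Longrightarrow> module_congruence R M h"
  unfolding module_congruence_def inj_on_def by metis

lemma push_module_simps [simp]:
  "carrier (push_module M h) = h ` carrier M"
  "\<zero>\<^bsub>push_module M h\<^esub> = h \<zero>\<^bsub>M\<^esub>"
  by (simp_all add: push_module_def)

text \<open>The preimages chosen in \<open>push_module\<close> may differ from \<open>x\<close> and
  \<open>y\<close>; the congruence removes the difference.\<close>

lemma push_add:
  assumes "module_congruence R M h" "x \<in> carrier M" "y \<in> carrier M"
  shows "h x \<oplus>\<^bsub>push_module M h\<^esub> h y = h (x \<oplus>\<^bsub>M\<^esub> y)"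
proof -
  let ?s = "inv_into (carrier M) h"
  have "?s (h x) \<in> carrier M" "h (?s (h x)) = h x" "?s (h y) \<in> carrier M" "h (?s (h y)) = h y"
    using assms by (auto intro: inv_into_into f_inv_into_f)
  then have "h (?s (h x) \<oplus>\<^bsub>M\<^esub> ?s (h y)) = h (x \<oplus>\<^bsub>M\<^esub> y)"
    by (intro module_congruence_add[OF assms(1)] assms(2,3))
  then show ?thesis by (simp add: push_module_def)
qed

lemma push_smult:
  assumes "module_congruence R M h" "a \<in> carrier R" "x \<in> carrier M"
  shows "a \<odot>\<^bsub>push_module M h\<^esub> h x = h (a \<odot>\<^bsub>M\<^esub> x)"
proof -
  let ?s = "inv_into (carrier M) h"
  have "?s (h x) \<in> carrier M" "h (?s (h x)) = h x"
    using assms by (auto intro: inv_into_into f_inv_into_f)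
  then have "h (a \<odot>\<^bsub>M\<^esub> ?s (h x)) = h (a \<odot>\<^bsub>M\<^esub> x)"
    by (intro module_congruence_smult[OF assms(1)] assms(2,3))
  then show ?thesis by (simp add: push_module_def)
qed

lemma push_hom:
  assumes "module_congruence R M h"
  shows "h \<in> lmod_hom R M (push_module M h)"
  by (rule lmod_homI) (auto simp: push_add[OF assms] push_smult[OF assms])

lemma push_left_module:
  assumes "left_module R M" and h: "module_congruence R M h"
  shows "left_module R (push_module M h)"
proof -
  interpret left_module R M by fact
  let ?N = "push_module M h"
  note hom = push_add[OF h] push_smult[OF h]
  show ?thesis
  proof (rule left_moduleI)
    show "ring R" by unfold_locales
    show "\<zero>\<^bsub>?N\<^esub> \<in> carrier ?N" by simp
    fix x assume x: "x \<in> carrier ?N"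
    then obtain x' where x': "x' \<in> carrier M" "x = h x'" by auto
    show "\<zero>\<^bsub>?N\<^esub> \<oplus>\<^bsub>?N\<^esub> x = x" by (simp add: x' hom)
    show "\<exists>y\<in>carrier ?N. y \<oplus>\<^bsub>?N\<^esub> x = \<zero>\<^bsub>?N\<^esub>"
      using x'(1) M.l_neg[OF x'(1)] by (intro bexI[of _ "h (\<ominus>\<^bsub>M\<^esub> x')"]) (simp_all add: x'(2) hom)
    show "\<one>\<^bsub>R\<^esub> \<odot>\<^bsub>?N\<^esub> x = x" by (simp add: x' hom smult_one)
    show "a \<odot>\<^bsub>?N\<^esub> x \<in> carrier ?N" if "a \<in> carrier R" for a
      by (simp add: x' hom that smult_closed)
    show "(a \<oplus>\<^bsub>R\<^esub> b) \<odot>\<^bsub>?N\<^esub> x = a \<odot>\<^bsub>?N\<^esub> x \<oplus>\<^bsub>?N\<^esub> b \<odot>\<^bsub>?N\<^esub> x"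
      "(a \<otimes>\<^bsub>R\<^esub> b) \<odot>\<^bsub>?N\<^esub> x = a \<odot>\<^bsub>?N\<^esub> (b \<odot>\<^bsub>?N\<^esub> x)"
      if "a \<in> carrier R" "b \<in> carrier R" for a b
      by (simp_all add: x' hom that smult_closed smult_l_distr smult_assoc)
    fix y assume "y \<in> carrier ?N"
    then obtain y' where y': "y' \<in> carrier M" "y = h y'" by auto
    show "x \<oplus>\<^bsub>?N\<^esub> y \<in> carrier ?N" by (simp add: x' y' hom)
    show "x \<oplus>\<^bsub>?N\<^esub> y = y \<oplus>\<^bsub>?N\<^esub> x" using M.a_comm[of x' y'] by (simp add: x' y' hom)
    show "a \<odot>\<^bsub>?N\<^esub> (x \<oplus>\<^bsub>?N\<^esub> y) = a \<odot>\<^bsub>?N\<^esub> x \<oplus>\<^bsub>?N\<^esub> a \<odot>\<^bsub>?N\<^esub> y" if "a \<in> carrier R" for a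
      by (simp add: x' y' hom that smult_closed smult_r_distr)
    fix z assume "z \<in> carrier ?N"
    then obtain z' where z': "z' \<in> carrier M" "z = h z'" by auto
    show "(x \<oplus>\<^bsub>?N\<^esub> y) \<oplus>\<^bsub>?N\<^esub> z = x \<oplus>\<^bsub>?N\<^esub> (y \<oplus>\<^bsub>?N\<^esub> z)"
      by (simp add: x' y' z' hom M.a_assoc)
  qed
qed

text \<open>\<open>injective_module\<close> tests only modules whose elements have type
  \<open>'u\<close>. The injection \<open>enc\<close> copies \<open>M\<close> and \<open>N\<close>
  into that type; the extension found there is pulled back along \<open>enc\<close>.\<close>

lemma injective_extend:
  fixes M :: "('a, 'm) module" and N :: "('a, 'm) module" and enc :: "'m \<Rightarrow> 'u"
  assumes E: "injective_module R (E :: ('a, 'u) module)" and "inj enc"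
    and M: "left_module R M" and N: "left_module R N"
    and i: "i \<in> lmod_hom R M N" "inj_on i (carrier M)" and f: "f \<in> lmod_hom R M E"
  shows "\<exists>g\<in>lmod_hom R N E. \<forall>x\<in>carrier M. g (i x) = f x"
proof -
  have inj: "inj_on enc A" for A using \<open>inj enc\<close> by (simp add: inj_on_def)
  have cM: "module_congruence R M enc" and cN: "module_congruence R N enc"
    by (auto intro: module_congruence_inj inj)
  define d where "d = inv_into UNIV enc"
  have d[simp]: "d (enc x) = x" for x using \<open>inj enc\<close> by (simp add: d_def)
  have "left_module R (push_module M enc)" "left_module R (push_module N enc)"
    using push_left_module M N cM cN by blast+
  moreover have dM: "d \<in> lmod_hom R (push_module M enc) M"
    by (rule lmod_homI) (auto simp: push_add[OF cM] push_smult[OF cM])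
  have "(\<lambda>x. enc (i (d x))) \<in> lmod_hom R (push_module M enc) (push_module N enc)"
    by (rule lmod_hom_comp[OF lmod_hom_comp[OF dM i(1)] push_hom[OF cN]])
  moreover have "inj_on (\<lambda>x. enc (i (d x))) (carrier (push_module M enc))"
    using i(2) \<open>inj enc\<close> by (auto simp: inj_on_def)
  moreover have "(\<lambda>x. f (d x)) \<in> lmod_hom R (push_module M enc) E"
    by (rule lmod_hom_comp[OF dM f])
  ultimately obtain g where g: "g \<in> lmod_hom R (push_module N enc) E"
      "\<forall>x\<in>carrier (push_module M enc). g (enc (i (d x))) = f (d x)"
    using E unfolding injective_module_def by blast
  have "(\<lambda>x. g (enc x)) \<in> lmod_hom R N E" by (rule lmod_hom_comp[OF push_hom[OF cN] g(1)])
  then show ?thesis using g(2) by (intro bexI[of _ "\<lambda>x. g (enc x)"]) auto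
qed

section \<open>Left ideals and the vanishing of \<open>Ext^1\<close>\<close>

locale plain_ring = ring R for R :: "'a ring" (structure)
begin

lemma left_ideal_module:
  assumes "J \<subseteq> carrier R" "\<zero> \<in> J" "\<And>x y. x \<in> J \<Longrightarrow> y \<in> J \<Longrightarrow> x \<oplus> y \<in> J"
    "\<And>a x. a \<in> carrier R \<Longrightarrow> x \<in> J \<Longrightarrow> a \<otimes> x \<in> J"
  shows "left_module R (regular_module R\<lparr>carrier := J\<rparr>)"
proof (rule left_moduleI)
  show "ring R" by unfold_locales
  show "\<exists>y\<in>carrier (regular_module R\<lparr>carrier := J\<rparr>). y \<oplus>\<^bsub>regular_module R\<lparr>carrier := J\<rparr>\<^esub> x = \<zero>\<^bsub>regular_module R\<lparr>carrier := J\<rparr>\<^esub>"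
    if "x \<in> carrier (regular_module R\<lparr>carrier := J\<rparr>)" for x
  proof (rule bexI[of _ "(\<ominus> \<one>) \<otimes> x"])
    have "x \<in> carrier R" using that assms(1) by (auto simp: regular_module_def)
    then show "(\<ominus> \<one>) \<otimes> x \<oplus>\<^bsub>regular_module R\<lparr>carrier := J\<rparr>\<^esub> x = \<zero>\<^bsub>regular_module R\<lparr>carrier := J\<rparr>\<^esub>"
      by (simp add: regular_module_def l_minus l_neg)
    show "(\<ominus> \<one>) \<otimes> x \<in> carrier (regular_module R\<lparr>carrier := J\<rparr>)"
      using assms(4)[of "\<ominus> \<one>" x] that by (simp add: regular_module_def)
  qed
qed (use assms in \<open>auto simp: regular_module_def a_assoc m_assoc l_distr r_distr subset_iff intro: a_comm\<close>)

lemma regular_left_module: "left_module R (regular_module R)"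
proof -
  have "regular_module R = regular_module R\<lparr>carrier := carrier R\<rparr>" by (simp add: regular_module_def)
  then show ?thesis using left_ideal_module[of "carrier R"] by simp
qed

text \<open>The easy half of Baer's criterion: \<open>y\<close> is the value at
  \<open>\<one>\<close> of an extension from \<open>J\<close> to the whole ring.\<close>

lemma injective_left_ideal:
  fixes E :: "('a, ('a, 'a) module_univ) module"
  assumes E: "injective_module R E"
    and J: "J \<subseteq> carrier R" "\<zero> \<in> J" "\<And>x y. x \<in> J \<Longrightarrow> y \<in> J \<Longrightarrow> x \<oplus> y \<in> J"
      "\<And>a x. a \<in> carrier R \<Longrightarrow> x \<in> J \<Longrightarrow> a \<otimes> x \<in> J"
    and f: "\<And>x. x \<in> J \<Longrightarrow> f x \<in> carrier E" "\<And>x y. x \<in> J \<Longrightarrow> y \<in> J \<Longrightarrow> f (x \<oplus> y) = f x \<oplus>\<^bsub>E\<^esub> f y"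
      "\<And>a x. a \<in> carrier R \<Longrightarrow> x \<in> J \<Longrightarrow> f (a \<otimes> x) = a \<odot>\<^bsub>E\<^esub> f x"
  shows "\<exists>y\<in>carrier E. \<forall>a\<in>J. f a = a \<odot>\<^bsub>E\<^esub> y"
proof -
  \<comment> \<open>Any injection into the universe serves; the third component 0 is a
    filler.\<close>
  define enc :: "'a \<Rightarrow> ('a, 'a) module_univ" where "enc a = {(a, a, 0)}" for a
  let ?J = "regular_module R\<lparr>carrier := J\<rparr>"
  have enc: "inj enc" by (auto simp: inj_def enc_def)
  have fE: "f \<in> lmod_hom R ?J E"
    by (rule lmod_homI) (simp_all add: regular_module_def f)
  have incl: "(\<lambda>x. x) \<in> lmod_hom R ?J (regular_module R)"
    by (rule lmod_homI) (use J(1) in \<open>auto simp: regular_module_def\<close>)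
  have "\<exists>g\<in>lmod_hom R (regular_module R) E. \<forall>x\<in>carrier ?J. g x = f x"
    by (rule injective_extend[OF E enc left_ideal_module[OF J] regular_left_module incl _ fE])
      (auto intro: inj_onI)
  then obtain g where g: "g \<in> lmod_hom R (regular_module R) E" "\<And>x. x \<in> J \<Longrightarrow> g x = f x"
    by auto
  have "f a = a \<odot>\<^bsub>E\<^esub> g \<one>" if "a \<in> J" for a
    using lmod_homD(3)[OF g(1), of a \<one>] g(2)[OF that] subsetD[OF J(1) that]
    by (simp add: regular_module_def)
  moreover have "g \<one> \<in> carrier E" using lmod_homD(1)[OF g(1), of \<one>] by (simp add: regular_module_def)
  ultimately show ?thesis by (intro bexI[of _ "g \<one>"] ballI)
qed

text \<open>This is the vanishing of \<open>Ext\<^sup>1(Rp, R)\<close>, computed from the presentation of \<open>Rp\<close> by \<open>R\<close>.\<close>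

lemma inj_dim_1_annihilator_hom:
  assumes dim: "inj_dim_le R (regular_module R) 1" and p: "p \<in> carrier R"
    and f: "\<And>a. a \<in> carrier R \<Longrightarrow> a \<otimes> p = \<zero> \<Longrightarrow> f a \<in> carrier R"
      "\<And>a b. a \<in> carrier R \<Longrightarrow> a \<otimes> p = \<zero> \<Longrightarrow> b \<in> carrier R \<Longrightarrow> b \<otimes> p = \<zero> \<Longrightarrow> f (a \<oplus> b) = f a \<oplus> f b"
      "\<And>a b. b \<in> carrier R \<Longrightarrow> a \<in> carrier R \<Longrightarrow> a \<otimes> p = \<zero> \<Longrightarrow> f (b \<otimes> a) = b \<otimes> f a"
  shows "\<exists>x\<in>carrier R. \<forall>a\<in>carrier R. a \<otimes> p = \<zero> \<longrightarrow> f a = a \<otimes> x"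
proof -
  obtain E :: "nat \<Rightarrow> ('a, ('a, 'a) module_univ) module" and e d
    where res: "injective_resolution R (regular_module R) E e d"
      and triv: "\<And>i. i > 1 \<Longrightarrow> carrier (E i) = {\<zero>\<^bsub>E i\<^esub>}"
    using dim unfolding inj_dim_le_def by blast
  have inj: "\<And>i. injective_module R (E i)"
    and e: "e \<in> lmod_hom R (regular_module R) (E 0)" "inj_on e (carrier R)"
    and d: "\<And>i. d i \<in> lmod_hom R (E i) (E (Suc i))"
    and ex0: "e ` carrier R = {x \<in> carrier (E 0). d 0 x = \<zero>\<^bsub>E (Suc 0)\<^esub>}"
    and ex1: "d 0 ` carrier (E 0) = {x \<in> carrier (E (Suc 0)). d (Suc 0) x = \<zero>\<^bsub>E 2\<^esub>}"
    using res unfolding injective_resolution_def a_kernel_eq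
    by (auto simp: regular_module_def numeral_2_eq_2)
  have mod: "left_module R (E i)" for i using inj by (simp add: injective_module_def)
  interpret E0: left_module R "E 0" by (rule mod)
  interpret E1: left_module R "E (Suc 0)" by (rule mod)
  \<comment> \<open>\<open>E 2\<close> is zero, so exactness at \<open>E 1\<close> makes
    \<open>d 0\<close> surjective.\<close>
  have onto: "d 0 ` carrier (E 0) = carrier (E (Suc 0))"
    using ex1 triv[of 2] lmod_homD(1)[OF d[of "Suc 0"]] by (auto simp: numeral_2_eq_2)
  have e': "e x \<in> carrier (E 0)" "e (x \<oplus> y) = e x \<oplus>\<^bsub>E 0\<^esub> e y" "e (x \<otimes> y) = x \<odot>\<^bsub>E 0\<^esub> e y"
    if "x \<in> carrier R" "y \<in> carrier R" for x y
    using lmod_homD[OF e(1)] that by (auto simp: regular_module_def)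
  note d0 = lmod_homD[OF d[of 0]]
  let ?J = "{a \<in> carrier R. a \<otimes> p = \<zero>}"
  \<comment> \<open>Inside the injective \<open>E 0\<close>, the map \<open>f\<close> on the left
    annihilator of \<open>p\<close> becomes multiplication by \<open>g\<close>.\<close>
  have "\<exists>g\<in>carrier (E 0). \<forall>a\<in>?J. e (f a) = a \<odot>\<^bsub>E 0\<^esub> g"
    by (rule injective_left_ideal[OF inj])
       (use p f in \<open>auto simp: l_distr m_assoc e'\<close>)
  then obtain g where g: "g \<in> carrier (E 0)" "\<And>a. a \<in> ?J \<Longrightarrow> e (f a) = a \<odot>\<^bsub>E 0\<^esub> g" by blast
  \<comment> \<open>\<open>h\<close> is the map \<open>Rp -> E 1\<close> that sends
    \<open>ap\<close> to \<open>a (d g)\<close>. It is well defined because on the annihilator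
    \<open>a g = e (f a)\<close>, which \<open>d\<close> kills; \<open>SOME\<close> recovers a
    coefficient from \<open>ap\<close>.\<close>
  define h where "h b = d 0 ((SOME a. a \<in> carrier R \<and> b = a \<otimes> p) \<odot>\<^bsub>E 0\<^esub> g)" for b
  have h: "h (a \<otimes> p) = a \<odot>\<^bsub>E (Suc 0)\<^esub> d 0 g" if a: "a \<in> carrier R" for a
  proof -
    define c where "c = (SOME c. c \<in> carrier R \<and> a \<otimes> p = c \<otimes> p)"
    have c: "c \<in> carrier R" "a \<otimes> p = c \<otimes> p"
      using someI[of "\<lambda>c. c \<in> carrier R \<and> a \<otimes> p = c \<otimes> p" a] a by (auto simp: c_def)
    then have cJ: "c \<ominus> a \<in> ?J" using a p by (simp add: a_minus_def l_distr l_minus r_neg)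
    have "d 0 ((c \<ominus> a) \<odot>\<^bsub>E 0\<^esub> g) = \<zero>\<^bsub>E (Suc 0)\<^esub>"
      using g(2)[OF cJ] ex0 f(1)[of "c \<ominus> a"] cJ by (metis (mono_tags, lifting) imageI mem_Collect_eq)
    then have "(c \<ominus> a) \<odot>\<^bsub>E (Suc 0)\<^esub> d 0 g = \<zero>\<^bsub>E (Suc 0)\<^esub>" using d0(3)[of "c \<ominus> a" g] g(1) a c by simp
    moreover have "c = (c \<ominus> a) \<oplus> a" using a c by (simp add: a_minus_def a_assoc l_neg)
    ultimately have "c \<odot>\<^bsub>E (Suc 0)\<^esub> d 0 g = a \<odot>\<^bsub>E (Suc 0)\<^esub> d 0 g"
      using E1.smult_l_distr[of "c \<ominus> a" a "d 0 g"] a c d0(1)[OF g(1)] E1.smult_closed by simp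
    moreover have "h (a \<otimes> p) = c \<odot>\<^bsub>E (Suc 0)\<^esub> d 0 g"
      using d0(3)[OF c(1) g(1)] by (simp add: h_def flip: c_def)
    ultimately show ?thesis by simp
  qed
  let ?P = "(\<lambda>a. a \<otimes> p) ` carrier R"
  have dg: "d 0 g \<in> carrier (E (Suc 0))" using d0(1) g(1) .
  have "\<exists>y\<in>carrier (E (Suc 0)). \<forall>b\<in>?P. h b = b \<odot>\<^bsub>E (Suc 0)\<^esub> y"
  proof (rule injective_left_ideal[OF inj])
    show "\<zero> \<in> ?P" using p by (intro image_eqI[of _ _ \<zero>]) auto
    show "x \<oplus> y \<in> ?P" "h (x \<oplus> y) = h x \<oplus>\<^bsub>E (Suc 0)\<^esub> h y" if xy: "x \<in> ?P" "y \<in> ?P" for x y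
    proof -
      obtain a b where ab: "a \<in> carrier R" "b \<in> carrier R" "x = a \<otimes> p" "y = b \<otimes> p" using xy by blast
      then have "x \<oplus> y = (a \<oplus> b) \<otimes> p" using p by (simp add: l_distr)
      then show "x \<oplus> y \<in> ?P" "h (x \<oplus> y) = h x \<oplus>\<^bsub>E (Suc 0)\<^esub> h y"
        using ab h E1.smult_l_distr dg by auto
    qed
    show "c \<otimes> x \<in> ?P" "h (c \<otimes> x) = c \<odot>\<^bsub>E (Suc 0)\<^esub> h x" if xc: "c \<in> carrier R" "x \<in> ?P" for c x
    proof -
      obtain a where a: "a \<in> carrier R" "x = a \<otimes> p" using xc by blast
      then have "c \<otimes> x = (c \<otimes> a) \<otimes> p" using p xc by (simp add: m_assoc)
      then show "c \<otimes> x \<in> ?P" "h (c \<otimes> x) = c \<odot>\<^bsub>E (Suc 0)\<^esub> h x"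
        using a h E1.smult_assoc dg xc by auto
    qed
  qed (use p h dg E1.smult_closed in auto)
  then obtain y where y: "y \<in> carrier (E (Suc 0))" "\<And>a. a \<in> carrier R \<Longrightarrow> h (a \<otimes> p) = (a \<otimes> p) \<odot>\<^bsub>E (Suc 0)\<^esub> y" by blast
  then obtain z where z: "z \<in> carrier (E 0)" "y = d 0 z" using onto by blast
  \<comment> \<open>\<open>h\<close> is multiplication by \<open>y = d z\<close>, so
    \<open>d (p z) = d g\<close>. Subtracting \<open>p z\<close> from \<open>g\<close> therefore
    gives an element of the kernel of \<open>d 0\<close>, without changing \<open>a g\<close> when
    \<open>a p = 0\<close>.\<close>
  define w where "w = g \<ominus>\<^bsub>E 0\<^esub> p \<odot>\<^bsub>E 0\<^esub> z"
  have pz: "p \<odot>\<^bsub>E 0\<^esub> z \<in> carrier (E 0)" using p z E0.smult_closed by simp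
  have w: "w \<in> carrier (E 0)" using pz g(1) by (simp add: w_def)
  have "d 0 w = d 0 g \<ominus>\<^bsub>E (Suc 0)\<^esub> d 0 (p \<odot>\<^bsub>E 0\<^esub> z)"
    using lmod_hom_diff[OF mod mod d[of 0] g(1) pz] by (simp add: w_def)
  also have "d 0 (p \<odot>\<^bsub>E 0\<^esub> z) = d 0 g"
    using y(2)[of \<one>] h[of \<one>] p z d0(3) dg by (simp add: E1.smult_one)
  finally have "d 0 w = \<zero>\<^bsub>E (Suc 0)\<^esub>" using dg by (simp add: a_minus_def E1.M.r_neg)
  then obtain x where x: "x \<in> carrier R" "w = e x" using ex0 w by blast
  have "f a = a \<otimes> x" if a: "a \<in> carrier R" "a \<otimes> p = \<zero>" for a
  proof -
    have "a \<odot>\<^bsub>E 0\<^esub> w = a \<odot>\<^bsub>E 0\<^esub> g \<ominus>\<^bsub>E 0\<^esub> (a \<otimes> p) \<odot>\<^bsub>E 0\<^esub> z"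
      using a(1) g(1) pz p z(1) by (simp add: w_def E0.smult_diff E0.smult_assoc)
    also have "\<dots> = e (f a)" using a g(2)[of a] g(1) z(1)
      by (simp add: E0.zero_smult a_minus_def E0.smult_closed)
    finally have "e (f a) = e (a \<otimes> x)" using e'(3) a x by simp
    then show ?thesis using e(2) f(1) a x by (auto simp: inj_on_def)
  qed
  then show ?thesis using x(1) by (intro bexI[of _ x]) auto
qed
end

section \<open>Rings with a monomial basis\<close>

text \<open>A ring in this signature has no scalar multiplication, so the field enters through
  coefficient functions: \<open>coef_bij\<close> says that the finite set \<open>N\<close> is a
  basis, and scalars act through the multiples \<open>single k b\<close> of basis elements.\<close>

locale monomial_ring = zero_category N nz m s t len + plain_ring A
  for N :: "'b set" and nz and m and s and t and len and A :: "'a ring" (structure) +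
  fixes coef :: "'a \<Rightarrow> 'b \<Rightarrow> 'k::field"
  assumes coef_bij: "bij_betw coef (carrier A) {f. \<forall>b. b \<notin> N \<longrightarrow> f b = 0}"
    and coef_add: "x \<in> carrier A \<Longrightarrow> y \<in> carrier A \<Longrightarrow> coef (x \<oplus> y) r = coef x r + coef y r"
    and coef_mult: "x \<in> carrier A \<Longrightarrow> y \<in> carrier A \<Longrightarrow>
      coef (x \<otimes> y) r = (\<Sum>(p, q) \<in> {(p, q). nz p q \<and> m p q = r}. coef x p * coef y q)"
    and coef_one: "coef \<one> r = (if r \<in> N \<and> len r = 0 then 1 else 0)"
begin

lemma coef_outside: "x \<in> carrier A \<Longrightarrow> b \<notin> N \<Longrightarrow> coef x b = 0"
  using bij_betwE[OF coef_bij] by blast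

lemma coef_eqI:
  assumes "x \<in> carrier A" "y \<in> carrier A" "\<And>b. b \<in> N \<Longrightarrow> coef x b = coef y b"
  shows "x = y"
proof -
  have "coef x = coef y"
  proof
    show "coef x b = coef y b" for b
      using assms coef_outside by (cases "b \<in> N") auto
  qed
  then show ?thesis using coef_bij assms by (auto simp: bij_betw_def inj_on_def)
qed

definition of_coef :: "('b \<Rightarrow> 'k) \<Rightarrow> 'a" where "of_coef = inv_into (carrier A) coef"

lemma of_coef:
  assumes "\<And>b. b \<notin> N \<Longrightarrow> f b = 0"
  shows of_coef_closed: "of_coef f \<in> carrier A" and coef_of_coef: "coef (of_coef f) = f"
proof -
  have "f \<in> coef ` carrier A" using coef_bij assms by (auto simp: bij_betw_def)
  then show "of_coef f \<in> carrier A" "coef (of_coef f) = f"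
    unfolding of_coef_def by (auto intro: inv_into_into f_inv_into_f)
qed

definition single :: "'k \<Rightarrow> 'b \<Rightarrow> 'a" where "single k b = of_coef (\<lambda>c. if c = b then k else 0)"

lemma single_closed [simp]: "b \<in> N \<Longrightarrow> single k b \<in> carrier A"
  unfolding single_def by (rule of_coef_closed) auto

lemma coef_single: "b \<in> N \<Longrightarrow> coef (single k b) c = (if c = b then k else 0)"
  unfolding single_def by (subst coef_of_coef) auto

lemma coef_zero [simp]: "coef \<zero> b = 0"
  using coef_add[of \<zero> \<zero> b] by (metis add_cancel_right_left l_zero zero_closed)

lemma coef_minus: "x \<in> carrier A \<Longrightarrow> coef (\<ominus> x) b = - coef x b"
  using coef_add[of "\<ominus> x" x b] by (simp add: l_neg eq_neg_iff_add_eq_0)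

lemma single_zero: "b \<in> N \<Longrightarrow> single 0 b = \<zero>"
  by (rule coef_eqI) (auto simp: coef_single)

lemma finite_factorizations: "finite {(p, q). nz p q \<and> m p q = r}"
  by (rule finite_subset[of _ "N \<times> N"]) (auto simp: finite_N nz_memL nz_memR)

lemma finite_right: "finite {q. nz p q}"
  by (rule finite_subset[OF _ finite_N]) (auto simp: nz_memR)

lemma coef_single_mult:
  assumes "nz b c" "x \<in> carrier A"
  shows "coef (single k b \<otimes> x) (m b c) = k * coef x c"
proof -
  have b: "b \<in> N" using nz_memL assms by blast
  have "coef (single k b \<otimes> x) (m b c) =
      (\<Sum>(p, q) \<in> {(p, q). nz p q \<and> m p q = m b c}. coef (single k b) p * coef x q)"
    using b assms by (simp add: coef_mult)
  also have "\<dots> = (\<Sum>(p, q) \<in> {(b, c)}. coef (single k b) p * coef x q)"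
    by (rule sum.mono_neutral_right[OF finite_factorizations])
       (use assms b in \<open>auto simp: coef_single split: if_splits dest: lcancel\<close>)
  finally show ?thesis by (simp add: coef_single b)
qed

lemma coef_single_mult_0:
  assumes "b \<in> N" "x \<in> carrier A" "\<And>c. nz b c \<Longrightarrow> r \<noteq> m b c"
  shows "coef (single k b \<otimes> x) r = 0"
proof -
  have "coef (single k b) p * coef x q = 0" if "nz p q" "m p q = r" for p q
    using that assms(1) assms(3)[of q] by (auto simp: coef_single)
  then show ?thesis using assms(1,2) by (auto simp: coef_mult intro!: sum.neutral)
qed

lemma coef_mult_single:
  assumes "nz c b" "x \<in> carrier A"
  shows "coef (x \<otimes> single k b) (m c b) = coef x c * k"
proof -
  have b: "b \<in> N" using nz_memR assms by blast
  have "coef (x \<otimes> single k b) (m c b) =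
      (\<Sum>(p, q) \<in> {(p, q). nz p q \<and> m p q = m c b}. coef x p * coef (single k b) q)"
    using b assms by (simp add: coef_mult)
  also have "\<dots> = (\<Sum>(p, q) \<in> {(c, b)}. coef x p * coef (single k b) q)"
    by (rule sum.mono_neutral_right[OF finite_factorizations])
       (use assms b in \<open>auto simp: coef_single split: if_splits dest: rcancel\<close>)
  finally show ?thesis by (simp add: coef_single b)
qed

lemma coef_mult_single_0:
  assumes "b \<in> N" "x \<in> carrier A" "\<And>c. nz c b \<Longrightarrow> r \<noteq> m c b"
  shows "coef (x \<otimes> single k b) r = 0"
proof -
  have "coef x p * coef (single k b) q = 0" if "nz p q" "m p q = r" for p q
    using that assms(1) assms(3)[of p] by (auto simp: coef_single)
  then show ?thesis using assms(1,2) by (auto simp: coef_mult intro!: sum.neutral)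
qed

lemma single_mult_single:
  assumes "b \<in> N" "c \<in> N"
  shows "single k b \<otimes> single l c = (if nz b c then single (k * l) (m b c) else \<zero>)"
proof (cases "nz b c")
  case True
  have "coef (single k b \<otimes> single l c) r = coef (single (k * l) (m b c)) r" for r
  proof (cases "r = m b c")
    case False
    have "coef (single k b \<otimes> single l c) r = 0"
      using False assms by (auto simp: coef_mult coef_single intro!: sum.neutral)
    then show ?thesis using False True by (simp add: coef_single m_mem)
  qed (use True assms in \<open>simp add: coef_single_mult coef_single m_mem\<close>)
  then show ?thesis using True assms by (auto intro!: coef_eqI simp: m_mem)
next
  case False
  have "coef (single k b \<otimes> single l c) r = 0" for r
    using False assms by (auto simp: coef_mult coef_single intro!: sum.neutral)
  then show ?thesis using False assms by (auto intro!: coef_eqI)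
qed

text \<open>Distinct \<open>c\<close> with \<open>c q\<close> nonzero give distinct products, so no
  terms can cancel: the left annihilator of a monomial is spanned by monomials.\<close>

lemma mult_single_eq_0_iff:
  assumes "q \<in> N" "a \<in> carrier A"
  shows "a \<otimes> single 1 q = \<zero> \<longleftrightarrow> (\<forall>c. nz c q \<longrightarrow> coef a c = 0)"
proof
  assume "a \<otimes> single 1 q = \<zero>"
  then show "\<forall>c. nz c q \<longrightarrow> coef a c = 0" using coef_mult_single[OF _ assms(2), of _ q 1] by auto
next
  assume r: "\<forall>c. nz c q \<longrightarrow> coef a c = 0"
  have "coef (a \<otimes> single 1 q) r = 0" for r
  proof (cases "\<exists>c. nz c q \<and> r = m c q")
    case True then show ?thesis using r assms coef_mult_single by auto
  next
    case False then show ?thesis using assms coef_mult_single_0 by blast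
  qed
  then show "a \<otimes> single 1 q = \<zero>" using assms by (intro coef_eqI) auto
qed

text \<open>Only monomials in the support of \<open>a\<close> have to be checked, which allows
  induction inside a span such as the radical.\<close>

lemma span_induct:
  assumes a: "a \<in> carrier A" and "P \<zero>"
    and add: "\<And>x y. x \<in> carrier A \<Longrightarrow> y \<in> carrier A \<Longrightarrow> P x \<Longrightarrow> P y \<Longrightarrow> P (x \<oplus> y)"
    and single: "\<And>b k. b \<in> N \<Longrightarrow> coef a b \<noteq> 0 \<Longrightarrow> P (single k b)"
  shows "P a"
proof -
  have "P (of_coef (\<lambda>b. if b \<in> B then coef a b else 0))" if "finite B" "B \<subseteq> N" for B
    using that
  proof (induction B)
    case empty
    have "of_coef (\<lambda>b. if b \<in> {} then coef a b else 0) = \<zero>"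
      by (rule coef_eqI) (auto simp: of_coef)
    then show ?case using \<open>P \<zero>\<close> by simp
  next
    case (insert b B)
    let ?x = "of_coef (\<lambda>b. if b \<in> B then coef a b else 0)"
    have B: "of_coef (\<lambda>c. if c \<in> insert b B then coef a c else 0) \<in> carrier A" "?x \<in> carrier A"
      "coef (of_coef (\<lambda>c. if c \<in> insert b B then coef a c else 0)) = (\<lambda>c. if c \<in> insert b B then coef a c else 0)"
      "coef ?x = (\<lambda>c. if c \<in> B then coef a c else 0)"
      using insert.prems by (auto intro!: of_coef)
    have "of_coef (\<lambda>c. if c \<in> insert b B then coef a c else 0) = single (coef a b) b \<oplus> ?x"
      by (rule coef_eqI) (use insert B in \<open>auto simp: coef_add coef_single\<close>)
    moreover have "P (single (coef a b) b)"
      using single[of b] single_zero[of b] \<open>P \<zero>\<close> insert.prems by (cases "coef a b = 0") auto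
    ultimately show ?case using insert add B(2) by simp
  qed
  from this[OF finite_N] have "P (of_coef (\<lambda>b. if b \<in> N then coef a b else 0))" by simp
  moreover have "of_coef (\<lambda>b. if b \<in> N then coef a b else 0) = a"
    by (rule coef_eqI) (use a in \<open>auto simp: of_coef\<close>)
  ultimately show ?thesis by simp
qed

text \<open>The coefficients stay the same; the sum for products is reindexed by swapping the
  factors.\<close>

lemma monomial_ring_op: "monomial_ring N (\<lambda>x y. nz y x) (\<lambda>x y. m y x) t s len (opposite_ring A) coef"
proof -
  have "ring (opposite_ring A)"
  proof (rule ringI)
    show "abelian_group (opposite_ring A)"
      by (rule abelian_groupI)
         (auto simp: opposite_ring_def a_ac intro: bexI[of _ "\<ominus> _"] l_neg)
    show "Group.monoid (opposite_ring A)"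
      by (rule monoidI) (auto simp: opposite_ring_def m_assoc)
  qed (auto simp: opposite_ring_def l_distr r_distr)
  then interpret op: ring "opposite_ring A" .
  interpret op: zero_category N "\<lambda>x y. nz y x" "\<lambda>x y. m y x" t s len by (rule zero_category_op)
  show ?thesis
  proof unfold_locales
    show "bij_betw coef (carrier (opposite_ring A)) {f. \<forall>b. b \<notin> N \<longrightarrow> f b = 0}"
      using coef_bij by (simp add: opposite_ring_def)
    fix x y r assume xy: "x \<in> carrier (opposite_ring A)" "y \<in> carrier (opposite_ring A)"
    show "coef (x \<oplus>\<^bsub>opposite_ring A\<^esub> y) r = coef x r + coef y r"
      using xy by (simp add: opposite_ring_def coef_add)
    have "coef (y \<otimes> x) r = (\<Sum>(p, q) \<in> {(p, q). nz p q \<and> m p q = r}. coef y p * coef x q)"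
      using xy by (simp add: opposite_ring_def coef_mult)
    also have "\<dots> = (\<Sum>(p, q) \<in> {(p, q). nz q p \<and> m q p = r}. coef x p * coef y q)"
      by (rule sum.reindex_bij_witness[of _ prod.swap prod.swap]) auto
    finally show "coef (x \<otimes>\<^bsub>opposite_ring A\<^esub> y) r = \<dots>" by (simp add: opposite_ring_def)
  next
    show "coef \<one>\<^bsub>opposite_ring A\<^esub> r = (if r \<in> N \<and> len r = 0 then 1 else 0)" for r
      by (simp add: opposite_ring_def coef_one)
  qed
qed

text \<open>For \<open>q\<close> minimal with \<open>qp = 0\<close>, the left annihilator of \<open>p\<close> has \<open>Aq\<close> as a direct summand;
  \<open>proj q\<close> is the projection onto \<open>Aq\<close>.\<close>

definition multiple :: "'b \<Rightarrow> 'b \<Rightarrow> bool" where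
  "multiple q r \<longleftrightarrow> (\<exists>c. nz c q \<and> r = m c q)"

definition proj :: "'b \<Rightarrow> 'a \<Rightarrow> 'a" where
  "proj q a = of_coef (\<lambda>r. if multiple q r then coef a r else 0)"

text \<open>Right division by \<open>q\<close>: of all elements whose product with \<open>q\<close>
  is \<open>proj q a\<close>, this is the one supported on the \<open>c\<close> with
  \<open>c q\<close> nonzero.\<close>

definition quot :: "'b \<Rightarrow> 'a \<Rightarrow> 'a" where
  "quot q a = of_coef (\<lambda>c. if nz c q then coef a (m c q) else 0)"

lemma proj_closed: "proj q a \<in> carrier A"
  and coef_proj: "coef (proj q a) = (\<lambda>r. if multiple q r then coef a r else 0)"
  unfolding proj_def by (auto intro!: of_coef simp: m_mem multiple_def)

lemma quot_closed: "quot q a \<in> carrier A"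
  and coef_quot: "coef (quot q a) = (\<lambda>c. if nz c q then coef a (m c q) else 0)"
  unfolding quot_def by (auto intro!: of_coef simp: nz_memL)

lemma quot_mult: assumes "q \<in> N" shows "quot q a \<otimes> single 1 q = proj q a"
proof (rule coef_eqI)
  fix r
  show "coef (quot q a \<otimes> single 1 q) r = coef (proj q a) r"
  proof (cases "multiple q r")
    case True then show ?thesis by (auto simp: multiple_def coef_proj coef_quot coef_mult_single quot_closed)
  next
    case False
    then have "coef (quot q a \<otimes> single 1 q) r = 0"
      by (intro coef_mult_single_0[OF assms quot_closed]) (auto simp: multiple_def)
    with False show ?thesis by (auto simp: coef_proj)
  qed
qed (use assms in \<open>simp_all add: proj_closed quot_closed\<close>)

text \<open>If \<open>ba\<close> is a left multiple of \<open>q\<close>, then by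
  \<open>overlap\<close> either \<open>a\<close> is one as well, or \<open>a\<close> is a right
  factor of \<open>q\<close> with \<open>zr a p\<close>, which minimality allows only for
  \<open>a = q\<close>. So left multiplication inside the annihilator of \<open>p\<close> neither
  creates nor destroys multiples of \<open>q\<close>.\<close>

lemma lmin_multiple_iff:
  assumes q: "lmin q p" and ba: "nz b a" "\<not> nz a p"
  shows "multiple q (m b a) \<longleftrightarrow> multiple q a"
  unfolding multiple_def
proof
  assume "\<exists>c. nz c q \<and> a = m c q"
  then obtain c where c: "nz c q" "a = m c q" by blast
  then have "nz b c \<and> nz (m b c) q" using nz_assoc[of b c q] ba by simp
  then show "\<exists>c. nz c q \<and> m b a = m c q" using comp_assoc[of b c q] c by metis
next
  assume "\<exists>c. nz c q \<and> m b a = m c q"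
  then obtain c where c: "nz c q" "m b a = m c q" by blast
  from overlap[OF ba(1) c] show "\<exists>c. nz c q \<and> a = m c q"
  proof
    assume "\<exists>u. nz c u \<and> nz u a \<and> b = m c u \<and> q = m u a"
    then obtain u where u: "nz u a" "q = m u a" by blast
    have "zr a p" using ba u q s_m[OF u(1)] by (auto simp: zr_def lmin_def nz_memL nz_memR)
    then have "a = q" using u q unfolding lmin_def by blast
    moreover have "q \<in> N" using q by (simp add: lmin_def zr_def)
    ultimately show ?thesis using nz_t m_t by metis
  next
    assume "\<exists>u. nz b u \<and> nz u q \<and> c = m b u \<and> a = m u q"
    then show ?thesis by blast
  qed
qed

text \<open>Every monomial \<open>y\<close> in \<open>a\<close> has \<open>\<not> nz y p\<close>, so
  multiplying by the monomials of \<open>b\<close> respects the splitting by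
  \<open>multiple q\<close>.\<close>

lemma proj_mult:
  assumes q: "lmin q p" and a: "a \<in> carrier A" "a \<otimes> single 1 p = \<zero>" and b: "b \<in> carrier A"
  shows "proj q (b \<otimes> a) = b \<otimes> proj q a"
proof (rule coef_eqI)
  have p: "p \<in> N" using q by (simp add: lmin_def zr_def)
  fix r
  have "coef (b \<otimes> proj q a) r =
      (\<Sum>(x, y) \<in> {(x, y). nz x y \<and> m x y = r}. coef b x * coef (proj q a) y)"
    by (rule coef_mult) (use b proj_closed in auto)
  also have "\<dots> = (\<Sum>(x, y) \<in> {(x, y). nz x y \<and> m x y = r}.
      if multiple q r then coef b x * coef a y else 0)"
  proof (rule sum.cong[OF refl], clarify)
    fix x y assume xy: "nz x y"
    show "coef b x * coef (proj q a) y =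
        (if multiple q (m x y) then coef b x * coef a y else 0)"
    proof (cases "coef a y = 0")
      case False
      then have "\<not> nz y p" using mult_single_eq_0_iff[OF p a(1)] a(2) by blast
      then show ?thesis using lmin_multiple_iff[OF q xy] by (simp add: coef_proj)
    qed (simp add: coef_proj)
  qed
  also have "\<dots> = coef (proj q (b \<otimes> a)) r"
    using a b by (cases "multiple q r") (simp_all add: coef_proj coef_mult)
  finally show "coef (proj q (b \<otimes> a)) r = coef (b \<otimes> proj q a) r" by simp
qed (use b proj_closed in auto)

lemma proj_add:
  assumes "a \<in> carrier A" "b \<in> carrier A" shows "proj q (a \<oplus> b) = proj q a \<oplus> proj q b"
  by (rule coef_eqI) (use assms in \<open>auto simp: proj_closed coef_proj coef_add\<close>)

section \<open>What injective dimension at most one forces\<close>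

lemma mult_eqI:
  assumes "\<And>a. a \<in> carrier A \<Longrightarrow> a \<otimes> q = \<zero> \<Longrightarrow> a \<otimes> y = \<zero>"
    and "q \<in> carrier A" "y \<in> carrier A" "a \<in> carrier A" "b \<in> carrier A" "a \<otimes> q = b \<otimes> q"
  shows "a \<otimes> y = b \<otimes> y"
proof -
  note [simp] = assms(2-5)
  have "(a \<ominus> b) \<otimes> q = \<zero>" by (simp add: a_minus_def l_distr l_minus assms(6) r_neg)
  then have "(a \<ominus> b) \<otimes> y = \<zero>" by (intro assms(1)) simp_all
  then have "a \<otimes> y \<oplus> \<ominus> (b \<otimes> y) = \<zero>" by (simp add: a_minus_def l_distr l_minus)
  then show ?thesis using minus_equality[of "a \<otimes> y" "\<ominus> (b \<otimes> y)"] by simp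
qed

text \<open>The extension principle is applied to the projection of the left annihilator of
  \<open>p\<close> onto \<open>Aq\<close> followed by the map \<open>Aq -> A\<close> that sends
  \<open>aq\<close> to \<open>ay\<close>; in coordinates this is
  \<open>quot q a \<otimes> y\<close>. The resulting \<open>z\<close> is tested on generators:
  \<open>q\<close> itself gives \<open>y = qz\<close>, and any other minimal \<open>q'\<close> is
  projected to zero.\<close>

lemma inj_dim_1_lmin:
  assumes dim: "inj_dim_le A (regular_module A) 1" and q: "lmin q p"
    and y: "y \<in> carrier A" "\<And>a. a \<in> carrier A \<Longrightarrow> a \<otimes> single 1 q = \<zero> \<Longrightarrow> a \<otimes> y = \<zero>"
  shows "\<exists>z\<in>carrier A. y = single 1 q \<otimes> z \<and> (\<forall>q'. lmin q' p \<and> q' \<noteq> q \<longrightarrow> single 1 q' \<otimes> z = \<zero>)"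
proof -
  have N: "p \<in> N" "q \<in> N" using q by (simp_all add: lmin_def zr_def)
  let ?q = "single 1 q"
  have eq: "quot q a \<otimes> y = c \<otimes> y" if "c \<in> carrier A" "c \<otimes> ?q = proj q a" for a c
  proof (rule mult_eqI[of ?q])
    show "quot q a \<otimes> ?q = c \<otimes> ?q" using that(2) quot_mult[OF N(2)] by simp
  qed (use that(1) N y quot_closed in simp_all)
  have "\<exists>z\<in>carrier A. \<forall>a\<in>carrier A. a \<otimes> single 1 p = \<zero> \<longrightarrow> quot q a \<otimes> y = a \<otimes> z"
  proof (rule inj_dim_1_annihilator_hom[OF dim])
    show "quot q (a \<oplus> b) \<otimes> y = quot q a \<otimes> y \<oplus> quot q b \<otimes> y"
      if "a \<in> carrier A" "b \<in> carrier A" for a b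
    proof -
      have "quot q (a \<oplus> b) \<otimes> y = (quot q a \<oplus> quot q b) \<otimes> y"
        by (rule eq) (use that N in \<open>simp_all add: l_distr quot_mult quot_closed proj_add\<close>)
      then show ?thesis using y(1) quot_closed by (simp add: l_distr)
    qed
    show "quot q (b \<otimes> a) \<otimes> y = b \<otimes> (quot q a \<otimes> y)"
      if "b \<in> carrier A" "a \<in> carrier A" "a \<otimes> single 1 p = \<zero>" for a b
    proof -
      have "quot q (b \<otimes> a) \<otimes> y = (b \<otimes> quot q a) \<otimes> y"
        by (rule eq) (use that N in \<open>simp_all add: m_assoc quot_mult quot_closed proj_mult[OF q]\<close>)
      then show ?thesis using y(1) that(1) quot_closed by (simp add: m_assoc)
    qed
  qed (use N y(1) quot_closed in auto)
  then obtain z where z: "z \<in> carrier A"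
    "\<And>a. a \<in> carrier A \<Longrightarrow> a \<otimes> single 1 p = \<zero> \<Longrightarrow> quot q a \<otimes> y = a \<otimes> z" by blast
  have ann: "single 1 q' \<otimes> single 1 p = \<zero>" if "lmin q' p" for q'
    using that N by (simp add: single_mult_single lmin_def zr_def)
  have "proj q ?q = ?q"
    by (rule coef_eqI) (use N nz_t[of q] m_t[of q] in \<open>auto simp: coef_proj proj_closed coef_single multiple_def\<close>)
  then have "quot q ?q \<otimes> y = \<one> \<otimes> y" using N by (intro eq) auto
  then have "y = ?q \<otimes> z" using z(2)[of ?q] ann[OF q] N y(1) by simp
  moreover have "single 1 q' \<otimes> z = \<zero>" if q': "lmin q' p" "q' \<noteq> q" for q'
  proof -
    have N': "q' \<in> N" using q' by (simp add: lmin_def zr_def)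
    have "\<not> multiple q q'" using q q' unfolding lmin_def multiple_def by metis
    then have "proj q (single 1 q') = \<zero>"
      by (intro coef_eqI) (use N' in \<open>auto simp: coef_proj proj_closed coef_single\<close>)
    then have "quot q (single 1 q') \<otimes> y = \<zero> \<otimes> y" using N by (intro eq) auto
    then show ?thesis using z(2)[of "single 1 q'"] ann[OF q'(1)] N' y(1) by simp
  qed
  ultimately show ?thesis using z by blast
qed

text \<open>For \<open>y = q\<close> the element \<open>z\<close> satisfies \<open>qz = q\<close>
  and \<open>q'z = 0\<close>. Both equations read off the coefficient of \<open>z\<close> at the
  common source of \<open>q\<close> and \<open>q'\<close>, once as 1 and once as 0.\<close>

lemma inj_dim_1_lmin_unique:
  assumes "inj_dim_le A (regular_module A) 1" "lmin q p" "lmin q' p"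
  shows "q = q'"
proof (rule ccontr)
  assume "q \<noteq> q'"
  have N: "p \<in> N" "q \<in> N" "q' \<in> N" and s: "s q = s q'" using assms by (simp_all add: lmin_def zr_def)
  obtain z where z: "z \<in> carrier A" "single 1 q = single 1 q \<otimes> z" "single 1 q' \<otimes> z = \<zero>"
    using inj_dim_1_lmin[OF assms(1,2), of "single 1 q"] assms N \<open>q \<noteq> q'\<close> by auto
  have "coef z (s q) = 1"
    using coef_single_mult[OF nz_s[OF N(2)] z(1), of 1] z(2) N m_s coef_single[OF N(2)] by simp
  moreover have "coef z (s q') = 0"
    using coef_single_mult[OF nz_s[OF N(3)] z(1), of 1] z(3) N m_s by simp
  ultimately show False using s by simp
qed

text \<open>For \<open>y = x\<close> one gets \<open>x = qz\<close> with some element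
  \<open>z\<close>; as left multiplication by \<open>q\<close> produces only monomials of the form
  \<open>qu\<close>, \<open>x\<close> is one of them.\<close>

lemma inj_dim_1_zero_divisor_closed:
  assumes "inj_dim_le A (regular_module A) 1" "lmin q p"
  shows "zero_divisor_closed q"
  unfolding zero_divisor_closed_def
proof (intro ballI impI)
  have N: "q \<in> N" using assms by (simp_all add: lmin_def zr_def)
  fix x assume x: "x \<in> N" "t x = t q \<and> (\<forall>r. zr r q \<longrightarrow> zr r x)"
  have "a \<otimes> single 1 x = \<zero>" if "a \<in> carrier A" "a \<otimes> single 1 q = \<zero>" for a
    unfolding mult_single_eq_0_iff[OF x(1) that(1)]
  proof (intro allI impI)
    fix c assume c: "nz c x"
    then have "\<not> zr c x" by (simp add: zr_def)
    then have "nz c q" using x N nz_memL[OF c] nz_comp[OF c] by (auto simp: zr_def)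
    then show "coef a c = 0" using that mult_single_eq_0_iff[OF N] by blast
  qed
  then obtain z where z: "z \<in> carrier A" "single 1 x = single 1 q \<otimes> z"
    using inj_dim_1_lmin[OF assms, of "single 1 x"] x by auto
  show "\<exists>u. nz q u \<and> x = m q u"
  proof (rule ccontr)
    assume "\<nexists>u. nz q u \<and> x = m q u"
    then have "coef (single 1 q \<otimes> z) x = 0" using N z by (intro coef_single_mult_0) auto
    then show False using coef_single[OF x(1), of 1 x] z by simp
  qed
qed

theorem inj_dim_1_perfect_cyclic:
  assumes "inj_dim_le A (regular_module A) 1"
    and "inj_dim_le (opposite_ring A) (regular_module (opposite_ring A)) 1"
    and "lmin q p" "rmin q p"
  shows "perfect_cyclic p"
proof (rule perfect_cyclic_of_unique)
  interpret op: monomial_ring N "\<lambda>x y. nz y x" "\<lambda>x y. m y x" t s len "opposite_ring A" coef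
    by (rule monomial_ring_op)
  show "p = p'" if "rmin q p" "rmin q p'" for p p' q
    using that by (rule op.inj_dim_1_lmin_unique[OF assms(2), unfolded rmin_op])
qed (use assms inj_dim_1_lmin_unique inj_dim_1_zero_divisor_closed in blast)+

end

section \<open>A criterion for injectivity\<close>

text \<open>The graph of a homomorphism from a submodule of \<open>M\<close>; the last clause makes
  an additive graph single-valued. Graphs are ordered by inclusion, which suits Zorn's
  lemma.\<close>

definition partial_hom :: "'a ring \<Rightarrow> ('a, 'm) module \<Rightarrow> ('a, 'n) module \<Rightarrow> ('m \<times> 'n) set \<Rightarrow> bool" where
  "partial_hom R M E G \<longleftrightarrow> G \<subseteq> carrier M \<times> carrier E \<and>
     (\<forall>u x v y. (u, x) \<in> G \<and> (v, y) \<in> G \<longrightarrow> (u \<oplus>\<^bsub>M\<^esub> v, x \<oplus>\<^bsub>E\<^esub> y) \<in> G) \<and>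
     (\<forall>a u x. a \<in> carrier R \<and> (u, x) \<in> G \<longrightarrow> (a \<odot>\<^bsub>M\<^esub> u, a \<odot>\<^bsub>E\<^esub> x) \<in> G) \<and>
     (\<forall>x. (\<zero>\<^bsub>M\<^esub>, x) \<in> G \<longrightarrow> x = \<zero>\<^bsub>E\<^esub>)"

lemma partial_homD:
  assumes "partial_hom R M E G"
  shows "(u, x) \<in> G \<Longrightarrow> u \<in> carrier M" "(u, x) \<in> G \<Longrightarrow> x \<in> carrier E"
    and "(u, x) \<in> G \<Longrightarrow> (v, y) \<in> G \<Longrightarrow> (u \<oplus>\<^bsub>M\<^esub> v, x \<oplus>\<^bsub>E\<^esub> y) \<in> G"
    and "a \<in> carrier R \<Longrightarrow> (u, x) \<in> G \<Longrightarrow> (a \<odot>\<^bsub>M\<^esub> u, a \<odot>\<^bsub>E\<^esub> x) \<in> G"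
    and "(\<zero>\<^bsub>M\<^esub>, x) \<in> G \<Longrightarrow> x = \<zero>\<^bsub>E\<^esub>"
  using assms unfolding partial_hom_def by blast+

lemma partial_hom_zero:
  assumes "left_module R M" "left_module R E" "partial_hom R M E G" "G \<noteq> {}"
  shows "(\<zero>\<^bsub>M\<^esub>, \<zero>\<^bsub>E\<^esub>) \<in> G"
proof -
  interpret M: left_module R M by fact
  interpret E: left_module R E by fact
  note G = partial_homD[OF assms(3)]
  obtain u x where ux: "(u, x) \<in> G" using assms(4) by auto
  then have "(\<zero>\<^bsub>R\<^esub> \<odot>\<^bsub>M\<^esub> u, \<zero>\<^bsub>R\<^esub> \<odot>\<^bsub>E\<^esub> x) \<in> G" by (intro G(4)) auto
  then show ?thesis using ux G(1,2) by (simp add: M.zero_smult E.zero_smult)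
qed

lemma partial_hom_minus:
  assumes "left_module R M" "left_module R E" "partial_hom R M E G" "(u, x) \<in> G"
  shows "(\<ominus>\<^bsub>M\<^esub> u, \<ominus>\<^bsub>E\<^esub> x) \<in> G"
proof -
  interpret M: left_module R M by fact
  interpret E: left_module R E by fact
  note G = partial_homD[OF assms(3)]
  have "((\<ominus>\<^bsub>R\<^esub> \<one>\<^bsub>R\<^esub>) \<odot>\<^bsub>M\<^esub> u, (\<ominus>\<^bsub>R\<^esub> \<one>\<^bsub>R\<^esub>) \<odot>\<^bsub>E\<^esub> x) \<in> G" using G(4)[OF _ assms(4)] by simp
  then show ?thesis using M.minus_one_smult[OF G(1)[OF assms(4)]] E.minus_one_smult[OF G(2)[OF assms(4)]]
    by simp
qed

lemma partial_hom_unique: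
  assumes "left_module R M" "left_module R E" "partial_hom R M E G" "(u, x) \<in> G" "(u, y) \<in> G"
  shows "x = y"
proof -
  interpret M: left_module R M by fact
  interpret E: left_module R E by fact
  note G = partial_homD[OF assms(3)]
  have u: "u \<in> carrier M" "x \<in> carrier E" "y \<in> carrier E" using G(1,2) assms(4,5) by blast+
  have "(u \<oplus>\<^bsub>M\<^esub> \<ominus>\<^bsub>M\<^esub> u, x \<oplus>\<^bsub>E\<^esub> \<ominus>\<^bsub>E\<^esub> y) \<in> G"
    by (intro G(3) assms(4) partial_hom_minus[OF assms(1-3,5)])
  then have "x \<oplus>\<^bsub>E\<^esub> \<ominus>\<^bsub>E\<^esub> y = \<zero>\<^bsub>E\<^esub>" using G(5) u M.r_neg by simp
  then show ?thesis using E.M.minus_equality[of x "\<ominus>\<^bsub>E\<^esub> y"] u by simp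
qed

lemma maximal_partial_hom:
  assumes "partial_hom R M E G0"
  shows "\<exists>G. partial_hom R M E G \<and> G0 \<subseteq> G \<and> (\<forall>G'. partial_hom R M E G' \<and> G \<subseteq> G' \<longrightarrow> G' = G)"
proof -
  let ?S = "{G. partial_hom R M E G \<and> G0 \<subseteq> G}"
  have "\<Union>C \<in> ?S" if "C \<noteq> {}" "subset.chain ?S C" for C
  proof -
    have C: "partial_hom R M E G" "G0 \<subseteq> G" if "G \<in> C" for G
      using that \<open>subset.chain ?S C\<close> by (auto simp: subset.chain_def)
    \<comment> \<open>Each closure condition involves at most two pairs, and two pairs lie in a
      common member of a chain.\<close>
    have common: "\<exists>G\<in>C. p \<in> G \<and> q \<in> G" if pq: "p \<in> \<Union>C" "q \<in> \<Union>C" for p q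
    proof -
      obtain X Y where XY: "X \<in> C" "p \<in> X" "Y \<in> C" "q \<in> Y" using pq by blast
      moreover have "X \<subseteq> Y \<or> Y \<subseteq> X" using XY \<open>subset.chain ?S C\<close> by (simp add: subset_chain_def)
      ultimately show ?thesis by blast
    qed
    have "G0 \<subseteq> \<Union>C" using \<open>C \<noteq> {}\<close> C(2) by blast
    moreover have "partial_hom R M E (\<Union>C)"
      unfolding partial_hom_def
    proof (intro conjI allI impI)
      show "\<Union>C \<subseteq> carrier M \<times> carrier E"
      proof (rule Union_least)
        show "X \<subseteq> carrier M \<times> carrier E" if "X \<in> C" for X
          using C(1)[OF that] by (simp add: partial_hom_def)
      qed
      show "(u \<oplus>\<^bsub>M\<^esub> v, x \<oplus>\<^bsub>E\<^esub> y) \<in> \<Union>C" if uv: "(u, x) \<in> \<Union>C \<and> (v, y) \<in> \<Union>C" for u x v y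
      proof -
        obtain G where G: "G \<in> C" "(u, x) \<in> G" "(v, y) \<in> G" using common uv by meson
        show ?thesis using partial_homD(3)[OF C(1)[OF G(1)] G(2,3)] G(1) by blast
      qed
      show "(a \<odot>\<^bsub>M\<^esub> u, a \<odot>\<^bsub>E\<^esub> x) \<in> \<Union>C" if au: "a \<in> carrier R \<and> (u, x) \<in> \<Union>C" for a u x
      proof -
        obtain G where G: "G \<in> C" "(u, x) \<in> G" using au by blast
        show ?thesis using partial_homD(4)[OF C(1)[OF G(1)] _ G(2), of a] au G(1) by blast
      qed
      show "x = \<zero>\<^bsub>E\<^esub>" if x: "(\<zero>\<^bsub>M\<^esub>, x) \<in> \<Union>C" for x
      proof -
        obtain G where G: "G \<in> C" "(\<zero>\<^bsub>M\<^esub>, x) \<in> G" using x by blast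
        show ?thesis using partial_homD(5)[OF C(1)[OF G(1)] G(2)] .
      qed
    qed
    ultimately show ?thesis by simp
  qed
  moreover have "?S \<noteq> {}" using assms by blast
  ultimately have "\<exists>G\<in>?S. \<forall>X\<in>?S. G \<subseteq> X \<longrightarrow> X = G" by (rule subset_Zorn_nonempty[rotated])
  then obtain G where G: "partial_hom R M E G" "G0 \<subseteq> G"
    and max: "\<And>X. partial_hom R M E X \<Longrightarrow> G0 \<subseteq> X \<Longrightarrow> G \<subseteq> X \<Longrightarrow> X = G" by auto
  have "X = G" if "partial_hom R M E X" "G \<subseteq> X" for X
    using max[OF that(1) subset_trans[OF G(2) that(2)] that(2)] .
  then show ?thesis using G by (intro exI[of _ G]) simp
qed

text \<open>The domain grows by \<open>Rn\<close>, with \<open>n\<close> sent to \<open>y\<close>. A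
  clash can only come from an \<open>a\<close> with \<open>an\<close> already in the domain, and
  \<open>compat\<close> rules it out.\<close>

lemma partial_hom_adjoin:
  assumes M: "left_module R M" and E: "left_module R E" and G: "partial_hom R M E G" "G \<noteq> {}"
    and n: "n \<in> carrier M" "n \<notin> Domain G" and y: "y \<in> carrier E"
    and compat: "\<And>a. a \<in> carrier R \<Longrightarrow> a \<odot>\<^bsub>M\<^esub> n \<in> Domain G \<Longrightarrow> (a \<odot>\<^bsub>M\<^esub> n, a \<odot>\<^bsub>E\<^esub> y) \<in> G"
  shows "\<exists>G'. partial_hom R M E G' \<and> G \<subset> G'"
proof -
  interpret M: left_module R M by fact
  interpret E: left_module R E by fact
  note G' = partial_homD[OF G(1)]
  note zero = partial_hom_zero[OF M E G]
  define H where "H = {(u \<oplus>\<^bsub>M\<^esub> a \<odot>\<^bsub>M\<^esub> n, x \<oplus>\<^bsub>E\<^esub> a \<odot>\<^bsub>E\<^esub> y) | u x a. (u, x) \<in> G \<and> a \<in> carrier R}"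
  have HI: "(u \<oplus>\<^bsub>M\<^esub> a \<odot>\<^bsub>M\<^esub> n, x \<oplus>\<^bsub>E\<^esub> a \<odot>\<^bsub>E\<^esub> y) \<in> H" if "(u, x) \<in> G" "a \<in> carrier R" for u x a
    using that by (auto simp: H_def)
  have HE: "\<exists>u x a. w = u \<oplus>\<^bsub>M\<^esub> a \<odot>\<^bsub>M\<^esub> n \<and> z = x \<oplus>\<^bsub>E\<^esub> a \<odot>\<^bsub>E\<^esub> y \<and> (u, x) \<in> G \<and> a \<in> carrier R"
    if "(w, z) \<in> H" for w z
    using that by (auto simp: H_def)
  have "partial_hom R M E H"
    unfolding partial_hom_def
  proof (intro conjI allI impI subsetI)
    fix p assume "p \<in> H"
    then show "p \<in> carrier M \<times> carrier E"
      using G'(1,2) n y by (auto simp: H_def M.smult_closed E.smult_closed)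
  next
    fix w z w' z' assume "(w, z) \<in> H \<and> (w', z') \<in> H"
    then obtain u x a u' x' a' where *: "w = u \<oplus>\<^bsub>M\<^esub> a \<odot>\<^bsub>M\<^esub> n" "z = x \<oplus>\<^bsub>E\<^esub> a \<odot>\<^bsub>E\<^esub> y" "(u, x) \<in> G" "a \<in> carrier R"
      "w' = u' \<oplus>\<^bsub>M\<^esub> a' \<odot>\<^bsub>M\<^esub> n" "z' = x' \<oplus>\<^bsub>E\<^esub> a' \<odot>\<^bsub>E\<^esub> y" "(u', x') \<in> G" "a' \<in> carrier R"
      using HE[of w z] HE[of w' z'] by blast
    note c = G'(1)[OF *(3)] G'(1)[OF *(7)] G'(2)[OF *(3)] G'(2)[OF *(7)] *(4,8) n(1) y
    have "w \<oplus>\<^bsub>M\<^esub> w' = (u \<oplus>\<^bsub>M\<^esub> u') \<oplus>\<^bsub>M\<^esub> (a \<oplus>\<^bsub>R\<^esub> a') \<odot>\<^bsub>M\<^esub> n"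
      unfolding * using c by (simp add: M.smult_l_distr M.smult_closed M.a_ac)
    moreover have "z \<oplus>\<^bsub>E\<^esub> z' = (x \<oplus>\<^bsub>E\<^esub> x') \<oplus>\<^bsub>E\<^esub> (a \<oplus>\<^bsub>R\<^esub> a') \<odot>\<^bsub>E\<^esub> y"
      unfolding * using c by (simp add: E.smult_l_distr E.smult_closed E.a_ac)
    ultimately show "(w \<oplus>\<^bsub>M\<^esub> w', z \<oplus>\<^bsub>E\<^esub> z') \<in> H" using HI[OF G'(3)[OF *(3,7)]] c by simp
  next
    fix b w z assume "b \<in> carrier R \<and> (w, z) \<in> H"
    then obtain u x a where *: "w = u \<oplus>\<^bsub>M\<^esub> a \<odot>\<^bsub>M\<^esub> n" "z = x \<oplus>\<^bsub>E\<^esub> a \<odot>\<^bsub>E\<^esub> y" "(u, x) \<in> G" "a \<in> carrier R"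
      "b \<in> carrier R"
      using HE[of w z] by blast
    note c = G'(1)[OF *(3)] G'(2)[OF *(3)] *(4,5) n(1) y
    have "b \<odot>\<^bsub>M\<^esub> w = b \<odot>\<^bsub>M\<^esub> u \<oplus>\<^bsub>M\<^esub> (b \<otimes>\<^bsub>R\<^esub> a) \<odot>\<^bsub>M\<^esub> n"
      unfolding * using c by (simp add: M.smult_r_distr M.smult_closed M.smult_assoc)
    moreover have "b \<odot>\<^bsub>E\<^esub> z = b \<odot>\<^bsub>E\<^esub> x \<oplus>\<^bsub>E\<^esub> (b \<otimes>\<^bsub>R\<^esub> a) \<odot>\<^bsub>E\<^esub> y"
      unfolding * using c by (simp add: E.smult_r_distr E.smult_closed E.smult_assoc)
    ultimately show "(b \<odot>\<^bsub>M\<^esub> w, b \<odot>\<^bsub>E\<^esub> z) \<in> H" using HI[OF G'(4)[OF *(5,3)]] c by simp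
  next
    fix z assume "(\<zero>\<^bsub>M\<^esub>, z) \<in> H"
    then obtain u x a where *: "\<zero>\<^bsub>M\<^esub> = u \<oplus>\<^bsub>M\<^esub> a \<odot>\<^bsub>M\<^esub> n" "z = x \<oplus>\<^bsub>E\<^esub> a \<odot>\<^bsub>E\<^esub> y" "(u, x) \<in> G" "a \<in> carrier R"
      using HE by blast
    note c = G'(1)[OF *(3)] M.smult_closed[OF *(4) n(1)]
    have "\<ominus>\<^bsub>M\<^esub> u = a \<odot>\<^bsub>M\<^esub> n"
      using *(1) c by (intro M.minus_equality) (simp_all add: M.a_comm)
    then have "a \<odot>\<^bsub>M\<^esub> n \<in> Domain G" using partial_hom_minus[OF M E G(1) *(3)] by auto
    then have "(a \<odot>\<^bsub>M\<^esub> n, a \<odot>\<^bsub>E\<^esub> y) \<in> G" using compat *(4) by blast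
    then have "(\<zero>\<^bsub>M\<^esub>, z) \<in> G" using G'(3)[OF *(3)] * by simp
    then show "z = \<zero>\<^bsub>E\<^esub>" by (rule G'(5))
  qed
  moreover have "G \<subseteq> H"
  proof
    fix p assume "p \<in> G"
    then obtain u x where ux: "p = (u, x)" "(u, x) \<in> G" by (cases p) auto
    have "(u \<oplus>\<^bsub>M\<^esub> \<zero>\<^bsub>R\<^esub> \<odot>\<^bsub>M\<^esub> n, x \<oplus>\<^bsub>E\<^esub> \<zero>\<^bsub>R\<^esub> \<odot>\<^bsub>E\<^esub> y) \<in> H" by (rule HI[OF ux(2)]) simp
    then show "p \<in> H" using ux n y G'(1,2)[OF ux(2)] by (simp add: M.zero_smult E.zero_smult)
  qed
  moreover have "n \<in> Domain H"
    using HI[OF zero, of "\<one>\<^bsub>R\<^esub>"] n y by (auto simp: M.smult_one)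
  ultimately show ?thesis using n(2) by blast
qed

text \<open>The graph of \<open>f\<close>, transported along \<open>i\<close>, lies in a maximal
  partial homomorphism, and \<open>adjoin\<close> shows that its domain cannot be proper.\<close>

lemma injective_of_adjoin:
  fixes E :: "('a, 'u) module"
  assumes E: "left_module R E"
    and adjoin: "\<And>(M :: ('a, 'u) module) G. left_module R M \<Longrightarrow> partial_hom R M E G \<Longrightarrow> G \<noteq> {} \<Longrightarrow>
      Domain G \<noteq> carrier M \<Longrightarrow> \<exists>G'. partial_hom R M E G' \<and> G \<subset> G'"
  shows "injective_module R E"
  unfolding injective_module_def
proof (intro conjI allI impI E)
  interpret E: left_module R E by fact
  fix M N :: "('a, 'u) module" and i f
  assume "left_module R M \<and> left_module R N \<and> i \<in> lmod_hom R M N \<and> inj_on i (carrier M) \<and> f \<in> lmod_hom R M E"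
  then have M: "left_module R M" and N: "left_module R N" and i: "i \<in> lmod_hom R M N" "inj_on i (carrier M)"
    and f: "f \<in> lmod_hom R M E" by blast+
  interpret M: left_module R M by fact
  interpret N: left_module R N by fact
  note i' = lmod_homD[OF i(1)] and f' = lmod_homD[OF f]
  define G0 where "G0 = (\<lambda>z. (i z, f z)) ` carrier M"
  have "partial_hom R N E G0"
    unfolding partial_hom_def
  proof (intro conjI allI impI)
    show "G0 \<subseteq> carrier N \<times> carrier E" using i'(1) f'(1) by (auto simp: G0_def)
    show "(u \<oplus>\<^bsub>N\<^esub> v, x \<oplus>\<^bsub>E\<^esub> y) \<in> G0" if uv: "(u, x) \<in> G0 \<and> (v, y) \<in> G0" for u x v y
    proof -
      obtain z z' where "z \<in> carrier M" "u = i z" "x = f z" "z' \<in> carrier M" "v = i z'" "y = f z'"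
        using uv by (auto simp: G0_def)
      then show ?thesis unfolding G0_def by (intro image_eqI[of _ _ "z \<oplus>\<^bsub>M\<^esub> z'"]) (auto simp: i' f')
    qed
    show "(a \<odot>\<^bsub>N\<^esub> u, a \<odot>\<^bsub>E\<^esub> x) \<in> G0" if au: "a \<in> carrier R \<and> (u, x) \<in> G0" for a u x
    proof -
      obtain z where "z \<in> carrier M" "u = i z" "x = f z" using au by (auto simp: G0_def)
      then show ?thesis unfolding G0_def
        using au M.smult_closed by (intro image_eqI[of _ _ "a \<odot>\<^bsub>M\<^esub> z"]) (auto simp: i' f')
    qed
    show "x = \<zero>\<^bsub>E\<^esub>" if x: "(\<zero>\<^bsub>N\<^esub>, x) \<in> G0" for x
    proof -
      obtain z where z: "z \<in> carrier M" "\<zero>\<^bsub>N\<^esub> = i z" "x = f z" using x by (auto simp: G0_def)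
      then have "i z = i \<zero>\<^bsub>M\<^esub>" using lmod_hom_zero[OF M N i(1)] by simp
      then have "z = \<zero>\<^bsub>M\<^esub>" using i(2) z(1) by (auto simp: inj_on_def)
      then show ?thesis using z(3) lmod_hom_zero[OF M E f] by simp
    qed
  qed
  from maximal_partial_hom[OF this] obtain G where G: "partial_hom R N E G" "G0 \<subseteq> G"
    and max: "\<forall>G'. partial_hom R N E G' \<and> G \<subseteq> G' \<longrightarrow> G' = G" by (elim exE conjE)
  have "G \<noteq> {}" using G(2) M.zero_closed by (auto simp: G0_def)
  have dom: "Domain G = carrier N"
  proof (rule ccontr)
    assume "Domain G \<noteq> carrier N"
    then obtain G' where "partial_hom R N E G'" "G \<subset> G'" using adjoin[OF N G(1) \<open>G \<noteq> {}\<close>] by blast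
    then show False using max by blast
  qed
  note G' = partial_homD[OF G(1)]
  define g where "g u = (SOME x. (u, x) \<in> G)" for u
  have gG: "(u, g u) \<in> G" if "u \<in> carrier N" for u
  proof -
    have "u \<in> Domain G" using dom that by simp
    then have "\<exists>x. (u, x) \<in> G" by auto
    then show ?thesis unfolding g_def by (rule someI_ex)
  qed
  have g: "g u = x" if "(u, x) \<in> G" for u x
    using partial_hom_unique[OF N E G(1) gG[OF G'(1)[OF that]] that] .
  have "g \<in> lmod_hom R N E"
  proof (rule lmod_homI)
    show "g u \<in> carrier E" if "u \<in> carrier N" for u using G'(2)[OF gG[OF that]] .
    show "g (u \<oplus>\<^bsub>N\<^esub> v) = g u \<oplus>\<^bsub>E\<^esub> g v" if "u \<in> carrier N" "v \<in> carrier N" for u v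
      by (rule g[OF G'(3)[OF gG[OF that(1)] gG[OF that(2)]]])
    show "g (a \<odot>\<^bsub>N\<^esub> u) = a \<odot>\<^bsub>E\<^esub> g u" if "a \<in> carrier R" "u \<in> carrier N" for a u
      by (rule g[OF G'(4)[OF that(1) gG[OF that(2)]]])
  qed
  moreover have "\<forall>x\<in>carrier M. g (i x) = f x" using g G(2) by (auto simp: G0_def)
  ultimately show "\<exists>g\<in>lmod_hom R N E. \<forall>x\<in>carrier M. g (i x) = f x" by blast
qed

section \<open>Injectivity tested on arrows\<close>

context monomial_ring
begin

definition arrows :: "'b set" where "arrows = {b \<in> N. len b = 1}"

text \<open>The radical of \<open>A\<close> is the direct sum of the left ideals
  \<open>A\<alpha>\<close>, so the family \<open>x\<close> describes a homomorphism from the radical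
  to \<open>E\<close>, and \<open>y\<close> is the value at \<open>\<one>\<close> of an extension to
  \<open>A\<close>.\<close>

definition arrow_extension :: "('a, 'u) module \<Rightarrow> bool" where
  "arrow_extension E \<longleftrightarrow> (\<forall>x.
     (\<forall>\<alpha>\<in>arrows. x \<alpha> \<in> carrier E \<and>
        (\<forall>a\<in>carrier A. a \<otimes> single 1 \<alpha> = \<zero> \<longrightarrow> a \<odot>\<^bsub>E\<^esub> x \<alpha> = \<zero>\<^bsub>E\<^esub>)) \<longrightarrow>
     (\<exists>y\<in>carrier E. \<forall>\<alpha>\<in>arrows. single 1 \<alpha> \<odot>\<^bsub>E\<^esub> y = x \<alpha>))"

lemma single_factor:
  assumes "nz b c" shows "single k (m b c) = single k b \<otimes> single 1 c"
  using assms single_mult_single[of b c k 1] nz_memL nz_memR by simp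

lemma single_t_mult:
  assumes "b \<in> N" shows "single k (t b) \<otimes> single 1 b = single k b"
  using single_factor[OF nz_t[OF assms], of k] m_t[OF assms] by simp

lemma mult_single_t:
  assumes "b \<in> N" shows "single 1 b \<otimes> single k (s b) = single k b"
  using single_mult_single[OF assms s_mem[OF assms], of 1 k] nz_s[OF assms] m_s[OF assms] by simp

text \<open>\<open>Ae\<close> is \<open>Ke\<close> plus its radical part: among the products
  \<open>de\<close>, the only one of length 0 is \<open>e\<close>.\<close>

lemma radical_part:
  assumes a: "a \<in> carrier A" and e: "e \<in> N" "len e = 0" and c: "len c = 0"
  shows "coef (a \<otimes> single 1 e \<ominus> single (coef a e) e) c = 0"
proof -
  have ee: "nz e e" "m e e = e" using nz_t[OF e(1)] m_t[OF e(1)] len_0_t[OF e] by auto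
  have "coef (a \<otimes> single 1 e) c = (if c = e then coef a e else 0)"
  proof (cases "c = e")
    case True
    then show ?thesis using coef_mult_single[OF ee(1) a, of 1] ee by simp
  next
    case False
    have "c \<noteq> m d e" if "nz d e" for d
    proof
      assume "c = m d e"
      then have "len d = 0" using len_m[OF that] c by simp
      then have "d = e" using len_0_s[of d] nz_comp[OF that] len_0_t[OF e] nz_memL[OF that] by simp
      then show False using False \<open>c = m d e\<close> ee by simp
    qed
    then show ?thesis using False coef_mult_single_0[OF e(1) a] by simp
  qed
  then show ?thesis using a e by (simp add: a_minus_def coef_add coef_minus coef_single)
qed

text \<open>A longest monomial \<open>r\<close> with \<open>r n0\<close> outside the domain yields
  an element \<open>n = r n0\<close> that generates a simple module modulo the domain: every arrow
  moves it inside, and \<open>e = t r\<close> fixes it. So the compatibility needed to adjoin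
  \<open>n\<close> concerns only the radical part of \<open>Ae\<close>, where \<open>ext\<close>
  provides the value \<open>y\<close>.\<close>

lemma adjoin_step:
  fixes M :: "('a, 'm) module"
  assumes M: "left_module A M" and E: "left_module A E" and ext: "arrow_extension E"
    and G: "partial_hom A M E G" "G \<noteq> {}" and dom: "Domain G \<noteq> carrier M"
  shows "\<exists>G'. partial_hom A M E G' \<and> G \<subset> G'"
proof -
  interpret M: left_module A M by fact
  interpret E: left_module A E by fact
  note G' = partial_homD[OF G(1)]
  note zero = partial_hom_zero[OF M E G]
  have D_add: "u \<oplus>\<^bsub>M\<^esub> v \<in> Domain G" if "u \<in> Domain G" "v \<in> Domain G" for u v
    using that G'(3) by blast
  have D_smult: "a \<odot>\<^bsub>M\<^esub> u \<in> Domain G" if "a \<in> carrier A" "u \<in> Domain G" for a u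
    using that G'(4) by blast
  have "Domain G \<subseteq> carrier M" using G'(1) by blast
  then obtain n0 where n0: "n0 \<in> carrier M" "n0 \<notin> Domain G" using dom by blast
  define S where "S = {r \<in> N. single 1 r \<odot>\<^bsub>M\<^esub> n0 \<notin> Domain G}"
  have "S \<noteq> {}"
  proof
    assume S: "S = {}"
    have "\<one> \<odot>\<^bsub>M\<^esub> n0 \<in> Domain G"
    proof (rule span_induct[of \<one> "\<lambda>a. a \<odot>\<^bsub>M\<^esub> n0 \<in> Domain G"])
      show "\<zero> \<odot>\<^bsub>M\<^esub> n0 \<in> Domain G" using zero n0 by (auto simp: M.zero_smult)
      show "(x \<oplus> y) \<odot>\<^bsub>M\<^esub> n0 \<in> Domain G" if "x \<in> carrier A" "y \<in> carrier A"
        "x \<odot>\<^bsub>M\<^esub> n0 \<in> Domain G" "y \<odot>\<^bsub>M\<^esub> n0 \<in> Domain G" for x y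
        using that D_add n0 by (simp add: M.smult_l_distr)
      show "single k b \<odot>\<^bsub>M\<^esub> n0 \<in> Domain G" if "b \<in> N" for b k
      proof -
        have "single 1 b \<odot>\<^bsub>M\<^esub> n0 \<in> Domain G" using S that by (auto simp: S_def)
        then have "single k (t b) \<odot>\<^bsub>M\<^esub> (single 1 b \<odot>\<^bsub>M\<^esub> n0) \<in> Domain G"
          using D_smult t_mem[OF that] by simp
        then show ?thesis
          using M.smult_assoc[of "single k (t b)" "single 1 b" n0] that t_mem[OF that] n0
          by (simp add: single_t_mult)
      qed
    qed simp
    then show False using n0 by (simp add: M.smult_one)
  qed
  moreover have "finite S" using finite_N by (simp add: S_def)
  ultimately have "Max (len ` S) \<in> len ` S" by simp
  then obtain r where r: "r \<in> S" "len r = Max (len ` S)" by auto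
  have r_max: "len q \<le> len r" if "q \<in> S" for q
    using that \<open>finite S\<close> by (simp add: r(2))
  have rN: "r \<in> N" using r(1) by (simp add: S_def)
  define e where "e = t r"
  have e: "e \<in> N" "len e = 0" using t_mem[OF rN] len_t[OF rN] by (auto simp: e_def)
  have ee: "single 1 e \<otimes> single 1 e = single 1 e"
    using single_t_mult[OF e(1), of 1] len_0_t[OF e] by simp
  define n where "n = single 1 r \<odot>\<^bsub>M\<^esub> n0"
  have n: "n \<in> carrier M" "n \<notin> Domain G" using r(1) rN n0 by (auto simp: n_def S_def M.smult_closed)
  have en: "single 1 e \<odot>\<^bsub>M\<^esub> n = n"
    using M.smult_assoc[of "single 1 e" "single 1 r" n0] n0 e rN single_t_mult[OF rN, of 1]
    by (simp add: n_def e_def)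
  have arr: "single 1 \<alpha> \<odot>\<^bsub>M\<^esub> n \<in> Domain G" if \<alpha>: "\<alpha> \<in> arrows" for \<alpha>
  proof -
    have eq: "single 1 \<alpha> \<odot>\<^bsub>M\<^esub> n = (single 1 \<alpha> \<otimes> single 1 r) \<odot>\<^bsub>M\<^esub> n0"
      using \<alpha> rN n0 by (simp add: n_def arrows_def M.smult_assoc)
    show ?thesis
    proof (cases "nz \<alpha> r")
      case True
      then have "m \<alpha> r \<notin> S" using r_max[of "m \<alpha> r"] len_m[OF True] \<alpha> by (auto simp: arrows_def)
      then show ?thesis using eq single_factor[OF True, of 1] m_mem[OF True] by (auto simp: S_def)
    next
      case False
      then show ?thesis using eq \<alpha> rN single_mult_single[of \<alpha> r 1 1] n0 zero
        by (auto simp: arrows_def M.zero_smult)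
    qed
  qed
  define x where "x \<alpha> = (SOME x. (single 1 \<alpha> \<odot>\<^bsub>M\<^esub> n, x) \<in> G)" for \<alpha>
  have x: "(single 1 \<alpha> \<odot>\<^bsub>M\<^esub> n, x \<alpha>) \<in> G" if "\<alpha> \<in> arrows" for \<alpha>
    unfolding x_def by (rule someI_ex) (use arr[OF that] in blast)
  have "\<exists>y\<in>carrier E. \<forall>\<alpha>\<in>arrows. single 1 \<alpha> \<odot>\<^bsub>E\<^esub> y = x \<alpha>"
  proof (rule ext[unfolded arrow_extension_def, rule_format], intro conjI ballI impI)
    fix \<alpha> assume \<alpha>: "\<alpha> \<in> arrows"
    show "x \<alpha> \<in> carrier E" using G'(2) x[OF \<alpha>] .
    fix a assume a: "a \<in> carrier A" "a \<otimes> single 1 \<alpha> = \<zero>"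
    have "a \<odot>\<^bsub>M\<^esub> (single 1 \<alpha> \<odot>\<^bsub>M\<^esub> n) = \<zero>\<^bsub>M\<^esub>"
      using M.smult_assoc[of a "single 1 \<alpha>" n] a \<alpha> n by (simp add: arrows_def M.zero_smult)
    then show "a \<odot>\<^bsub>E\<^esub> x \<alpha> = \<zero>\<^bsub>E\<^esub>" using G'(4)[OF a(1) x[OF \<alpha>]] G'(5) by simp
  qed
  then obtain y0 where y0: "y0 \<in> carrier E" "\<And>\<alpha>. \<alpha> \<in> arrows \<Longrightarrow> single 1 \<alpha> \<odot>\<^bsub>E\<^esub> y0 = x \<alpha>" by blast
  \<comment> \<open>\<open>n\<close> is fixed by \<open>e\<close>, so its image has to be fixed too;
    multiplying by \<open>e\<close> does not change the products with arrows of source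
    \<open>e\<close>.\<close>
  define y where "y = single 1 e \<odot>\<^bsub>E\<^esub> y0"
  have y: "y \<in> carrier E" using e y0 by (simp add: y_def E.smult_closed)
  have ey: "single 1 e \<odot>\<^bsub>E\<^esub> y = y"
    using E.smult_assoc[of "single 1 e" "single 1 e" y0] e y0 ee by (simp add: y_def)
  have arrG: "(single 1 \<alpha> \<odot>\<^bsub>M\<^esub> n, single 1 \<alpha> \<odot>\<^bsub>E\<^esub> y) \<in> G" if \<alpha>: "\<alpha> \<in> arrows" for \<alpha>
  proof -
    have \<alpha>N: "\<alpha> \<in> N" using \<alpha> by (simp add: arrows_def)
    have y1: "single 1 \<alpha> \<odot>\<^bsub>E\<^esub> y = (single 1 \<alpha> \<otimes> single 1 e) \<odot>\<^bsub>E\<^esub> y0"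
      using \<alpha>N e y0 by (simp add: y_def E.smult_assoc)
    have n1: "single 1 \<alpha> \<odot>\<^bsub>M\<^esub> n = (single 1 \<alpha> \<otimes> single 1 e) \<odot>\<^bsub>M\<^esub> n"
      using \<alpha>N e n en by (simp add: M.smult_assoc)
    show ?thesis
    proof (cases "nz \<alpha> e")
      case True
      then have "s \<alpha> = e" using nz_comp len_0_t[OF e] by simp
      then have "single 1 \<alpha> \<otimes> single 1 e = single 1 \<alpha>" using mult_single_t[OF \<alpha>N] by simp
      then show ?thesis using y1 x[OF \<alpha>] y0(2)[OF \<alpha>] by simp
    next
      case False
      then have "single 1 \<alpha> \<otimes> single 1 e = \<zero>" using single_mult_single[OF \<alpha>N e(1)] by simp
      then show ?thesis using y1 n1 zero n y0 by (simp add: M.zero_smult E.zero_smult)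
    qed
  qed
  have rad: "(\<rho> \<odot>\<^bsub>M\<^esub> n, \<rho> \<odot>\<^bsub>E\<^esub> y) \<in> G" if \<rho>: "\<rho> \<in> carrier A" "\<And>c. len c = 0 \<Longrightarrow> coef \<rho> c = 0" for \<rho>
  proof (rule span_induct[OF \<rho>(1)])
    show "(\<zero> \<odot>\<^bsub>M\<^esub> n, \<zero> \<odot>\<^bsub>E\<^esub> y) \<in> G" using zero n y by (simp add: M.zero_smult E.zero_smult)
    show "((a \<oplus> b) \<odot>\<^bsub>M\<^esub> n, (a \<oplus> b) \<odot>\<^bsub>E\<^esub> y) \<in> G" if "a \<in> carrier A" "b \<in> carrier A"
      "(a \<odot>\<^bsub>M\<^esub> n, a \<odot>\<^bsub>E\<^esub> y) \<in> G" "(b \<odot>\<^bsub>M\<^esub> n, b \<odot>\<^bsub>E\<^esub> y) \<in> G" for a b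
      using G'(3)[OF that(3,4)] that(1,2) n y by (simp add: M.smult_l_distr E.smult_l_distr)
    fix b k assume b: "b \<in> N" "coef \<rho> b \<noteq> 0"
    then have "0 < len b" using \<rho>(2) by blast
    then obtain d \<alpha> where d: "nz d \<alpha>" "len \<alpha> = 1" "b = m d \<alpha>" using first_arrow b by blast
    have \<alpha>: "\<alpha> \<in> arrows" "d \<in> N" "\<alpha> \<in> N" using d nz_memL nz_memR by (auto simp: arrows_def)
    have "(single k d \<odot>\<^bsub>M\<^esub> (single 1 \<alpha> \<odot>\<^bsub>M\<^esub> n), single k d \<odot>\<^bsub>E\<^esub> (single 1 \<alpha> \<odot>\<^bsub>E\<^esub> y)) \<in> G"
      by (rule G'(4)[OF _ arrG]) (use \<alpha> in auto)
    then show "(single k b \<odot>\<^bsub>M\<^esub> n, single k b \<odot>\<^bsub>E\<^esub> y) \<in> G"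
      using \<alpha> n y by (simp add: d(3) single_factor[OF d(1)] M.smult_assoc E.smult_assoc)
  qed
  show ?thesis
  proof (rule partial_hom_adjoin[OF M E G n y])
    fix a assume a: "a \<in> carrier A" "a \<odot>\<^bsub>M\<^esub> n \<in> Domain G"
    define \<rho> where "\<rho> = a \<otimes> single 1 e \<ominus> single (coef a e) e"
    have \<rho>: "\<rho> \<in> carrier A" using a e by (simp add: \<rho>_def)
    have sum: "a \<otimes> single 1 e = \<rho> \<oplus> single (coef a e) e"
      using a e by (simp add: \<rho>_def a_minus_def a_assoc l_neg)
    have \<rho>G: "(\<rho> \<odot>\<^bsub>M\<^esub> n, \<rho> \<odot>\<^bsub>E\<^esub> y) \<in> G"
      by (rule rad[OF \<rho>]) (simp add: \<rho>_def radical_part[OF a(1) e])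
    have an: "a \<odot>\<^bsub>M\<^esub> n = \<rho> \<odot>\<^bsub>M\<^esub> n \<oplus>\<^bsub>M\<^esub> single (coef a e) e \<odot>\<^bsub>M\<^esub> n"
    proof -
      have "a \<odot>\<^bsub>M\<^esub> n = (a \<otimes> single 1 e) \<odot>\<^bsub>M\<^esub> n" using M.smult_assoc[OF a(1) _ n(1), of "single 1 e"] e en by simp
      then show ?thesis using sum \<rho> e n by (simp add: M.smult_l_distr)
    qed
    \<comment> \<open>Otherwise \<open>an\<close> differs from an invertible multiple of
      \<open>n\<close> by an element of the domain, and \<open>n\<close> would lie in the
      domain.\<close>
    have "coef a e = 0"
    proof (rule ccontr)
      assume k: "coef a e \<noteq> 0"
      let ?k = "coef a e"
      have cn: "\<rho> \<odot>\<^bsub>M\<^esub> n \<in> carrier M" "single ?k e \<odot>\<^bsub>M\<^esub> n \<in> carrier M"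
        using \<rho> e n by (simp_all add: M.smult_closed)
      have "\<ominus>\<^bsub>M\<^esub> (\<rho> \<odot>\<^bsub>M\<^esub> n) \<in> Domain G" using partial_hom_minus[OF M E G(1) \<rho>G] by blast
      then have "\<ominus>\<^bsub>M\<^esub> (\<rho> \<odot>\<^bsub>M\<^esub> n) \<oplus>\<^bsub>M\<^esub> a \<odot>\<^bsub>M\<^esub> n \<in> Domain G" using D_add a(2) by blast
      then have "single ?k e \<odot>\<^bsub>M\<^esub> n \<in> Domain G" using an cn by (simp add: M.a_assoc[symmetric] M.l_neg)
      then have "single (inverse ?k) e \<odot>\<^bsub>M\<^esub> (single ?k e \<odot>\<^bsub>M\<^esub> n) \<in> Domain G" using D_smult e by simp
      moreover have "single (inverse ?k) e \<otimes> single ?k e = single 1 e"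
        using single_mult_single[OF e(1) e(1), of "inverse ?k" ?k] k nz_t[OF e(1)] m_t[OF e(1)] len_0_t[OF e]
        by simp
      ultimately have "single 1 e \<odot>\<^bsub>M\<^esub> n \<in> Domain G"
        using M.smult_assoc[of "single (inverse ?k) e" "single ?k e" n] e n by simp
      then show False using en n by simp
    qed
    then have "a \<otimes> single 1 e = \<rho>" using sum \<rho> e by (simp add: single_zero)
    then have "a \<odot>\<^bsub>M\<^esub> n = \<rho> \<odot>\<^bsub>M\<^esub> n" "a \<odot>\<^bsub>E\<^esub> y = \<rho> \<odot>\<^bsub>E\<^esub> y"
      using M.smult_assoc[OF a(1) _ n(1), of "single 1 e"] E.smult_assoc[OF a(1) _ y, of "single 1 e"] e en ey
      by simp_all
    then show "(a \<odot>\<^bsub>M\<^esub> n, a \<odot>\<^bsub>E\<^esub> y) \<in> G" using \<rho>G by simp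
  qed
qed

theorem injective_of_arrow_extension:
  assumes "left_module A E" "arrow_extension E"
  shows "injective_module A E"
  by (rule injective_of_adjoin[OF assms(1) adjoin_step[OF _ assms]])

end

section \<open>The injective resolution\<close>

context monomial_ring
begin

text \<open>Coordinates of \<open>Hom\<^sub>K(A, A)\<close>: \<open>\<phi> b r\<close> is the coefficient of \<open>r\<close> in the value at \<open>b\<close>, and \<open>a\<close> acts
  by \<open>(a\<phi>)(b) = \<phi>(ba)\<close>.\<close>

definition dual :: "('a, 'b \<Rightarrow> 'b \<Rightarrow> 'k) module" where
  "dual = \<lparr>carrier = {\<phi>. \<forall>b r. b \<notin> N \<or> r \<notin> N \<longrightarrow> \<phi> b r = 0}, monoid.mult = undefined, one = undefined,
     zero = (\<lambda>b r. 0), add = (\<lambda>\<phi> \<psi> b r. \<phi> b r + \<psi> b r),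
     module.smult = (\<lambda>a \<phi> b r. \<Sum>c | nz b c. coef a c * \<phi> (m b c) r)\<rparr>"

lemma dual_simps:
  "\<phi> \<in> carrier dual \<longleftrightarrow> (\<forall>b r. b \<notin> N \<or> r \<notin> N \<longrightarrow> \<phi> b r = 0)"
  "\<zero>\<^bsub>dual\<^esub> = (\<lambda>b r. 0)"
  "\<phi> \<oplus>\<^bsub>dual\<^esub> \<psi> = (\<lambda>b r. \<phi> b r + \<psi> b r)"
  "a \<odot>\<^bsub>dual\<^esub> \<phi> = (\<lambda>b r. \<Sum>c | nz b c. coef a c * \<phi> (m b c) r)"
  by (simp_all add: dual_def)

lemma sum_coef_mult:
  assumes "a \<in> carrier A" "b \<in> carrier A" "finite C"
  shows "(\<Sum>c\<in>C. coef (a \<otimes> b) c * g c) =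
    (\<Sum>(p, q) \<in> {(p, q). nz p q \<and> m p q \<in> C}. coef a p * coef b q * g (m p q))"
proof -
  let ?h = "\<lambda>(p, q). coef a p * coef b q * g (m p q)"
  let ?S = "{(p, q). nz p q \<and> m p q \<in> C}"
  have fin: "finite ?S"
    by (rule finite_subset[of _ "N \<times> N"]) (auto simp: finite_N nz_memL nz_memR)
  have "coef (a \<otimes> b) c * g c = sum ?h {x \<in> ?S. (\<lambda>(p, q). m p q) x = c}" if "c \<in> C" for c
  proof -
    have "coef (a \<otimes> b) c * g c = (\<Sum>x \<in> {(p, q). nz p q \<and> m p q = c}. (case x of (p, q) \<Rightarrow> coef a p * coef b q) * g c)"
      using assms by (simp add: coef_mult sum_distrib_right)
    also have "\<dots> = sum ?h {x \<in> ?S. (\<lambda>(p, q). m p q) x = c}"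
      by (rule sum.cong) (use that in auto)
    finally show ?thesis .
  qed
  then have "(\<Sum>c\<in>C. coef (a \<otimes> b) c * g c) = (\<Sum>c\<in>C. sum ?h {x \<in> ?S. (\<lambda>(p, q). m p q) x = c})"
    by simp
  also have "\<dots> = sum ?h ?S" by (rule sum.group[OF fin assms(3)]) auto
  finally show ?thesis .
qed

lemma dual_smult_assoc:
  assumes "a \<in> carrier A" "b \<in> carrier A" "\<phi> \<in> carrier dual"
  shows "(a \<otimes> b) \<odot>\<^bsub>dual\<^esub> \<phi> = a \<odot>\<^bsub>dual\<^esub> (b \<odot>\<^bsub>dual\<^esub> \<phi>)"
proof (intro ext)
  fix \<beta> r
  have "((a \<otimes> b) \<odot>\<^bsub>dual\<^esub> \<phi>) \<beta> r = (\<Sum>(p, q) \<in> {(p, q). nz p q \<and> m p q \<in> {c. nz \<beta> c}}.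
      coef a p * coef b q * \<phi> (m \<beta> (m p q)) r)"
    unfolding dual_simps by (rule sum_coef_mult) (use assms finite_right in auto)
  also have "\<dots> = (\<Sum>(p, q) \<in> (SIGMA p:{p. nz \<beta> p}. {q. nz (m \<beta> p) q}).
      coef a p * (coef b q * \<phi> (m (m \<beta> p) q) r))"
  proof (rule sum.cong)
    show "{(p, q). nz p q \<and> m p q \<in> {c. nz \<beta> c}} = (SIGMA p:{p. nz \<beta> p}. {q. nz (m \<beta> p) q})"
      using nz_assoc by auto
  qed (auto simp: comp_assoc)
  also have "\<dots> = (\<Sum>p | nz \<beta> p. \<Sum>q | nz (m \<beta> p) q. coef a p * (coef b q * \<phi> (m (m \<beta> p) q) r))"
    by (rule sum.Sigma[symmetric]) (auto simp: finite_right)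
  also have "\<dots> = (a \<odot>\<^bsub>dual\<^esub> (b \<odot>\<^bsub>dual\<^esub> \<phi>)) \<beta> r"
    by (simp add: dual_simps sum_distrib_left)
  finally show "((a \<otimes> b) \<odot>\<^bsub>dual\<^esub> \<phi>) \<beta> r = (a \<odot>\<^bsub>dual\<^esub> (b \<odot>\<^bsub>dual\<^esub> \<phi>)) \<beta> r" .
qed

lemma dual_single_smult:
  assumes "c \<in> N" shows "(single k c \<odot>\<^bsub>dual\<^esub> \<phi>) b r = (if nz b c then k * \<phi> (m b c) r else 0)"
proof -
  have "(single k c \<odot>\<^bsub>dual\<^esub> \<phi>) b r = (\<Sum>d | nz b d. if d = c then k * \<phi> (m b c) r else 0)"
    unfolding dual_simps by (rule sum.cong) (use assms in \<open>auto simp: coef_single\<close>)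
  also have "\<dots> = (if nz b c then k * \<phi> (m b c) r else 0)"
    by (simp add: sum.delta finite_right)
  finally show ?thesis .
qed

lemma dual_smult_closed: "\<phi> \<in> carrier dual \<Longrightarrow> a \<odot>\<^bsub>dual\<^esub> \<phi> \<in> carrier dual"
  by (auto simp: dual_simps nz_memL intro!: sum.neutral)

lemma dual_one_smult:
  assumes "\<phi> \<in> carrier dual" shows "\<one> \<odot>\<^bsub>dual\<^esub> \<phi> = \<phi>"
proof (intro ext)
  fix b r
  show "(\<one> \<odot>\<^bsub>dual\<^esub> \<phi>) b r = \<phi> b r"
  proof (cases "b \<in> N")
    case True
    have "coef \<one> c * \<phi> (m b c) r = (if c = s b then \<phi> b r else 0)" if c: "nz b c" for c
    proof (cases "len c = 0")
      case True
      then have "c = s b" using nz_comp[OF c] len_0_t[OF nz_memR[OF c]] by simp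
      then show ?thesis using True m_s[OF \<open>b \<in> N\<close>] nz_memR[OF c] by (simp add: coef_one)
    next
      case False
      then have "c \<noteq> s b" using len_s[OF \<open>b \<in> N\<close>] by auto
      then show ?thesis using False by (simp add: coef_one)
    qed
    then have "(\<one> \<odot>\<^bsub>dual\<^esub> \<phi>) b r = (\<Sum>c | nz b c. if c = s b then \<phi> b r else 0)"
      unfolding dual_simps by (intro sum.cong refl) simp
    then show ?thesis using True nz_s by (simp add: sum.delta finite_right)
  next
    case False
    then have "(\<one> \<odot>\<^bsub>dual\<^esub> \<phi>) b r = 0"
      by (auto simp: dual_simps dest: nz_memL intro!: sum.neutral)
    then show ?thesis using assms False by (simp add: dual_simps)
  qed
qed

lemma dual_left_module: "left_module A dual"
proof (rule left_moduleI)
  show "ring A" by unfold_locales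
  show "\<exists>\<psi>\<in>carrier dual. \<psi> \<oplus>\<^bsub>dual\<^esub> \<phi> = \<zero>\<^bsub>dual\<^esub>" if "\<phi> \<in> carrier dual" for \<phi>
    by (rule bexI[of _ "\<lambda>b r. - \<phi> b r"]) (use that in \<open>auto simp: dual_simps\<close>)
  show "(a \<otimes> b) \<odot>\<^bsub>dual\<^esub> \<phi> = a \<odot>\<^bsub>dual\<^esub> (b \<odot>\<^bsub>dual\<^esub> \<phi>)"
    if "a \<in> carrier A" "b \<in> carrier A" "\<phi> \<in> carrier dual" for a b \<phi>
    by (rule dual_smult_assoc[OF that])
  show "\<one> \<odot>\<^bsub>dual\<^esub> \<phi> = \<phi>" if "\<phi> \<in> carrier dual" for \<phi>
    by (rule dual_one_smult[OF that])
  show "a \<odot>\<^bsub>dual\<^esub> \<phi> \<in> carrier dual" if "\<phi> \<in> carrier dual" for a \<phi>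
    by (rule dual_smult_closed[OF that])
  show "(a \<oplus> b) \<odot>\<^bsub>dual\<^esub> \<phi> = a \<odot>\<^bsub>dual\<^esub> \<phi> \<oplus>\<^bsub>dual\<^esub> b \<odot>\<^bsub>dual\<^esub> \<phi>"
    if "a \<in> carrier A" "b \<in> carrier A" for a b \<phi>
    using that by (intro ext) (simp add: dual_simps coef_add distrib_right sum.distrib)
  show "a \<odot>\<^bsub>dual\<^esub> (\<phi> \<oplus>\<^bsub>dual\<^esub> \<psi>) = a \<odot>\<^bsub>dual\<^esub> \<phi> \<oplus>\<^bsub>dual\<^esub> a \<odot>\<^bsub>dual\<^esub> \<psi>" for a \<phi> \<psi>
    by (intro ext) (simp add: dual_simps distrib_left sum.distrib)
qed (simp_all add: dual_simps add_ac)

text \<open>Directness of the sum of the \<open>A\<alpha>\<close>: by \<open>overlap\<close> one of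
  the right factors contains the other, and both have length 1.\<close>

lemma last_arrow_unique:
  assumes "nz c \<alpha>" "nz c' \<alpha>'" "len \<alpha> = 1" "len \<alpha>' = 1" "m c \<alpha> = m c' \<alpha>'"
  shows "\<alpha> = \<alpha>' \<and> c = c'"
proof -
  have same: "b = b'" if "nz u b" "b' = m u b" "len b = 1" "len b' = 1" for u b b'
    using that len_m[OF that(1)] len_factorL[OF that(1)] by simp
  have "\<alpha> = \<alpha>'" using overlap[OF assms(1,2,5)] same assms(3,4) by metis
  then show ?thesis using rcancel assms by blast
qed

text \<open>In coordinates the equation at \<open>\<alpha>\<close> reads
  \<open>y (c \<alpha>) = z \<alpha> c\<close>, and it defines \<open>y\<close> on all paths with an
  arrow on the right, on each in one way. Where \<open>c \<alpha>\<close> is zero, the annihilator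
  condition makes \<open>z \<alpha> c\<close> vanish.\<close>

lemma dual_arrow_extension:
  assumes z: "\<And>\<alpha>. \<alpha> \<in> arrows \<Longrightarrow> z \<alpha> \<in> carrier dual"
    and ann: "\<And>\<alpha> a. \<alpha> \<in> arrows \<Longrightarrow> a \<in> carrier A \<Longrightarrow> a \<otimes> single 1 \<alpha> = \<zero> \<Longrightarrow> a \<odot>\<^bsub>dual\<^esub> z \<alpha> = \<zero>\<^bsub>dual\<^esub>"
  shows "\<exists>y\<in>carrier dual. \<forall>\<alpha>\<in>arrows. single 1 \<alpha> \<odot>\<^bsub>dual\<^esub> y = z \<alpha>"
proof -
  define P where "P b x \<longleftrightarrow> nz (fst x) (snd x) \<and> len (snd x) = 1 \<and> b = m (fst x) (snd x)" for b x
  \<comment> \<open>Elements without such a factorisation, in particular the identities, occur in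
    none of the equations and get the value 0.\<close>
  define y where "y b r = (if \<exists>x. P b x then z (snd (SOME x. P b x)) (fst (SOME x. P b x)) r else 0)" for b r
  have y: "y (m c \<alpha>) r = z \<alpha> c r" if "nz c \<alpha>" "len \<alpha> = 1" for c \<alpha> r
  proof -
    have P: "P (m c \<alpha>) (c, \<alpha>)" using that by (simp add: P_def)
    have uniq: "x = (c, \<alpha>)" if "P (m c \<alpha>) x" for x
      using last_arrow_unique[of c \<alpha> "fst x" "snd x"] that \<open>nz c \<alpha>\<close> \<open>len \<alpha> = 1\<close>
      by (auto simp: P_def prod_eq_iff)
    have "(SOME x. P (m c \<alpha>) x) = (c, \<alpha>)" using P uniq by (rule some_equality)
    moreover have "\<exists>x. P (m c \<alpha>) x" using P by blast
    ultimately show ?thesis by (simp add: y_def)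
  qed
  have "y \<in> carrier dual"
    unfolding dual_simps
  proof (intro allI impI)
    fix b r assume br: "b \<notin> N \<or> r \<notin> N"
    show "y b r = 0"
    proof (cases "\<exists>x. P b x")
      case True
      then obtain c \<alpha> where c: "nz c \<alpha>" "len \<alpha> = 1" "b = m c \<alpha>" by (auto simp: P_def)
      then have "r \<notin> N" using br m_mem by auto
      moreover have "\<alpha> \<in> arrows" using c nz_memR by (simp add: arrows_def)
      ultimately show ?thesis using y[OF c(1,2)] z[of \<alpha>] c(3) by (simp add: dual_simps)
    qed (simp add: y_def)
  qed
  moreover have "single 1 \<alpha> \<odot>\<^bsub>dual\<^esub> y = z \<alpha>" if \<alpha>: "\<alpha> \<in> arrows" for \<alpha>
  proof (intro ext)
    fix b r
    have \<alpha>N: "\<alpha> \<in> N" "len \<alpha> = 1" using \<alpha> by (auto simp: arrows_def)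
    show "(single 1 \<alpha> \<odot>\<^bsub>dual\<^esub> y) b r = z \<alpha> b r"
    proof (cases "nz b \<alpha>")
      case True then show ?thesis using y \<alpha>N by (simp add: dual_single_smult)
    next
      case False
      have "z \<alpha> b r = 0"
      proof (cases "b \<in> N")
        case True
        \<comment> \<open>Acting by \<open>b\<close> and evaluating at the identity
          \<open>t b\<close> returns \<open>z \<alpha>\<close> at \<open>b\<close>; and
          \<open>b\<close> kills \<open>\<alpha>\<close>.\<close>
        then have "(single 1 b \<odot>\<^bsub>dual\<^esub> z \<alpha>) (t b) r = 0"
          using ann[OF \<alpha>, of "single 1 b"] single_mult_single[OF True \<alpha>N(1)] False by (simp add: dual_simps)
        then show ?thesis using True nz_t[OF True] m_t[OF True] by (simp add: dual_single_smult)
      next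
        case False then show ?thesis using z[OF \<alpha>] by (simp add: dual_simps)
      qed
      then show ?thesis using False \<alpha>N by (simp add: dual_single_smult)
    qed
  qed
  ultimately show ?thesis by (intro bexI[of _ y] ballI)
qed

text \<open>If annihilator relations that hold after \<open>h\<close> can be lifted to
  \<open>dual\<close>, the equations for arrows are solved there and the solution is pushed forward.
  For the quotient by \<open>A\<close>, the hypothesis \<open>lift\<close> is where
  \<open>Ext^1(A\<alpha>, A)\<close> enters.\<close>

lemma push_dual_injective:
  fixes h :: "('b \<Rightarrow> 'b \<Rightarrow> 'k) \<Rightarrow> 'u"
  assumes h: "module_congruence A dual h"
    and lift: "\<And>\<alpha> z. \<alpha> \<in> arrows \<Longrightarrow> z \<in> carrier dual \<Longrightarrow>
      (\<And>a. a \<in> carrier A \<Longrightarrow> a \<otimes> single 1 \<alpha> = \<zero> \<Longrightarrow> h (a \<odot>\<^bsub>dual\<^esub> z) = h \<zero>\<^bsub>dual\<^esub>) \<Longrightarrow>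
      \<exists>z'\<in>carrier dual. h z' = h z \<and> (\<forall>a\<in>carrier A. a \<otimes> single 1 \<alpha> = \<zero> \<longrightarrow> a \<odot>\<^bsub>dual\<^esub> z' = \<zero>\<^bsub>dual\<^esub>)"
  shows "injective_module A (push_module dual h)"
proof (rule injective_of_arrow_extension[OF push_left_module[OF dual_left_module h]])
  let ?E = "push_module dual h"
  show "arrow_extension ?E" unfolding arrow_extension_def
  proof (intro allI impI)
    fix x assume x: "\<forall>\<alpha>\<in>arrows. x \<alpha> \<in> carrier ?E \<and>
      (\<forall>a\<in>carrier A. a \<otimes> single 1 \<alpha> = \<zero> \<longrightarrow> a \<odot>\<^bsub>?E\<^esub> x \<alpha> = \<zero>\<^bsub>?E\<^esub>)"
    define P where "P \<alpha> z \<longleftrightarrow> z \<in> carrier dual \<and> h z = x \<alpha> \<and>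
      (\<forall>a\<in>carrier A. a \<otimes> single 1 \<alpha> = \<zero> \<longrightarrow> a \<odot>\<^bsub>dual\<^esub> z = \<zero>\<^bsub>dual\<^esub>)" for \<alpha> z
    have ex: "\<exists>z. P \<alpha> z" if \<alpha>: "\<alpha> \<in> arrows" for \<alpha>
    proof -
      obtain z where z: "z \<in> carrier dual" "x \<alpha> = h z" using x \<alpha> by auto
      have "h (a \<odot>\<^bsub>dual\<^esub> z) = h \<zero>\<^bsub>dual\<^esub>" if "a \<in> carrier A" "a \<otimes> single 1 \<alpha> = \<zero>" for a
      proof -
        have "a \<odot>\<^bsub>?E\<^esub> x \<alpha> = \<zero>\<^bsub>?E\<^esub>" using x \<alpha> that by blast
        then show ?thesis using push_smult[OF h that(1) z(1)] z(2) by simp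
      qed
      from lift[OF \<alpha> z(1) this] show ?thesis unfolding P_def z(2) by blast
    qed
    define z where "z \<alpha> = (SOME z. P \<alpha> z)" for \<alpha>
    have z: "P \<alpha> (z \<alpha>)" if "\<alpha> \<in> arrows" for \<alpha>
      unfolding z_def by (rule someI_ex[OF ex[OF that]])
    have "\<exists>y\<in>carrier dual. \<forall>\<alpha>\<in>arrows. single 1 \<alpha> \<odot>\<^bsub>dual\<^esub> y = z \<alpha>"
      by (rule dual_arrow_extension) (use z in \<open>auto simp: P_def\<close>)
    then obtain y where y: "y \<in> carrier dual" "\<And>\<alpha>. \<alpha> \<in> arrows \<Longrightarrow> single 1 \<alpha> \<odot>\<^bsub>dual\<^esub> y = z \<alpha>" by blast
    show "\<exists>y\<in>carrier ?E. \<forall>\<alpha>\<in>arrows. single 1 \<alpha> \<odot>\<^bsub>?E\<^esub> y = x \<alpha>"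
    proof (intro bexI[of _ "h y"] ballI)
      fix \<alpha> assume \<alpha>: "\<alpha> \<in> arrows"
      then have "single 1 \<alpha> \<odot>\<^bsub>?E\<^esub> h y = h (z \<alpha>)"
        using push_smult[OF h _ y(1), of "single 1 \<alpha>"] y(2) by (simp add: arrows_def)
      then show "single 1 \<alpha> \<odot>\<^bsub>?E\<^esub> h y = x \<alpha>" using z[OF \<alpha>] by (simp add: P_def)
    qed (use y in simp)
  qed
qed

text \<open>Right multiplication by \<open>x\<close>, the embedding of \<open>A\<close> into
  \<open>Hom_K(A, A)\<close>.\<close>

definition incl :: "'a \<Rightarrow> 'b \<Rightarrow> 'b \<Rightarrow> 'k" where
  "incl x b r = (if b \<in> N then coef (single 1 b \<otimes> x) r else 0)"

lemma incl_closed: "x \<in> carrier A \<Longrightarrow> incl x \<in> carrier dual"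
  by (auto simp: dual_simps incl_def coef_outside)

lemma incl_zero: "incl \<zero> = \<zero>\<^bsub>dual\<^esub>"
  by (intro ext) (simp add: incl_def dual_simps)

lemma incl_add:
  "x \<in> carrier A \<Longrightarrow> y \<in> carrier A \<Longrightarrow> incl (x \<oplus> y) = incl x \<oplus>\<^bsub>dual\<^esub> incl y"
  by (intro ext) (simp add: dual_simps incl_def r_distr coef_add)

lemma coef_single_scale:
  assumes "b \<in> N" "x \<in> carrier A"
  shows "coef (single k b \<otimes> x) r = k * coef (single 1 b \<otimes> x) r"
proof (cases "\<exists>c. nz b c \<and> r = m b c")
  case True then show ?thesis using assms by (auto simp: coef_single_mult)
next
  case False
  then show ?thesis using coef_single_mult_0[OF assms] by auto
qed

lemma incl_mult:
  assumes a: "a \<in> carrier A" and x: "x \<in> carrier A"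
  shows "incl (a \<otimes> x) = a \<odot>\<^bsub>dual\<^esub> incl x"
proof (rule span_induct[OF a])
  interpret D: left_module A dual by (rule dual_left_module)
  note ix = incl_closed[OF x]
  show "incl (\<zero> \<otimes> x) = \<zero> \<odot>\<^bsub>dual\<^esub> incl x"
    using x ix by (simp add: D.zero_smult incl_zero)
  show "incl ((a \<oplus> b) \<otimes> x) = (a \<oplus> b) \<odot>\<^bsub>dual\<^esub> incl x"
    if "a \<in> carrier A" "b \<in> carrier A" "incl (a \<otimes> x) = a \<odot>\<^bsub>dual\<^esub> incl x" "incl (b \<otimes> x) = b \<odot>\<^bsub>dual\<^esub> incl x" for a b
    using that x ix by (simp add: l_distr incl_add D.smult_l_distr)
  show "incl (single k c \<otimes> x) = single k c \<odot>\<^bsub>dual\<^esub> incl x" if c: "c \<in> N" for c k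
  proof (intro ext)
    fix b r
    show "incl (single k c \<otimes> x) b r = (single k c \<odot>\<^bsub>dual\<^esub> incl x) b r"
    proof (cases "b \<in> N")
      case True
      have "single 1 b \<otimes> (single k c \<otimes> x) = (single 1 b \<otimes> single k c) \<otimes> x"
        using True c x by (simp add: m_assoc)
      then show ?thesis using True c x single_mult_single[OF True c, of 1 k] coef_single_scale[of "m b c" x k r]
        by (auto simp: incl_def dual_single_smult m_mem)
    next
      case False
      then show ?thesis using c nz_memL by (auto simp: incl_def dual_single_smult)
    qed
  qed
qed

lemma incl_hom: "incl \<in> lmod_hom A (regular_module A) dual"
  by (rule lmod_homI) (auto simp: regular_module_def incl_closed incl_add incl_mult)

lemma incl_inj: "inj_on incl (carrier A)"
proof (rule inj_onI)
  fix x y assume xy: "x \<in> carrier A" "y \<in> carrier A" "incl x = incl y"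
  \<comment> \<open>The values of right multiplication by \<open>x\<close> at the identities
    determine \<open>x\<close>.\<close>
  have "incl x (t r) r = coef x r" if "r \<in> N" "x \<in> carrier A" for x r
    using coef_single_mult[OF nz_t[OF that(1)] that(2), of 1] that t_mem m_t by (simp add: incl_def)
  then show "x = y" using xy by (metis coef_eqI)
qed

text \<open>Carries closedness from monomials to elements. Left multiplication by a monomial is
  injective where it is nonzero, so a monomial that kills \<open>w\<close> kills every monomial in
  its support. Each of these is then a multiple of \<open>p\<close>, and \<open>y\<close> collects
  the quotients.\<close>

lemma zero_divisor_closed_element:
  assumes p: "p \<in> N" "zero_divisor_closed p" and w: "w \<in> carrier A"
    and ann: "\<And>a. a \<in> carrier A \<Longrightarrow> a \<otimes> single 1 p = \<zero> \<Longrightarrow> a \<otimes> w = \<zero>"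
  shows "\<exists>y\<in>carrier A. w = single 1 p \<otimes> y"
proof -
  define y where "y = of_coef (\<lambda>u. if nz p u then coef w (m p u) else 0)"
  have y: "y \<in> carrier A" "coef y = (\<lambda>u. if nz p u then coef w (m p u) else 0)"
    by (auto simp: y_def nz_memR intro!: of_coef)
  have "w = single 1 p \<otimes> y"
  proof (rule coef_eqI)
    fix r assume r: "r \<in> N"
    show "coef w r = coef (single 1 p \<otimes> y) r"
    proof (cases "\<exists>u. nz p u \<and> r = m p u")
      case True
      then show ?thesis using y by (auto simp: coef_single_mult)
    next
      case False
      have "coef w r = 0"
      proof (rule ccontr)
        assume wr: "coef w r \<noteq> 0"
        have kill: "nz c p" if "nz c r" for c
        proof (rule ccontr)
          assume "\<not> nz c p"
          then have "single 1 c \<otimes> single 1 p = \<zero>" using single_mult_single[OF nz_memL[OF that] p(1)] by simp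
          then have "single 1 c \<otimes> w = \<zero>" using ann nz_memL[OF that] by simp
          then show False using coef_single_mult[OF that w, of 1] wr by simp
        qed
        \<comment> \<open>The identity at \<open>t r\<close> does not kill \<open>r\<close>, so by
          \<open>kill\<close> it does not kill \<open>p\<close> either.\<close>
        have "t r = t p"
          using nz_comp[OF kill[OF nz_t[OF r]]] nz_comp[OF nz_t[OF r]] by simp
        moreover have "zr c r" if "zr c p" for c
          using that kill \<open>t r = t p\<close> r by (auto simp: zr_def)
        ultimately show False using False p(2) r unfolding zero_divisor_closed_def by blast
      qed
      moreover have "coef (single 1 p \<otimes> y) r = 0"
        using False coef_single_mult_0[OF p(1) y(1), of r 1] by blast
      ultimately show ?thesis by simp
    qed
  qed (simp_all add: w p(1) y(1))
  then show ?thesis using y(1) by blast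
qed

lemma mult_idem_right:
  assumes "a \<in> carrier A" "e \<in> N" "len e = 0" "c \<in> N"
  shows "coef (a \<otimes> single 1 e) c = (if s c = e then coef a c else 0)"
proof (cases "s c = e")
  case True
  then show ?thesis using coef_mult_single[OF nz_s[OF assms(4)] assms(1), of 1] m_s[OF assms(4)] by simp
next
  case False
  have "c \<noteq> m d e" if "nz d e" for d
    using False s_m[OF that] len_0_s[OF assms(2,3)] by auto
  then show ?thesis using False coef_mult_single_0[OF assms(2,1)] by simp
qed

text \<open>The obstruction to lifting lies in \<open>Ext\<^sup>1(A\<alpha>, A)\<close>, which vanishes by the condition on the arrow
  \<open>\<alpha>\<close>: the left annihilator of \<open>\<alpha>\<close> inside \<open>Ae\<close> is \<open>0\<close> or \<open>Ap\<close>.\<close>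

lemma annihilator_correction:
  assumes cond: arrow_condition and \<alpha>: "\<alpha> \<in> arrows" and z: "z \<in> carrier dual"
    and ann: "\<And>a. a \<in> carrier A \<Longrightarrow> a \<otimes> single 1 \<alpha> = \<zero> \<Longrightarrow> \<exists>w\<in>carrier A. a \<odot>\<^bsub>dual\<^esub> z = incl w"
  shows "\<exists>x\<in>carrier A. \<forall>a\<in>carrier A. a \<otimes> single 1 \<alpha> = \<zero> \<longrightarrow> a \<odot>\<^bsub>dual\<^esub> z = incl (a \<otimes> x)"
proof -
  interpret D: left_module A dual by (rule dual_left_module)
  have \<alpha>N: "\<alpha> \<in> N" "len \<alpha> = 1" using \<alpha> by (auto simp: arrows_def)
  define e where "e = t \<alpha>"
  have e: "e \<in> N" "len e = 0" using t_mem[OF \<alpha>N(1)] len_t[OF \<alpha>N(1)] by (auto simp: e_def)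
  let ?e = "single 1 e"
  have e\<alpha>: "?e \<otimes> single 1 \<alpha> = single 1 \<alpha>" using single_t_mult[OF \<alpha>N(1), of 1] by (simp add: e_def)
  have ee: "?e \<otimes> ?e = ?e" using single_t_mult[OF e(1), of 1] len_0_t[OF e] by simp
  have supp: "zr c \<alpha>" if "a \<in> carrier A" "a \<otimes> single 1 \<alpha> = \<zero>" "c \<in> N" "s c = e" "coef a c \<noteq> 0" for a c
    using that mult_single_eq_0_iff[OF \<alpha>N(1)] \<alpha>N by (auto simp: zr_def e_def)
  \<comment> \<open>The left annihilator of \<open>\<alpha>\<close> splits into its part in
    \<open>Ae\<close> and all of \<open>A(1 - e)\<close>. This is the part in \<open>Ae\<close>, on
    which \<open>arrow_condition\<close> has a say.\<close>
  have "\<exists>y\<in>carrier A. \<forall>a\<in>carrier A. a \<otimes> single 1 \<alpha> = \<zero> \<longrightarrow> (a \<otimes> ?e) \<odot>\<^bsub>dual\<^esub> z = incl (a \<otimes> (?e \<otimes> y))"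
  proof (cases "\<exists>p. lmin p \<alpha>")
    case False
    have "a \<otimes> ?e = \<zero>" if a: "a \<in> carrier A" "a \<otimes> single 1 \<alpha> = \<zero>" for a
    proof (rule coef_eqI)
      fix c assume c: "c \<in> N"
      have "coef a c = 0" if sc: "s c = e"
      proof (rule ccontr)
        assume "coef a c \<noteq> 0"
        note supp = supp[OF a c sc this]
        then obtain q where "lmin q \<alpha>" using lmin_exists[OF supp] by blast
        then show False using False by blast
      qed
      then show "coef (a \<otimes> ?e) c = coef \<zero> c" using mult_idem_right[OF a(1) e c] by auto
    qed (use a e in auto)
    then show ?thesis using z e by (intro bexI[of _ \<zero>]) (auto simp: D.zero_smult incl_zero)
  next
    case True
    then obtain p where p: "lmin p \<alpha>" by blast
    then have pN: "p \<in> N" and sp: "s p = e" by (auto simp: lmin_def zr_def e_def)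
    have uniq: "p' = p" if "lmin p' \<alpha>" for p' using cond p that \<alpha>N unfolding arrow_condition_def by blast
    have closed: "zero_divisor_closed p" using cond p \<alpha>N unfolding arrow_condition_def by blast
    let ?p = "single 1 p"
    have p\<alpha>: "?p \<otimes> single 1 \<alpha> = \<zero>" using p single_mult_single[OF pN \<alpha>N(1)] by (simp add: lmin_def zr_def)
    \<comment> \<open>\<open>p\<close> acting on \<open>z\<close> gives \<open>w\<close>, so the
      left annihilator of \<open>p\<close> kills \<open>w\<close>, and closedness will write it as
      \<open>py\<close>.\<close>
    obtain w where w: "w \<in> carrier A" "?p \<odot>\<^bsub>dual\<^esub> z = incl w" using ann[OF _ p\<alpha>] pN by auto
    have "a \<otimes> w = \<zero>" if a: "a \<in> carrier A" "a \<otimes> ?p = \<zero>" for a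
    proof -
      have "incl (a \<otimes> w) = (a \<otimes> ?p) \<odot>\<^bsub>dual\<^esub> z"
        using D.smult_assoc[OF a(1) _ z, of ?p] incl_mult[OF a(1) w(1)] w(2) pN by simp
      also have "\<dots> = incl \<zero>" by (simp add: a(2) D.zero_smult[OF z] incl_zero)
      finally show ?thesis using incl_inj a w by (auto simp: inj_on_def)
    qed
    then obtain y where y: "y \<in> carrier A" "w = ?p \<otimes> y"
      using zero_divisor_closed_element[OF pN closed w(1)] by blast
    have "(a \<otimes> ?e) \<odot>\<^bsub>dual\<^esub> z = incl (a \<otimes> (?e \<otimes> y))" if a: "a \<in> carrier A" "a \<otimes> single 1 \<alpha> = \<zero>" for a
    proof -
      \<comment> \<open>Every monomial of \<open>ae\<close> kills \<open>\<alpha>\<close> and is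
        therefore a left multiple of the only minimal \<open>p\<close>.\<close>
      have "a \<otimes> ?e = proj p a"
      proof (rule coef_eqI)
        fix c assume c: "c \<in> N"
        have "multiple p c" if "s c = e" "coef a c \<noteq> 0"
          using lmin_exists[OF supp[OF a c that]] uniq unfolding multiple_def by metis
        moreover have "s c = e" if "multiple p c" using that s_m sp by (auto simp: multiple_def)
        ultimately show "coef (a \<otimes> ?e) c = coef (proj p a) c"
          using mult_idem_right[OF a(1) e c] by (auto simp: coef_proj)
      qed (use a e proj_closed in auto)
      then have ae: "a \<otimes> ?e = quot p a \<otimes> ?p" by (simp add: quot_mult[OF pN])
      have "(a \<otimes> ?e) \<odot>\<^bsub>dual\<^esub> z = quot p a \<odot>\<^bsub>dual\<^esub> incl w"
        unfolding ae using w z pN quot_closed by (simp add: D.smult_assoc)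
      also have "\<dots> = incl ((quot p a \<otimes> ?p) \<otimes> y)"
        using w(1) y pN quot_closed by (simp add: incl_mult[symmetric] m_assoc)
      also have "\<dots> = incl (a \<otimes> (?e \<otimes> y))" unfolding ae[symmetric] using a y e by (simp add: m_assoc)
      finally show ?thesis .
    qed
    then show ?thesis using y(1) by blast
  qed
  then obtain y where y: "y \<in> carrier A"
    "\<And>a. a \<in> carrier A \<Longrightarrow> a \<otimes> single 1 \<alpha> = \<zero> \<Longrightarrow> (a \<otimes> ?e) \<odot>\<^bsub>dual\<^esub> z = incl (a \<otimes> (?e \<otimes> y))" by blast
  \<comment> \<open>The complementary idempotent kills \<open>\<alpha>\<close>, so the hypothesis
    applies to it and corrects the other component. Writing it as \<open>?f \<otimes> ?f\<close>
    lets one factor act on \<open>z\<close> while the other remains in front of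
    \<open>v\<close>.\<close>
  let ?f = "\<one> \<ominus> ?e"
  have f: "?f \<in> carrier A" using e by simp
  have ff: "?f \<otimes> ?f = ?f"
  proof -
    have "?f \<otimes> ?f = ?f \<oplus> \<ominus> (?e \<oplus> \<ominus> (?e \<otimes> ?e))"
      using e by (simp add: a_minus_def l_distr r_distr l_minus r_minus minus_add)
    then show ?thesis using e ee by (simp add: r_neg)
  qed
  have "?f \<otimes> single 1 \<alpha> = \<zero>" using e e\<alpha> \<alpha>N by (simp add: a_minus_def l_distr l_minus r_neg)
  then obtain v where v: "v \<in> carrier A" "?f \<odot>\<^bsub>dual\<^esub> z = incl v" using ann f by blast
  have "a \<odot>\<^bsub>dual\<^esub> z = incl (a \<otimes> (?f \<otimes> v \<oplus> ?e \<otimes> y))" if a: "a \<in> carrier A" "a \<otimes> single 1 \<alpha> = \<zero>" for a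
  proof -
    have "a = a \<otimes> (?f \<oplus> ?e)" using a e by (simp add: a_minus_def a_assoc l_neg)
    then have "a = a \<otimes> (?f \<otimes> ?f) \<oplus> a \<otimes> ?e" using a e f ff by (simp add: r_distr)
    then have "a \<odot>\<^bsub>dual\<^esub> z = (a \<otimes> (?f \<otimes> ?f)) \<odot>\<^bsub>dual\<^esub> z \<oplus>\<^bsub>dual\<^esub> (a \<otimes> ?e) \<odot>\<^bsub>dual\<^esub> z"
      using D.smult_l_distr[of "a \<otimes> (?f \<otimes> ?f)" "a \<otimes> ?e" z] a f e z by (metis m_closed single_closed)
    also have "(a \<otimes> (?f \<otimes> ?f)) \<odot>\<^bsub>dual\<^esub> z = incl (a \<otimes> (?f \<otimes> v))"
      using a f v z by (simp add: D.smult_assoc incl_mult)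
    finally show ?thesis using a y f v e by (simp add: y(2) incl_add r_distr)
  qed
  then show ?thesis using f v e y(1) by (intro bexI[of _ "?f \<otimes> v \<oplus> ?e \<otimes> y"]) auto
qed

text \<open>The graph of \<open>\<phi>\<close> with indices and rows turned into ring elements, so
  that it becomes a set of triples of the prescribed type; the component 0 is a filler.\<close>

definition encode :: "('b \<Rightarrow> 'b \<Rightarrow> 'k) \<Rightarrow> ('a, 'a) module_univ" where
  "encode \<phi> = (\<lambda>b. (single 1 b, of_coef (\<phi> b), 0)) ` N"

lemma encode_inj: "inj_on encode (carrier dual)"
proof (rule inj_onI)
  fix \<phi> \<psi> assume \<phi>: "\<phi> \<in> carrier dual" and \<psi>: "\<psi> \<in> carrier dual" and eq: "encode \<phi> = encode \<psi>"
  have single_inj: "b = c" if "b \<in> N" "c \<in> N" "single 1 b = single 1 c" for b c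
    using coef_single[OF that(1), of 1 b] coef_single[OF that(2), of 1 b] that(3) by (simp split: if_splits)
  show "\<phi> = \<psi>"
  proof
    fix b
    show "\<phi> b = \<psi> b"
    proof (cases "b \<in> N")
      case True
      then have "(single 1 b, of_coef (\<phi> b), 0) \<in> encode \<psi>"
        unfolding eq[symmetric] by (simp add: encode_def)
      then obtain c where c: "c \<in> N" "single 1 b = single 1 c" "of_coef (\<phi> b) = of_coef (\<psi> c)"
        by (auto simp: encode_def)
      then have "of_coef (\<phi> b) = of_coef (\<psi> b)" using single_inj[OF True] by simp
      moreover have "coef (of_coef (\<phi> b)) = \<phi> b" "coef (of_coef (\<psi> b)) = \<psi> b"
        by (rule coef_of_coef; use \<phi> \<psi> in \<open>simp add: dual_simps\<close>)+
      ultimately show ?thesis by metis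
    next
      case False
      then show ?thesis using \<phi> \<psi> by (intro ext) (simp add: dual_simps)
    qed
  qed
qed

section \<open>The quotient of \<open>Hom_K(A, A)\<close> by \<open>A\<close>\<close>

lemma incl_minus:
  assumes "y \<in> carrier A" shows "incl (\<ominus> y) = \<ominus>\<^bsub>dual\<^esub> incl y"
proof -
  interpret D: left_module A dual by (rule dual_left_module)
  have "incl (\<ominus> y) \<oplus>\<^bsub>dual\<^esub> incl y = \<zero>\<^bsub>dual\<^esub>"
    using assms incl_add[of "\<ominus> y" y] by (simp add: l_neg incl_zero)
  then show ?thesis using D.M.minus_equality[of "incl (\<ominus> y)" "incl y"] assms by (simp add: incl_closed)
qed

definition coset :: "('b \<Rightarrow> 'b \<Rightarrow> 'k) \<Rightarrow> ('b \<Rightarrow> 'b \<Rightarrow> 'k) set" where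
  "coset \<phi> = (\<lambda>x. \<phi> \<oplus>\<^bsub>dual\<^esub> incl x) ` carrier A"

text \<open>A coset is a set of functions, one level above what \<open>encode\<close> accepts, so a
  chosen representative stands for it. The choice depends on the coset alone, hence equal cosets
  have equal codes.\<close>

definition encode_coset :: "('b \<Rightarrow> 'b \<Rightarrow> 'k) \<Rightarrow> ('a, 'a) module_univ" where
  "encode_coset \<phi> = encode (SOME \<psi>. \<psi> \<in> coset \<phi>)"

lemma encode_coset_eq_iff:
  assumes \<phi>: "\<phi> \<in> carrier dual" and \<psi>: "\<psi> \<in> carrier dual"
  shows "encode_coset \<phi> = encode_coset \<psi> \<longleftrightarrow> (\<exists>x\<in>carrier A. \<psi> = \<phi> \<oplus>\<^bsub>dual\<^esub> incl x)"
proof -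
  interpret D: left_module A dual by (rule dual_left_module)
  have some: "(SOME \<psi>. \<psi> \<in> coset \<phi>) \<in> coset \<phi>" for \<phi>
    by (rule someI[of _ "\<phi> \<oplus>\<^bsub>dual\<^esub> incl \<zero>"]) (auto simp: coset_def)
  have sub: "coset \<phi> \<subseteq> carrier dual" if "\<phi> \<in> carrier dual" for \<phi>
    using that by (auto simp: coset_def incl_closed)
  show ?thesis
  proof
    assume "encode_coset \<phi> = encode_coset \<psi>"
    then have "(SOME \<phi>'. \<phi>' \<in> coset \<phi>) = (SOME \<psi>'. \<psi>' \<in> coset \<psi>)"
      unfolding encode_coset_def
      by (rule inj_onD[OF encode_inj _ subsetD[OF sub[OF \<phi>] some] subsetD[OF sub[OF \<psi>] some]])
    then obtain x y where xy: "x \<in> carrier A" "y \<in> carrier A" "\<phi> \<oplus>\<^bsub>dual\<^esub> incl x = \<psi> \<oplus>\<^bsub>dual\<^esub> incl y"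
      using some[of \<phi>] some[of \<psi>] by (auto simp: coset_def)
    have "\<psi> = (\<psi> \<oplus>\<^bsub>dual\<^esub> incl y) \<oplus>\<^bsub>dual\<^esub> \<ominus>\<^bsub>dual\<^esub> incl y"
      using \<psi> incl_closed[OF xy(2)] by (simp add: D.a_assoc D.M.r_neg)
    also have "\<dots> = \<phi> \<oplus>\<^bsub>dual\<^esub> (incl x \<oplus>\<^bsub>dual\<^esub> \<ominus>\<^bsub>dual\<^esub> incl y)"
      using \<phi> incl_closed xy by (simp flip: xy(3) add: D.a_assoc)
    also have "incl x \<oplus>\<^bsub>dual\<^esub> \<ominus>\<^bsub>dual\<^esub> incl y = incl (x \<ominus> y)"
      using xy incl_add[of x "\<ominus> y"] by (simp add: a_minus_def incl_minus)
    finally show "\<exists>x\<in>carrier A. \<psi> = \<phi> \<oplus>\<^bsub>dual\<^esub> incl x" using xy by blast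
  next
    assume "\<exists>x\<in>carrier A. \<psi> = \<phi> \<oplus>\<^bsub>dual\<^esub> incl x"
    then obtain x where x: "x \<in> carrier A" "\<psi> = \<phi> \<oplus>\<^bsub>dual\<^esub> incl x" by blast
    have "coset \<psi> = coset \<phi>"
    proof
      show "coset \<psi> \<subseteq> coset \<phi>"
      proof
        fix \<chi> assume "\<chi> \<in> coset \<psi>"
        then obtain y where y: "y \<in> carrier A" "\<chi> = \<psi> \<oplus>\<^bsub>dual\<^esub> incl y" by (auto simp: coset_def)
        then have "\<chi> = \<phi> \<oplus>\<^bsub>dual\<^esub> incl (x \<oplus> y)" using x \<phi> by (simp add: incl_add incl_closed D.a_assoc)
        then show "\<chi> \<in> coset \<phi>" using x y unfolding coset_def by (intro image_eqI[of _ _ "x \<oplus> y"]) auto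
      qed
      show "coset \<phi> \<subseteq> coset \<psi>"
      proof
        fix \<chi> assume "\<chi> \<in> coset \<phi>"
        then obtain y where y: "y \<in> carrier A" "\<chi> = \<phi> \<oplus>\<^bsub>dual\<^esub> incl y" by (auto simp: coset_def)
        have "y = x \<oplus> (y \<ominus> x)" using x(1) y(1) a_lcomm[of x y "\<ominus> x"] by (simp add: a_minus_def r_neg)
        then have "\<chi> = \<phi> \<oplus>\<^bsub>dual\<^esub> (incl x \<oplus>\<^bsub>dual\<^esub> incl (y \<ominus> x))"
          using y x incl_add[of x "y \<ominus> x"] by simp
        then have "\<chi> = \<psi> \<oplus>\<^bsub>dual\<^esub> incl (y \<ominus> x)" using x y \<phi> by (simp add: incl_closed D.a_assoc)
        then show "\<chi> \<in> coset \<psi>" using x y unfolding coset_def by (intro image_eqI[of _ _ "y \<ominus> x"]) auto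
      qed
    qed
    then show "encode_coset \<phi> = encode_coset \<psi>" by (simp add: encode_coset_def)
  qed
qed

lemma encode_coset_congruence: "module_congruence A dual encode_coset"
proof -
  interpret D: left_module A dual by (rule dual_left_module)
  show ?thesis unfolding module_congruence_def
  proof (intro conjI ballI impI)
    fix x x' y y' assume c: "x \<in> carrier dual" "x' \<in> carrier dual" "y \<in> carrier dual" "y' \<in> carrier dual"
      and "encode_coset x = encode_coset x'" "encode_coset y = encode_coset y'"
    then have "\<exists>u\<in>carrier A. x' = x \<oplus>\<^bsub>dual\<^esub> incl u" "\<exists>v\<in>carrier A. y' = y \<oplus>\<^bsub>dual\<^esub> incl v"
      using encode_coset_eq_iff[OF c(1,2)] encode_coset_eq_iff[OF c(3,4)] by simp_all
    then obtain u v where uv: "u \<in> carrier A" "x' = x \<oplus>\<^bsub>dual\<^esub> incl u" "v \<in> carrier A" "y' = y \<oplus>\<^bsub>dual\<^esub> incl v"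
      by (elim bexE)
    then have "x' \<oplus>\<^bsub>dual\<^esub> y' = (x \<oplus>\<^bsub>dual\<^esub> y) \<oplus>\<^bsub>dual\<^esub> incl (u \<oplus> v)"
      using c by (simp add: incl_add incl_closed D.a_ac)
    then show "encode_coset (x \<oplus>\<^bsub>dual\<^esub> y) = encode_coset (x' \<oplus>\<^bsub>dual\<^esub> y')"
      using c uv(1,3) by (intro iffD2[OF encode_coset_eq_iff] bexI[of _ "u \<oplus> v"]) (simp_all add: incl_closed)
  next
    fix a x x' assume c: "a \<in> carrier A" "x \<in> carrier dual" "x' \<in> carrier dual"
      and "encode_coset x = encode_coset x'"
    then have "\<exists>u\<in>carrier A. x' = x \<oplus>\<^bsub>dual\<^esub> incl u"
      using encode_coset_eq_iff[OF c(2,3)] by simp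
    then obtain u where u: "u \<in> carrier A" "x' = x \<oplus>\<^bsub>dual\<^esub> incl u" by (elim bexE)
    then have "a \<odot>\<^bsub>dual\<^esub> x' = a \<odot>\<^bsub>dual\<^esub> x \<oplus>\<^bsub>dual\<^esub> incl (a \<otimes> u)"
      using c by (simp add: D.smult_r_distr incl_mult incl_closed)
    then show "encode_coset (a \<odot>\<^bsub>dual\<^esub> x) = encode_coset (a \<odot>\<^bsub>dual\<^esub> x')"
      using c u(1) by (intro iffD2[OF encode_coset_eq_iff] bexI[of _ "a \<otimes> u"]) (simp_all add: D.smult_closed incl_closed)
  qed
qed

lemma encode_coset_eq_zero_iff:
  assumes "\<phi> \<in> carrier dual"
  shows "encode_coset \<phi> = encode_coset \<zero>\<^bsub>dual\<^esub> \<longleftrightarrow> (\<exists>x\<in>carrier A. \<phi> = incl x)"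
proof -
  interpret D: left_module A dual by (rule dual_left_module)
  have "encode_coset \<phi> = encode_coset \<zero>\<^bsub>dual\<^esub> \<longleftrightarrow> encode_coset \<zero>\<^bsub>dual\<^esub> = encode_coset \<phi>" by auto
  also have "\<dots> \<longleftrightarrow> (\<exists>x\<in>carrier A. \<phi> = \<zero>\<^bsub>dual\<^esub> \<oplus>\<^bsub>dual\<^esub> incl x)"
    using assms by (intro encode_coset_eq_iff) auto
  also have "\<dots> \<longleftrightarrow> (\<exists>x\<in>carrier A. \<phi> = incl x)"
    by (intro bex_cong refl) (simp add: incl_closed)
  finally show ?thesis .
qed

text \<open>The resolution is \<open>0 -> A -> Hom_K(A, A) -> Hom_K(A, A)/A -> 0\<close>. The arrow
  condition enters in the injectivity of the quotient.\<close>

theorem inj_dim_1_of_arrow_condition: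
  assumes cond: arrow_condition
  shows "inj_dim_le A (regular_module A) 1"
proof -
  interpret D: left_module A dual by (rule dual_left_module)
  \<comment> \<open>Collapsing \<open>dual\<close> to one point gives the zero module, so all terms
    are images of \<open>dual\<close> and share one injectivity argument.\<close>
  define k :: "('b \<Rightarrow> 'b \<Rightarrow> 'k) \<Rightarrow> ('a, 'a) module_univ" where "k = (\<lambda>_. {})"
  define h where "h i = (if i = 0 then encode else if i = 1 then encode_coset else k)" for i :: nat
  define E where "E i = push_module dual (h i)" for i
  have "module_congruence A dual k" by (simp add: k_def module_congruence_def)
  then have h: "module_congruence A dual (h i)" for i
    by (simp add: h_def module_congruence_inj[OF encode_inj] encode_coset_congruence)
  have inj: "injective_module A (E i)" for i
    unfolding E_def
  proof (rule push_dual_injective[OF h])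
    fix \<alpha> z assume \<alpha>: "\<alpha> \<in> arrows" and z: "z \<in> carrier dual"
      and ann: "\<And>a. a \<in> carrier A \<Longrightarrow> a \<otimes> single 1 \<alpha> = \<zero> \<Longrightarrow> h i (a \<odot>\<^bsub>dual\<^esub> z) = h i \<zero>\<^bsub>dual\<^esub>"
    consider "i = 0" | "i = 1" | "i > 1" by linarith
    then show "\<exists>z'\<in>carrier dual. h i z' = h i z \<and>
      (\<forall>a\<in>carrier A. a \<otimes> single 1 \<alpha> = \<zero> \<longrightarrow> a \<odot>\<^bsub>dual\<^esub> z' = \<zero>\<^bsub>dual\<^esub>)"
    proof cases
      case 1
      have "a \<odot>\<^bsub>dual\<^esub> z = \<zero>\<^bsub>dual\<^esub>" if "a \<in> carrier A" "a \<otimes> single 1 \<alpha> = \<zero>" for a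
        using inj_onD[OF encode_inj, of "a \<odot>\<^bsub>dual\<^esub> z" "\<zero>\<^bsub>dual\<^esub>"] ann[OF that] that(1) z 1 D.smult_closed
        by (simp add: h_def)
      then show ?thesis using z by (intro bexI[of _ z]) auto
    next
      case 2
      have "\<exists>w\<in>carrier A. a \<odot>\<^bsub>dual\<^esub> z = incl w" if "a \<in> carrier A" "a \<otimes> single 1 \<alpha> = \<zero>" for a
        using ann[OF that] encode_coset_eq_zero_iff[of "a \<odot>\<^bsub>dual\<^esub> z"] that(1) z D.smult_closed 2
        by (simp add: h_def)
      from annihilator_correction[OF cond \<alpha> z this] obtain x where x: "x \<in> carrier A"
        and az: "\<forall>a\<in>carrier A. a \<otimes> single 1 \<alpha> = \<zero> \<longrightarrow> a \<odot>\<^bsub>dual\<^esub> z = incl (a \<otimes> x)" by (rule bexE)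
      note ix = incl_closed[OF x]
      \<comment> \<open>Changing \<open>z\<close> by an element of \<open>A\<close> keeps its class;
        the correction \<open>x\<close> turns relations modulo \<open>A\<close> into relations in
        \<open>dual\<close>.\<close>
      define z' where "z' = z \<ominus>\<^bsub>dual\<^esub> incl x"
      have z': "z' \<in> carrier dual" using z ix by (simp add: z'_def)
      have "z = z' \<oplus>\<^bsub>dual\<^esub> incl x"
        using z ix by (simp add: z'_def a_minus_def D.a_assoc D.M.l_neg)
      then have "h i z' = h i z" using 2 encode_coset_eq_iff[OF z' z] x by (auto simp: h_def)
      moreover have "a \<odot>\<^bsub>dual\<^esub> z' = \<zero>\<^bsub>dual\<^esub>" if "a \<in> carrier A" "a \<otimes> single 1 \<alpha> = \<zero>" for a
      proof -
        have "a \<odot>\<^bsub>dual\<^esub> z = a \<odot>\<^bsub>dual\<^esub> incl x" using az that incl_mult[OF that(1) x] by simp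
        then show ?thesis
          using D.smult_diff[OF that(1) z ix] D.smult_closed[OF that(1) ix]
          by (simp add: z'_def a_minus_def D.M.r_neg)
      qed
      ultimately show ?thesis using z' by (intro bexI[of _ z']) auto
    next
      case 3
      then show ?thesis using D.smult_zero by (intro bexI[of _ "\<zero>\<^bsub>dual\<^esub>"]) (auto simp: h_def k_def)
    qed
  qed
  define sec where "sec = inv_into (carrier dual) encode"
  have sec: "sec (encode \<phi>) = \<phi>" if "\<phi> \<in> carrier dual" for \<phi>
    unfolding sec_def by (rule inv_into_f_f[OF encode_inj that])
  \<comment> \<open>\<open>d 0\<close> decodes an element and passes to its coset. The later
    differentials are zero, \<open>{}\<close> being the only element of their targets.\<close>
  define d where "d i x = (if i = 0 then encode_coset (sec x) else {})" for i :: nat and x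
  have E0: "carrier (E 0) = encode ` carrier dual" and E1: "carrier (E (Suc 0)) = encode_coset ` carrier dual"
    and E2: "carrier (E (Suc (Suc i))) = {{}}" "\<zero>\<^bsub>E (Suc (Suc i))\<^esub> = {}" for i
    using D.M.zero_closed by (auto simp: E_def h_def k_def)
  have incl_E: "(\<lambda>x. encode (incl x)) \<in> lmod_hom A (regular_module A) (E 0)"
    unfolding E_def h_def by (rule lmod_hom_comp[OF incl_hom]) (simp add: push_hom module_congruence_inj encode_inj)
  have d_hom: "d i \<in> lmod_hom A (E i) (E (Suc i))" for i
  proof (cases i)
    case 0
    have sec_hom: "sec \<in> lmod_hom A (E 0) dual"
      by (rule lmod_homI)
         (auto simp: E_def h_def sec push_add[OF module_congruence_inj[OF encode_inj]]
           push_smult[OF module_congruence_inj[OF encode_inj]] D.smult_closed)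
    have "encode_coset \<in> lmod_hom A dual (E (Suc 0))"
      using push_hom[OF h[of 1]] by (simp add: E_def h_def)
    then have "(\<lambda>x. encode_coset (sec x)) \<in> lmod_hom A (E 0) (E (Suc 0))"
      by (rule lmod_hom_comp[OF sec_hom])
    then show ?thesis using 0 by (simp add: d_def[abs_def])
  next
    case (Suc j)
    interpret E: left_module A "E (Suc (Suc j))" using inj by (simp add: injective_module_def)
    have "{} \<oplus>\<^bsub>E (Suc (Suc j))\<^esub> {} = {}" "\<And>a. a \<in> carrier A \<Longrightarrow> a \<odot>\<^bsub>E (Suc (Suc j))\<^esub> {} = {}"
      using E.M.l_zero[OF E.M.zero_closed] E.smult_zero by (simp_all add: E2)
    then show ?thesis using Suc by (intro lmod_homI) (auto simp: d_def E2)
  qed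
  have "injective_resolution A (regular_module A) E (\<lambda>x. encode (incl x)) d"
    unfolding injective_resolution_def a_kernel_eq
  proof (intro conjI allI)
    show "left_module A (regular_module A)" by (rule regular_left_module)
    show "injective_module A (E i)" for i by (rule inj)
    show "(\<lambda>x. encode (incl x)) \<in> lmod_hom A (regular_module A) (E 0)" by (rule incl_E)
    show "inj_on (\<lambda>x. encode (incl x)) (carrier (regular_module A))"
    proof (rule inj_onI)
      fix x y assume xy: "x \<in> carrier (regular_module A)" "y \<in> carrier (regular_module A)"
        "encode (incl x) = encode (incl y)"
      then have "incl x = incl y"
        by (intro inj_onD[OF encode_inj]) (simp_all add: regular_module_def incl_closed)
      then show "x = y" using xy by (intro inj_onD[OF incl_inj]) (simp_all add: regular_module_def)
    qed
    show "d i \<in> lmod_hom A (E i) (E (Suc i))" for i by (rule d_hom)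
    have zero1: "\<zero>\<^bsub>E 1\<^esub> = encode_coset \<zero>\<^bsub>dual\<^esub>" by (simp add: E_def h_def)
    show "(\<lambda>x. encode (incl x)) ` carrier (regular_module A) = {x \<in> carrier (E 0). d 0 x = \<zero>\<^bsub>E 1\<^esub>}"
    proof
      show "(\<lambda>x. encode (incl x)) ` carrier (regular_module A) \<subseteq> {x \<in> carrier (E 0). d 0 x = \<zero>\<^bsub>E 1\<^esub>}"
      proof
        fix y assume "y \<in> (\<lambda>x. encode (incl x)) ` carrier (regular_module A)"
        then obtain x where x: "x \<in> carrier A" "y = encode (incl x)" by (auto simp: regular_module_def)
        then show "y \<in> {x \<in> carrier (E 0). d 0 x = \<zero>\<^bsub>E 1\<^esub>}"
          using incl_closed[OF x(1)] encode_coset_eq_zero_iff[of "incl x"] unfolding zero1 E0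
          by (auto simp: d_def sec)
      qed
      show "{x \<in> carrier (E 0). d 0 x = \<zero>\<^bsub>E 1\<^esub>} \<subseteq> (\<lambda>x. encode (incl x)) ` carrier (regular_module A)"
      proof
        fix y assume "y \<in> {x \<in> carrier (E 0). d 0 x = \<zero>\<^bsub>E 1\<^esub>}"
        then obtain \<phi> where \<phi>: "\<phi> \<in> carrier dual" "y = encode \<phi>" "encode_coset \<phi> = encode_coset \<zero>\<^bsub>dual\<^esub>"
          unfolding zero1 E0 by (auto simp: d_def sec)
        then show "y \<in> (\<lambda>x. encode (incl x)) ` carrier (regular_module A)"
          using encode_coset_eq_zero_iff[OF \<phi>(1)] by (auto simp: regular_module_def)
      qed
    qed
    show "d i ` carrier (E i) = {x \<in> carrier (E (Suc i)). d (Suc i) x = \<zero>\<^bsub>E (Suc (Suc i))\<^esub>}" for i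
    proof (cases i)
      case 0
      have "d 0 ` carrier (E 0) = encode_coset ` carrier dual"
        unfolding E0 image_image by (rule image_cong) (auto simp: d_def sec)
      then show ?thesis using 0 by (simp add: E1 E2 d_def)
    next
      case (Suc j)
      have "carrier (E i) \<noteq> {}" using D.M.zero_closed by (auto simp: E_def)
      then show ?thesis using Suc by (auto simp: E2 d_def)
    qed
  qed
  moreover have "carrier (E i) = {\<zero>\<^bsub>E i\<^esub>}" if "i > 1" for i
    using that E2[of "i - 2"] by (simp add: numeral_2_eq_2 Suc_diff_Suc)
  ultimately show ?thesis
    unfolding inj_dim_le_def by (intro exI[of _ E] exI[of _ "\<lambda>x. encode (incl x)"] exI[of _ d]) simp
qed

theorem one_gorenstein_iff:
  "one_gorenstein A \<longleftrightarrow> (\<forall>p q. lmin q p \<and> rmin q p \<longrightarrow> perfect_cyclic p)"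
proof
  assume "one_gorenstein A"
  then show "\<forall>p q. lmin q p \<and> rmin q p \<longrightarrow> perfect_cyclic p"
    unfolding one_gorenstein_def using inj_dim_1_perfect_cyclic by blast
next
  assume *: "\<forall>p q. lmin q p \<and> rmin q p \<longrightarrow> perfect_cyclic p"
  interpret op: monomial_ring N "\<lambda>x y. nz y x" "\<lambda>x y. m y x" t s len "opposite_ring A" coef
    by (rule monomial_ring_op)
  have arrow_condition op.arrow_condition
    by (rule arrow_condition arrow_condition_op; use * in blast)+
  then show "one_gorenstein A"
    unfolding one_gorenstein_def
    using inj_dim_1_of_arrow_condition op.inj_dim_1_of_arrow_condition by blast
qed

end

section \<open>Monomial path algebras\<close>

declare split_paired_All [simp del] split_paired_Ex [simp del]

lemma (in wf_digraph) qpaths_append: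
  "(u, xs @ ys) \<in> qpaths G \<longleftrightarrow> (u, xs) \<in> qpaths G \<and> (qtarget G (u, xs), ys) \<in> qpaths G"
  unfolding qpaths_def qtarget_def by (auto simp: awalk_append_iff)

lemma (in wf_digraph) qtarget_append:
  "(u, xs @ ys) \<in> qpaths G \<Longrightarrow> qtarget G (u, xs @ ys) = qtarget G (qtarget G (u, xs), ys)"
  unfolding qpaths_def qtarget_def by (auto simp: awalk_append_iff)

lemma (in wf_digraph) qpaths_Nil: "(u, []) \<in> qpaths G \<longleftrightarrow> u \<in> verts G"
  unfolding qpaths_def by (auto simp: awalk_Nil_iff)

lemma qtarget_Nil: "qtarget Q (u, []) = u"
  by (simp add: qtarget_def pre_digraph.awalk_verts.simps)

lemma (in wf_digraph) qtarget_in_verts: "p \<in> qpaths G \<Longrightarrow> qtarget G p \<in> verts G"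
  unfolding qpaths_def qtarget_def by (auto dest: awalk_last_in_verts)

lemma (in wf_digraph) qsource_in_verts: "p \<in> qpaths G \<Longrightarrow> qsource p \<in> verts G"
  unfolding qpaths_def qsource_def by (auto dest: awalk_hd_in_verts)

section \<open>Monomial ideals are spanned by their paths\<close>

locale monomial_quotient = fin_digraph Q
  for Q :: "('v, 'e) pre_digraph" +
  fixes I :: "(('v, 'e) qpath \<Rightarrow> 'k::field) set"
  assumes monomial: "monomial_ideal Q I"
begin

abbreviation P :: "(('v, 'e) qpath \<Rightarrow> 'k) ring" where "P \<equiv> path_algebra Q"

lemma ideal_I: "ideal I P"
  using monomial by (simp add: monomial_ideal_def admissible_ideal_def)

sublocale I: ideal I P by (rule ideal_I)

lemma composable_iff: "composable Q p q \<longleftrightarrow> q \<in> qpaths Q \<and> p \<in> qpaths Q \<and> fst p = qtarget Q q"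
  by (auto simp: composable_def qsource_def)

lemma composable_qpaths:
  "composable Q (v, xs) (u, ys) \<longleftrightarrow> v = qtarget Q (u, ys) \<and> (u, ys @ xs) \<in> qpaths Q"
  by (auto simp: composable_iff qpaths_append)

lemma qcomp_Pair [simp]: "qcomp (v, xs) (u, ys) = (u, ys @ xs)"
  by (simp add: qcomp_def qsource_def)

lemma qcomp_in_qpaths: "composable Q p q \<Longrightarrow> qcomp p q \<in> qpaths Q"
  by (cases p; cases q) (simp add: composable_qpaths)

text \<open>A path can be cut in only finitely many places; this keeps the sum in the product of the
  path algebra from defaulting to 0.\<close>

lemma finite_qcomp: "finite {(p, q). composable Q p q \<and> qcomp p q = r}"
proof -
  let ?f = "\<lambda>i. ((qtarget Q (fst r, take i (snd r)), drop i (snd r)), (fst r, take i (snd r)))"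
  have "{(p, q). composable Q p q \<and> qcomp p q = r} \<subseteq> ?f ` {..length (snd r)}"
  proof
    fix x assume "x \<in> {(p, q). composable Q p q \<and> qcomp p q = r}"
    then obtain v xs u ys where "x = ((v, xs), (u, ys))" "composable Q (v, xs) (u, ys)"
        "qcomp (v, xs) (u, ys) = r"
      by (cases x) auto
    then show "x \<in> ?f ` {..length (snd r)}"
      by (intro image_eqI[of _ _ "length ys"]) (auto simp: composable_qpaths)
  qed
  then show ?thesis by (rule finite_subset) simp
qed

lemma P_simps:
  "f \<in> carrier P \<longleftrightarrow> finite {p. f p \<noteq> 0} \<and> {p. f p \<noteq> 0} \<subseteq> qpaths Q"
  "(f \<otimes>\<^bsub>P\<^esub> g) r = (\<Sum>(p, q) \<in> {(p, q). composable Q p q \<and> qcomp p q = r}. f p * g q)"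
  "\<one>\<^bsub>P\<^esub> = (\<lambda>p. if p \<in> qpaths Q \<and> qlength p = 0 then 1 else 0)"
  "\<zero>\<^bsub>P\<^esub> = (\<lambda>p. 0)"
  "f \<oplus>\<^bsub>P\<^esub> g = (\<lambda>p. f p + g p)"
  by (simp_all add: path_algebra_def)

definition scaled :: "'k \<Rightarrow> ('v, 'e) qpath \<Rightarrow> ('v, 'e) qpath \<Rightarrow> 'k" where
  "scaled k p = (\<lambda>r. if r = p then k else 0)"

lemma path_vec_eq: "path_vec p = scaled 1 p"
  by (simp add: path_vec_def scaled_def)

lemma scaled_closed: "p \<in> qpaths Q \<Longrightarrow> scaled k p \<in> carrier P"
  by (auto simp: P_simps scaled_def)

lemma scaled_mult:
  assumes "composable Q p q" shows "scaled k p \<otimes>\<^bsub>P\<^esub> scaled l q = scaled (k * l) (qcomp p q)"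
proof
  fix r
  have "(scaled k p \<otimes>\<^bsub>P\<^esub> scaled l q) r =
      (\<Sum>x \<in> {(p, q). composable Q p q \<and> qcomp p q = r}. if x = (p, q) then k * l else 0)"
    unfolding P_simps by (rule sum.cong) (auto simp: scaled_def split: if_splits)
  also have "\<dots> = scaled (k * l) (qcomp p q) r"
    using assms finite_qcomp by (simp add: sum.delta[OF finite_qcomp] scaled_def eq_commute)
  finally show "(scaled k p \<otimes>\<^bsub>P\<^esub> scaled l q) r = scaled (k * l) (qcomp p q) r" .
qed

lemma path_vec_qcomp:
  "composable Q p q \<Longrightarrow> path_vec (qcomp p q) = path_vec p \<otimes>\<^bsub>P\<^esub> (path_vec q :: _ \<Rightarrow> 'k)"
  by (simp add: path_vec_eq scaled_mult)

lemma P_minus: assumes "f \<in> carrier P" shows "\<ominus>\<^bsub>P\<^esub> f = (\<lambda>p. - f p)"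
  by (rule I.minus_equality) (use assms in \<open>auto simp: P_simps\<close>)

lemma path_vec_mult_mem:
  assumes "composable Q p q" "path_vec p \<in> I \<or> path_vec q \<in> I"
  shows "path_vec (qcomp p q) \<in> I"
  using assms I.I_l_closed I.I_r_closed scaled_closed[of p 1] scaled_closed[of q 1]
  by (auto simp: path_vec_qcomp composable_iff path_vec_eq[symmetric])

text \<open>The elements supported on paths of length at least 2 in \<open>I\<close> form an ideal
  \<open>T\<close>, since each path in a product contains a path from the factor in
  \<open>T\<close>. It contains the generating paths, hence all of \<open>I\<close>.\<close>

lemma mem_I_support:
  assumes f: "f \<in> I" and p: "f p \<noteq> 0"
  shows "path_vec p \<in> I \<and> qlength p \<ge> 2"
proof -
  obtain S where S: "S \<subseteq> {p \<in> qpaths Q. qlength p \<ge> 2}" "I = genideal P (path_vec ` S)"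
    using monomial unfolding monomial_ideal_def by blast
  define T where "T = {f \<in> carrier P. \<forall>p. f p \<noteq> 0 \<longrightarrow> path_vec p \<in> I \<and> qlength p \<ge> 2}"
  have T: "path_vec p \<in> I \<and> qlength p \<ge> 2" if "f \<in> T" "f p \<noteq> 0" for f p
    using that by (simp add: T_def)
  have factor: "\<exists>p q. composable Q p q \<and> qcomp p q = r \<and> f p \<noteq> 0 \<and> g q \<noteq> 0"
    if "(f \<otimes>\<^bsub>P\<^esub> g) r \<noteq> 0" for f g r
  proof (rule ccontr)
    assume "\<not> ?thesis"
    then have "(f \<otimes>\<^bsub>P\<^esub> g) r = 0" unfolding P_simps by (intro sum.neutral) auto
    then show False using that by simp
  qed
  have len: "qlength (qcomp p q) = qlength p + qlength q" for p q :: "('v, 'e) qpath"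
    by (simp add: qlength_def qcomp_def)
  have "ideal T P"
  proof (rule idealI)
    show "ring P" by unfold_locales
    show "subgroup T (add_monoid P)"
    proof
      show "T \<subseteq> carrier (add_monoid P)" by (auto simp: T_def)
      show "\<one>\<^bsub>add_monoid P\<^esub> \<in> T" by (simp add: T_def) (simp add: P_simps)
      show "x \<otimes>\<^bsub>add_monoid P\<^esub> y \<in> T" if "x \<in> T" "y \<in> T" for x y
      proof -
        have "x \<oplus>\<^bsub>P\<^esub> y \<in> carrier P" using that by (intro I.a_closed) (auto simp: T_def)
        moreover have "path_vec p \<in> I \<and> qlength p \<ge> 2" if "(x \<oplus>\<^bsub>P\<^esub> y) p \<noteq> 0" for p
        proof -
          have "x p \<noteq> 0 \<or> y p \<noteq> 0" using that by (auto simp: P_simps)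
          then show ?thesis using T \<open>x \<in> T\<close> \<open>y \<in> T\<close> by blast
        qed
        ultimately show ?thesis by (simp add: T_def)
      qed
      show "inv\<^bsub>add_monoid P\<^esub> x \<in> T" if "x \<in> T" for x
      proof -
        have x: "x \<in> carrier P" using that by (simp add: T_def)
        have "inv\<^bsub>add_monoid P\<^esub> x = \<ominus>\<^bsub>P\<^esub> x" by (simp only: a_inv_def)
        moreover have "\<ominus>\<^bsub>P\<^esub> x \<in> T"
          using I.a_inv_closed[OF x] T[OF that] unfolding T_def by (simp add: P_minus[OF x])
        ultimately show ?thesis by simp
      qed
    qed
    show "x \<otimes>\<^bsub>P\<^esub> a \<in> T" "a \<otimes>\<^bsub>P\<^esub> x \<in> T" if a: "a \<in> T" "x \<in> carrier P" for a x
    proof -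
      have aP: "a \<in> carrier P" using a by (simp add: T_def)
      have "path_vec r \<in> I \<and> qlength r \<ge> 2" if r: "(x \<otimes>\<^bsub>P\<^esub> a) r \<noteq> 0" for r
      proof -
        obtain p q where "composable Q p q" "qcomp p q = r" "a q \<noteq> 0" using factor[OF r] by blast
        then show ?thesis using T[OF a(1), of q] path_vec_mult_mem[of p q] len[of p q] by auto
      qed
      then show "x \<otimes>\<^bsub>P\<^esub> a \<in> T" using aP a(2) by (simp add: T_def)
      have "path_vec r \<in> I \<and> qlength r \<ge> 2" if r: "(a \<otimes>\<^bsub>P\<^esub> x) r \<noteq> 0" for r
      proof -
        obtain p q where "composable Q p q" "qcomp p q = r" "a p \<noteq> 0" using factor[OF r] by blast
        then show ?thesis using T[OF a(1), of p] path_vec_mult_mem[of p q] len[of p q] by auto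
      qed
      then show "a \<otimes>\<^bsub>P\<^esub> x \<in> T" using aP a(2) by (simp add: T_def)
    qed
  qed
  moreover have "path_vec ` S \<subseteq> T"
  proof
    fix f :: "('v, 'e) qpath \<Rightarrow> 'k" assume f: "f \<in> path_vec ` S"
    then obtain x where x: "x \<in> S" "f = path_vec x" by blast
    have SP: "path_vec x \<in> carrier P" if "x \<in> S" for x
      using S(1) that by (auto simp: path_vec_eq intro!: scaled_closed)
    then have "path_vec ` S \<subseteq> carrier P" by blast
    then have "f \<in> I" using I.genideal_self f S(2) by blast
    moreover have "f \<in> carrier P" using SP x by simp
    moreover have "qlength x \<ge> 2" using x S(1) by auto
    moreover have "f p \<noteq> 0 \<longrightarrow> p = x" for p using x by (simp add: path_vec_def)
    ultimately show "f \<in> T" unfolding T_def using x(2) by blast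
  qed
  ultimately have "I \<subseteq> T" unfolding S(2) by (rule I.genideal_minimal)
  then show ?thesis using T f p by blast
qed

lemma mem_I_iff:
  assumes f: "f \<in> carrier P"
  shows "f \<in> I \<longleftrightarrow> (\<forall>p. f p \<noteq> 0 \<longrightarrow> path_vec p \<in> I)"
proof
  assume "f \<in> I" then show "\<forall>p. f p \<noteq> 0 \<longrightarrow> path_vec p \<in> I" using mem_I_support by blast
next
  assume supp: "\<forall>p. f p \<noteq> 0 \<longrightarrow> path_vec p \<in> I"
  have fin: "finite {p. f p \<noteq> 0}" and Q: "\<And>p. f p \<noteq> 0 \<Longrightarrow> p \<in> qpaths Q" using f by (auto simp: P_simps)
  have "(\<lambda>p. if p \<in> B then f p else 0) \<in> I" if "finite B" "B \<subseteq> {p. f p \<noteq> 0}" for B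
    using that
  proof (induction B)
    case empty
    have "\<zero>\<^bsub>P\<^esub> \<in> I" by (rule additive_subgroup.zero_closed[OF ideal.axioms(1)[OF ideal_I]])
    then show ?case by (simp add: P_simps)
  next
    case (insert b B)
    have b: "b \<in> qpaths Q" "path_vec b \<in> I" using insert.prems supp Q by blast+
    \<comment> \<open>An ideal of a ring in this signature is not closed under scalars by
      definition; the multiple by \<open>f b\<close> of the trivial path at the target acts as the
      scalar.\<close>
    let ?e = "(qtarget Q b, [])"
    have e: "?e \<in> qpaths Q" using qtarget_in_verts[OF b(1)] by (simp add: qpaths_Nil)
    have c: "composable Q ?e b" using b e by (simp add: composable_iff)
    have "scaled (f b) ?e \<otimes>\<^bsub>P\<^esub> path_vec b \<in> I" using I.I_l_closed[OF b(2) scaled_closed[OF e]] .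
    moreover have "scaled (f b) ?e \<otimes>\<^bsub>P\<^esub> path_vec b = scaled (f b) b"
      using scaled_mult[OF c, of "f b" 1] by (simp add: path_vec_eq qcomp_def qsource_def)
    ultimately have "scaled (f b) b \<oplus>\<^bsub>P\<^esub> (\<lambda>p. if p \<in> B then f p else 0) \<in> I"
      using insert by (intro additive_subgroup.a_closed[OF ideal.axioms(1)[OF ideal_I]]) auto
    moreover have "scaled (f b) b \<oplus>\<^bsub>P\<^esub> (\<lambda>p. if p \<in> B then f p else 0) = (\<lambda>p. if p \<in> insert b B then f p else 0)"
      using insert.hyps by (auto simp: P_simps scaled_def)
    ultimately show ?case by simp
  qed
  from this[OF fin] have "(\<lambda>p. if p \<in> {p. f p \<noteq> 0} then f p else 0) \<in> I" by blast
  moreover have "(\<lambda>p. if p \<in> {p. f p \<noteq> 0} then f p else 0) = f" by auto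
  ultimately show "f \<in> I" by simp
qed

section \<open>The finite category of nonzero paths\<close>

definition N :: "('v, 'e) qpath set" where "N = {p. nonzero_path Q I p}"

definition nz :: "('v, 'e) qpath \<Rightarrow> ('v, 'e) qpath \<Rightarrow> bool" where
  "nz p q \<longleftrightarrow> composable Q p q \<and> qcomp p q \<in> N"

lemma N_iff: "p \<in> N \<longleftrightarrow> p \<in> qpaths Q \<and> path_vec p \<notin> I"
  by (simp add: N_def nonzero_path_def)

lemma nz_in_N: assumes "nz p q" shows "p \<in> N" "q \<in> N"
  using assms path_vec_mult_mem[of p q] by (auto simp: nz_def N_iff composable_iff)

lemma short_in_N: assumes "p \<in> qpaths Q" "qlength p < 2" shows "p \<in> N"
proof -
  have "(path_vec p :: _ \<Rightarrow> 'k) p \<noteq> 0" by (simp add: path_vec_def)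
  then have "path_vec p \<notin> I" using mem_I_support[of "path_vec p" p] assms(2) by auto
  then show ?thesis using assms(1) by (simp add: N_iff)
qed

text \<open>The first arrow is split off as the right factor, matching the recursion of powers;
  power 0 is the whole ring.\<close>

lemma path_in_arrow_ideal_power:
  "p \<in> qpaths Q \<Longrightarrow> path_vec p \<in> arrow_ideal Q [^]\<^bsub>ideals_set P\<^esub> (qlength p)"
proof (induction "qlength p" arbitrary: p)
  case 0
  then have "qlength p = 0" by simp
  then show ?case using scaled_closed[OF 0(2), of 1]
    by (simp add: nat_pow_def ideals_set_def path_vec_eq)
next
  case (Suc n)
  obtain u e es where p: "p = (u, e # es)" using Suc(2) by (cases p; cases "snd p") (auto simp: qlength_def)
  let ?a = "(u, [e])" and ?r = "(qtarget Q (u, [e]), es)"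
  have "(u, [e] @ es) \<in> qpaths Q" using Suc.prems by (simp add: p)
  then have c: "composable Q ?r ?a" and "?r \<in> qpaths Q" "?a \<in> qpaths Q"
    using qpaths_append[of u "[e]" es] by (simp_all add: composable_qpaths)
  have "path_vec ` {p \<in> qpaths Q. qlength p = 1} \<subseteq> carrier P"
    by (auto simp: path_vec_eq intro!: scaled_closed)
  then have "path_vec ` {p \<in> qpaths Q. qlength p = 1} \<subseteq> (arrow_ideal Q :: (_ \<Rightarrow> 'k) set)"
    unfolding arrow_ideal_def by (rule I.genideal_self)
  then have "(path_vec ?a :: _ \<Rightarrow> 'k) \<in> arrow_ideal Q"
    by (rule subsetD) (rule imageI, use \<open>?a \<in> qpaths Q\<close> in \<open>simp add: qlength_def\<close>)
  moreover have "(path_vec ?r :: _ \<Rightarrow> 'k) \<in> arrow_ideal Q [^]\<^bsub>ideals_set P\<^esub> n"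
    using Suc(1)[of ?r] Suc(2) \<open>?r \<in> qpaths Q\<close> by (simp add: qlength_def p)
  ultimately have "(path_vec ?r :: _ \<Rightarrow> 'k) \<otimes>\<^bsub>P\<^esub> path_vec ?a \<in>
      ideal_prod P (arrow_ideal Q [^]\<^bsub>ideals_set P\<^esub> n) (arrow_ideal Q)"
    by (rule ideal_prod.prod[rotated])
  also have "\<dots> = arrow_ideal Q [^]\<^bsub>ideals_set P\<^esub> (Suc n)"
    by (simp add: nat_pow_def ideals_set_def)
  finally have "path_vec ?r \<otimes>\<^bsub>P\<^esub> path_vec ?a \<in> arrow_ideal Q [^]\<^bsub>ideals_set P\<^esub> (Suc n)" .
  then show ?case using path_vec_qcomp[OF c] Suc(2) by (simp add: p)
qed

text \<open>Admissibility supplies an \<open>m\<close> such that every path of length at least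
  \<open>m\<close> has an initial piece in \<open>I\<close>, and a finite quiver has finitely many
  shorter paths.\<close>

lemma finite_N: "finite N"
proof -
  obtain m :: nat where m: "arrow_ideal Q [^]\<^bsub>ideals_set P\<^esub> m \<subseteq> I"
    using monomial unfolding monomial_ideal_def admissible_ideal_def by blast
  have "qlength p < m" if p: "p \<in> N" for p
  proof (rule ccontr)
    assume "\<not> qlength p < m"
    obtain u es where u: "p = (u, es)" by (cases p)
    let ?q = "(u, take m es)" and ?r = "(qtarget Q (u, take m es), drop m es)"
    have c: "composable Q ?r ?q" and q: "?q \<in> qpaths Q"
      using p qpaths_append[of u "take m es" "drop m es"] by (simp_all add: composable_qpaths u N_iff)
    have "path_vec ?q \<in> I"
      using path_in_arrow_ideal_power[OF q] m \<open>\<not> qlength p < m\<close> by (auto simp: qlength_def u)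
    then have "path_vec (qcomp ?r ?q) \<in> I" using path_vec_mult_mem[OF c] by blast
    then show False using p by (simp add: u N_iff)
  qed
  then have "N \<subseteq> verts Q \<times> {es. set es \<subseteq> arcs Q \<and> length es \<le> m}"
    by (fastforce simp: N_iff qpaths_def awalk_def qlength_def)
  moreover have "finite (verts Q \<times> {es. set es \<subseteq> arcs Q \<and> length es \<le> m})"
    by (intro finite_cartesian_product finite_lists_length_le finite_verts finite_arcs)
  ultimately show ?thesis by (rule finite_subset)
qed

lemma nz_Pair: "nz (v, xs) (u, ys) \<longleftrightarrow> v = qtarget Q (u, ys) \<and> (u, ys @ xs) \<in> N"
  by (auto simp: nz_def composable_qpaths N_iff)

lemma N_prefix: "(u, ys @ xs) \<in> N \<Longrightarrow> (u, ys) \<in> N"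
  using nz_in_N(2)[of "(qtarget Q (u, ys), xs)" "(u, ys)"] by (simp add: nz_Pair)

lemma N_suffix: "(u, ys @ xs) \<in> N \<Longrightarrow> (qtarget Q (u, ys), xs) \<in> N"
  using nz_in_N(1)[of "(qtarget Q (u, ys), xs)" "(u, ys)"] by (simp add: nz_Pair)

lemma target_append: "(u, ys @ xs) \<in> N \<Longrightarrow> qtarget Q (u, ys @ xs) = qtarget Q (qtarget Q (u, ys), xs)"
  using qtarget_append by (simp add: N_iff)

lemma Nil_in_N: "u \<in> verts Q \<Longrightarrow> (u, []) \<in> N"
  by (rule short_in_N) (simp_all add: qpaths_Nil qlength_def)

text \<open>Vertices become trivial paths, and \<open>overlap\<close> is the comparison of two cuts
  of one list of arrows.\<close>

sublocale Z: zero_category N nz qcomp "\<lambda>p. (qsource p, [])" "\<lambda>p. (qtarget Q p, [])" qlength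
proof
  show "finite N" by (rule finite_N)
  fix x y z w x' y' :: "('v, 'e) qpath"
  obtain xv xs where x: "x = (xv, xs)" by (cases x)
  obtain yv ys where y: "y = (yv, ys)" by (cases y)
  obtain zv zs where z: "z = (zv, zs)" by (cases z)
  obtain wv ws where w: "w = (wv, ws)" by (cases w)
  obtain xv' xs' where x': "x' = (xv', xs')" by (cases x')
  obtain yv' ys' where y': "y' = (yv', ys')" by (cases y')
  note eqs = x y z w x' y'
  show "x \<in> N" if "nz x y" using nz_in_N[OF that] by blast
  show "y \<in> N" if "nz x y" using nz_in_N[OF that] by blast
  show "qcomp x y \<in> N" if "nz x y" using that by (simp add: nz_def)
  show "(qsource x, []) = (qtarget Q y, [])" if "nz x y" using that by (simp add: eqs nz_Pair qsource_def)
  show "nz x (qsource x, [])" if "x \<in> N" using that by (simp add: eqs nz_Pair qsource_def qtarget_Nil)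
  show "nz (qtarget Q x, []) x" if "x \<in> N" using that by (simp add: eqs nz_Pair)
  show "qcomp x (qsource x, []) = x" by (simp add: eqs qsource_def)
  show "qcomp (qtarget Q x, []) x = x" by (simp add: eqs)
  show "(qsource x, []) \<in> N" if "x \<in> N"
    using that qsource_in_verts[of x] by (intro Nil_in_N) (simp add: N_iff)
  show "(qtarget Q x, []) \<in> N" if "x \<in> N"
    using that qtarget_in_verts[of x] by (intro Nil_in_N) (simp add: N_iff)
  show "nz x y \<and> nz (qcomp x y) z \<longleftrightarrow> nz y z \<and> nz x (qcomp y z)"
    using N_suffix[of zv zs "ys @ xs"] N_prefix[of zv "zs @ ys" xs] target_append[of zv zs ys]
    by (auto simp: eqs nz_Pair)
  show "qcomp (qcomp x y) z = qcomp x (qcomp y z)" by (simp add: eqs)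
  show "y = y'" if "nz x y" "nz x y'" "qcomp x y = qcomp x y'" using that by (simp add: eqs)
  show "x = x'" if "nz x y" "nz x' y" "qcomp x y = qcomp x' y" using that by (simp add: eqs nz_Pair)
  show "qlength (qcomp x y) = qlength x + qlength y" by (simp add: eqs qlength_def)
  show "(qsource x, []) = x" if "qlength x = 0" using that by (simp add: eqs qlength_def qsource_def)
  show "(qtarget Q x, []) = x" if "qlength x = 0" using that by (simp add: eqs qlength_def qtarget_Nil)
  show "qlength (qsource x, []) = 0" "qlength (qtarget Q x, []) = 0" by (simp_all add: qlength_def)
  show "\<exists>y a. nz y a \<and> qlength a = 1 \<and> x = qcomp y a" if xN: "x \<in> N" "0 < qlength x"
  proof -
    obtain e es where "xs = [e] @ es" using xN(2) by (cases xs) (auto simp: eqs qlength_def)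
    then show ?thesis using xN(1)
      by (intro exI[of _ "(qtarget Q (xv, [e]), es)"] exI[of _ "(xv, [e])"]) (simp add: eqs nz_Pair qlength_def)
  qed
  show "\<exists>y a. nz a y \<and> qlength a = 1 \<and> x = qcomp a y" if xN: "x \<in> N" "0 < qlength x"
  proof -
    obtain e es where "xs = es @ [e]" using xN(2) by (cases xs rule: rev_cases) (auto simp: eqs qlength_def)
    then show ?thesis using xN(1)
      by (intro exI[of _ "(xv, es)"] exI[of _ "(qtarget Q (xv, es), [e])"]) (simp add: eqs nz_Pair qlength_def)
  qed
  show "(\<exists>u. nz z u \<and> nz u y \<and> x = qcomp z u \<and> w = qcomp u y) \<or>
      (\<exists>u. nz x u \<and> nz u w \<and> z = qcomp x u \<and> y = qcomp u w)"
    if nz: "nz x y" "nz z w" and eq: "qcomp x y = qcomp z w"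
  proof -
    have v: "yv = wv" "ys @ xs = ws @ zs" using eq by (simp_all add: eqs)
    have xv: "xv = qtarget Q (wv, ys)" "(wv, ys @ xs) \<in> N" and zv: "zv = qtarget Q (wv, ws)" "(wv, ws @ zs) \<in> N"
      using nz v by (simp_all add: eqs nz_Pair)
    \<comment> \<open>\<open>us\<close> is the stretch of arrows between the two cuts.\<close>
    from v(2) obtain us where "ys = ws @ us \<and> us @ xs = zs \<or> ys @ us = ws \<and> xs = us @ zs"
      unfolding append_eq_append_conv2 by blast
    then show ?thesis
    proof
      assume us: "ys = ws @ us \<and> us @ xs = zs"
      let ?u = "(qtarget Q (wv, ws), us)"
      have "(wv, (ws @ us) @ xs) \<in> N" using xv(2) us v by simp
      then have "(wv, ws @ us) \<in> N" by (rule N_prefix)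
      then have "nz ?u w" and "qtarget Q ?u = xv" using target_append[of wv ws us] us xv by (simp_all add: w nz_Pair)
      moreover have "(qtarget Q (wv, ws), us @ xs) \<in> N" using N_suffix[of wv ws "us @ xs"] zv us by simp
      ultimately have "nz x ?u \<and> nz ?u w \<and> z = qcomp x ?u \<and> y = qcomp ?u w"
        using us v zv by (simp add: eqs nz_Pair)
      then show ?thesis by blast
    next
      assume us: "ys @ us = ws \<and> xs = us @ zs"
      let ?u = "(qtarget Q (yv, ys), us)"
      have "(yv, (ys @ us) @ zs) \<in> N" using zv(2) us v by simp
      then have "(yv, ys @ us) \<in> N" by (rule N_prefix)
      then have "nz ?u y" and "qtarget Q ?u = zv" using target_append[of yv ys us] us zv v by (simp_all add: y nz_Pair)
      moreover have "(qtarget Q (yv, ys), us @ zs) \<in> N" using N_suffix[of yv ys "us @ zs"] xv us v by simp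
      ultimately have "nz z ?u \<and> nz ?u y \<and> x = qcomp z ?u \<and> w = qcomp ?u y"
        using us v xv by (simp add: eqs nz_Pair)
      then show ?thesis by blast
    qed
  qed
qed

section \<open>The quotient algebra and its basis of nonzero paths\<close>

definition coef :: "(('v, 'e) qpath \<Rightarrow> 'k) set \<Rightarrow> ('v, 'e) qpath \<Rightarrow> 'k" where
  "coef X p = (if p \<in> N then (SOME f. f \<in> X) p else 0)"

text \<open>Elements of \<open>I\<close> vanish on nonzero paths, so it does not matter which
  representative \<open>coef\<close> picks.\<close>

lemma coef_coset:
  assumes f: "f \<in> carrier P" shows "coef (I +>\<^bsub>P\<^esub> f) p = (if p \<in> N then f p else 0)"
proof (cases "p \<in> N")
  case True
  define g where "g = (SOME g. g \<in> I +>\<^bsub>P\<^esub> f)"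
  have "g \<in> I +>\<^bsub>P\<^esub> f" unfolding g_def by (rule someI[of _ f]) (rule I.a_rcos_self[OF f])
  then obtain i where i: "i \<in> I" "g = i \<oplus>\<^bsub>P\<^esub> f" by (auto simp: a_r_coset_def r_coset_def)
  have "i p = 0" using mem_I_support[OF i(1), of p] True by (auto simp: N_iff)
  then show ?thesis using True i(2) by (simp add: coef_def P_simps flip: g_def)
qed (simp add: coef_def)

abbreviation A where "A \<equiv> P Quot I"

lemma A_cases: assumes "X \<in> carrier A" obtains f where "f \<in> carrier P" "X = I +>\<^bsub>P\<^esub> f"
  using assms by (auto simp: FactRing_def A_RCOSETS_def')

text \<open>Representatives with equal coefficients differ by an element supported on zero paths,
  which lies in \<open>I\<close>. For products, factors of a nonzero path are nonzero, so the sums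
  over composable and over nonzero factorisations of it agree.\<close>

sublocale M: monomial_ring N nz qcomp "\<lambda>p. (qsource p, [])" "\<lambda>p. (qtarget Q p, [])" qlength A coef
proof (intro monomial_ring.intro plain_ring.intro monomial_ring_axioms.intro)
  show "zero_category N nz qcomp (\<lambda>p. (qsource p, [])) (\<lambda>p. (qtarget Q p, [])) qlength"
    by (rule Z.zero_category_axioms)
  show "ring A" by (rule I.quotient_is_ring)
  show "bij_betw coef (carrier A) {f. \<forall>b. b \<notin> N \<longrightarrow> f b = 0}"
    unfolding bij_betw_def
  proof
    show "inj_on coef (carrier A)"
    proof (rule inj_onI)
      fix X Y assume X: "X \<in> carrier A" and Y: "Y \<in> carrier A" and eq: "coef X = coef Y"
      obtain f where f: "f \<in> carrier P" "X = I +>\<^bsub>P\<^esub> f" using X by (rule A_cases)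
      obtain g where g: "g \<in> carrier P" "Y = I +>\<^bsub>P\<^esub> g" using Y by (rule A_cases)
      have fg: "f \<ominus>\<^bsub>P\<^esub> g \<in> carrier P" using f g by simp
      have diff: "(f \<ominus>\<^bsub>P\<^esub> g) p = f p - g p" for p using g by (simp add: a_minus_def P_minus) (simp add: P_simps)
      have "path_vec p \<in> I" if p: "(f \<ominus>\<^bsub>P\<^esub> g) p \<noteq> 0" for p
      proof (rule ccontr)
        assume "path_vec p \<notin> I"
        moreover have "p \<in> qpaths Q" using fg p by (auto simp: P_simps(1))
        ultimately have "p \<in> N" by (simp add: N_iff)
        then have "f p = g p" using fun_cong[OF eq, of p] f g by (simp add: coef_coset)
        then show False using p diff by simp
      qed
      then have "f \<ominus>\<^bsub>P\<^esub> g \<in> I" using mem_I_iff[OF fg] by blast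
      then show "X = Y" using I.quotient_eq_iff_same_a_r_cos[OF ideal_I f(1) g(1)] f g by simp
    qed
    show "coef ` carrier A = {f. \<forall>b. b \<notin> N \<longrightarrow> f b = 0}"
    proof
      show "coef ` carrier A \<subseteq> {f. \<forall>b. b \<notin> N \<longrightarrow> f b = 0}" by (auto simp: coef_def)
      show "{f. \<forall>b. b \<notin> N \<longrightarrow> f b = 0} \<subseteq> coef ` carrier A"
      proof
        fix f :: "('v, 'e) qpath \<Rightarrow> 'k" assume f: "f \<in> {f. \<forall>b. b \<notin> N \<longrightarrow> f b = 0}"
        then have supp: "{p. f p \<noteq> 0} \<subseteq> N" by blast
        then have fP: "f \<in> carrier P" using finite_subset[OF supp finite_N] by (auto simp: P_simps N_iff)
        have "coef (I +>\<^bsub>P\<^esub> f) = f" using f by (auto simp: coef_coset[OF fP])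
        moreover have "I +>\<^bsub>P\<^esub> f \<in> carrier A" using fP by (auto simp: FactRing_def A_RCOSETS_def')
        ultimately show "f \<in> coef ` carrier A" by (metis imageI)
      qed
    qed
  qed
  fix X Y r assume X: "X \<in> carrier A" and Y: "Y \<in> carrier A"
  obtain f where f: "f \<in> carrier P" "X = I +>\<^bsub>P\<^esub> f" using X by (rule A_cases)
  obtain g where g: "g \<in> carrier P" "Y = I +>\<^bsub>P\<^esub> g" using Y by (rule A_cases)
  have "X \<oplus>\<^bsub>A\<^esub> Y = I +>\<^bsub>P\<^esub> (f \<oplus>\<^bsub>P\<^esub> g)" using I.a_rcos_sum f g by (simp add: FactRing_def)
  then have "coef (X \<oplus>\<^bsub>A\<^esub> Y) r = (if r \<in> N then (f \<oplus>\<^bsub>P\<^esub> g) r else 0)"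
    using coef_coset[of "f \<oplus>\<^bsub>P\<^esub> g" r] I.add.m_closed[OF f(1) g(1)] by simp
  then show "coef (X \<oplus>\<^bsub>A\<^esub> Y) r = coef X r + coef Y r"
    using f g by (simp add: coef_coset) (simp add: P_simps)
  have "X \<otimes>\<^bsub>A\<^esub> Y = I +>\<^bsub>P\<^esub> (f \<otimes>\<^bsub>P\<^esub> g)" using I.rcoset_mult_add f g by (simp add: FactRing_def)
  then have XY: "coef (X \<otimes>\<^bsub>A\<^esub> Y) r = (if r \<in> N then (f \<otimes>\<^bsub>P\<^esub> g) r else 0)"
    using coef_coset[of "f \<otimes>\<^bsub>P\<^esub> g" r] I.m_closed[OF f(1) g(1)] by simp
  show "coef (X \<otimes>\<^bsub>A\<^esub> Y) r = (\<Sum>(p, q) \<in> {(p, q). nz p q \<and> qcomp p q = r}. coef X p * coef Y q)"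
  proof (cases "r \<in> N")
    case True
    have "(\<Sum>(p, q) \<in> {(p, q). nz p q \<and> qcomp p q = r}. coef X p * coef Y q) =
        (\<Sum>(p, q) \<in> {(p, q). composable Q p q \<and> qcomp p q = r}. f p * g q)"
    proof (rule sum.cong)
      show "{(p, q). nz p q \<and> qcomp p q = r} = {(p, q). composable Q p q \<and> qcomp p q = r}"
        using True by (auto simp: nz_def)
      fix x assume "x \<in> {(p, q). composable Q p q \<and> qcomp p q = r}"
      then obtain p q where x: "x = (p, q)" "nz p q" using True by (auto simp: nz_def)
      then show "(case x of (p, q) \<Rightarrow> coef X p * coef Y q) = (case x of (p, q) \<Rightarrow> f p * g q)"
        using nz_in_N[OF x(2)] f g by (simp add: coef_coset)
    qed
    then show ?thesis using XY True by (simp add: P_simps(2))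
  next
    case False
    then show ?thesis using XY by (auto simp: nz_def intro!: sum.neutral)
  qed
next
  have "\<one>\<^bsub>A\<^esub> = I +>\<^bsub>P\<^esub> \<one>\<^bsub>P\<^esub>" by (simp add: FactRing_def)
  then show "coef \<one>\<^bsub>A\<^esub> r = (if r \<in> N \<and> qlength r = 0 then 1 else 0)" for r
    by (simp add: coef_coset) (auto simp: P_simps N_iff)
qed

section \<open>Translation of perfect pairs and of the set F\<close>

lemma zr_iff:
  "Z.zr p q \<longleftrightarrow> nonzero_path Q I p \<and> nonzero_path Q I q \<and> composable Q p q \<and> zero_path Q I (qcomp p q)"
  using qcomp_in_qpaths[of p q]
  by (auto simp: Z.zr_def nz_def N_iff nonzero_path_def zero_path_def composable_def)

text \<open>\<open>r\<close> is nonzero, so in a factorisation of \<open>r\<close> composability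
  already amounts to \<open>nz\<close>.\<close>

lemma factor_iff:
  assumes "r \<in> N" shows "(\<exists>u. nz p u \<and> r = qcomp p u) \<longleftrightarrow> (\<exists>u. composable Q p u \<and> r = qcomp p u)"
    and "(\<exists>u. nz u p \<and> r = qcomp u p) \<longleftrightarrow> (\<exists>u. composable Q u p \<and> r = qcomp u p)"
  using assms by (auto simp: nz_def)

lemma perfect_pair_iff: "perfect_pair Q I p q \<longleftrightarrow> Z.perfect p q"
proof -
  have len: "qlength p \<ge> 1 \<and> qlength q \<ge> 1" if "Z.zr p q"
    using Z.zr_lenL[OF that] Z.zr_lenR[OF that] by simp
  have right: "(\<exists>u. nz q u \<and> q' = qcomp q u) \<longleftrightarrow> (\<exists>u. composable Q q u \<and> q' = qcomp q u)" if "Z.zr p q'" for q'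
    using that by (intro factor_iff) (simp add: Z.zr_def)
  have left: "(\<exists>u. nz u p \<and> p' = qcomp u p) \<longleftrightarrow> (\<exists>u. composable Q u p \<and> p' = qcomp u p)" if "Z.zr p' q" for p'
    using that by (intro factor_iff) (simp add: Z.zr_def)
  have "Z.perfect p q \<longleftrightarrow> Z.zr p q \<and>
      (\<forall>q'. Z.zr p q' \<longrightarrow> (\<exists>u. composable Q q u \<and> q' = qcomp q u)) \<and>
      (\<forall>p'. Z.zr p' q \<longrightarrow> (\<exists>u. composable Q u p \<and> p' = qcomp u p))"
    unfolding Z.perfect_def using right left by auto
  also have "\<dots> \<longleftrightarrow> perfect_pair Q I p q"
  proof (cases "Z.zr p q")
    case True
    then show ?thesis using len[OF True] unfolding perfect_pair_def zr_iff by auto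
  next
    case False
    then show ?thesis unfolding perfect_pair_def zr_iff by auto
  qed
  finally show ?thesis by simp
qed

lemma perfect_path_iff: "perfect_path Q I p \<longleftrightarrow> Z.perfect_cyclic p"
proof
  assume "perfect_path Q I p"
  then show "Z.perfect_cyclic p"
    unfolding perfect_path_def Z.perfect_cyclic_def perfect_pair_iff by blast
next
  assume "Z.perfect_cyclic p"
  then obtain n :: nat and ps where n: "n \<ge> 1" "ps 1 = p" "ps (n + 1) = p"
    and pp: "\<forall>i\<in>{1..n}. Z.perfect (ps i) (ps (i + 1))" unfolding Z.perfect_cyclic_def by blast
  have mem: "nonzero_path Q I (ps i)" if "i \<in> {1..n}" for i
    using pp that by (simp add: Z.perfect_def zr_iff)
  have p: "nonzero_path Q I p" using mem[of 1] n by simp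
  have "nonzero_path Q I (ps i)" if "i \<in> {1..n + 1}" for i
    using mem[of i] that p n(3) by (cases "i = n + 1") auto
  then show "perfect_path Q I p"
    unfolding perfect_path_def perfect_pair_iff using p n pp by (intro conjI exI[of _ n] exI[of _ ps]) auto
qed

text \<open>A zero path \<open>r\<close> inside \<open>qp\<close> lies neither in \<open>p\<close>
  nor in \<open>q\<close>, which are nonzero, so it straddles the junction. By \<open>lmin\<close>
  it cannot stop before the end of \<open>q\<close>, and by \<open>rmin\<close> it cannot start
  after the beginning of \<open>p\<close>. Conversely, shortening either factor while the product
  stays zero gives a proper zero subpath.\<close>

lemma minimal_iff:
  assumes "p \<in> N" "q \<in> N" "composable Q q p"
  shows "qcomp q p \<in> minimal_paths Q {p. zero_path Q I p} \<longleftrightarrow> Z.lmin q p \<and> Z.rmin q p"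
proof
  assume "qcomp q p \<in> minimal_paths Q {p. zero_path Q I p}"
  then have zero: "zero_path Q I (qcomp q p)"
    and min: "\<And>r. zero_path Q I r \<Longrightarrow> subpath Q r (qcomp q p) \<Longrightarrow> r = qcomp q p"
    by (auto simp: minimal_paths_def)
  have zr: "Z.zr q p" using assms zero unfolding zr_iff by (simp add: N_def)
  have "q1 = q" if "nz d q1" "q = qcomp d q1" "Z.zr q1 p" for d q1
  proof -
    have c: "composable Q q1 p" and z: "zero_path Q I (qcomp q1 p)" using that(3) by (simp_all add: zr_iff)
    have "subpath Q (qcomp q1 p) (qcomp q p)"
      unfolding subpath_def
    proof (intro exI conjI)
      show "composable Q d (qcomp q1 p)" using that(1,2) c assms(3)
        by (cases d; cases q1; cases p) (simp add: nz_def composable_qpaths qpaths_append qtarget_append)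
      show "composable Q (qcomp q1 p) (qsource p, [])" using c
        by (cases q1; cases p) (auto simp: composable_qpaths qsource_def qtarget_Nil)
      show "qcomp q p = qcomp d (qcomp (qcomp q1 p) (qsource p, []))"
        by (cases d; cases q1; cases p) (simp add: that(2) qsource_def)
    qed
    then have "qcomp q1 p = qcomp q p" using min z by blast
    then have "snd d = []" by (cases d; cases q1; cases p) (simp add: that(2))
    then show ?thesis using that(1,2) by (cases d; cases q1) (simp add: nz_def)
  qed
  moreover have "p1 = p" if "nz p1 d" "p = qcomp p1 d" "Z.zr q p1" for d p1
  proof -
    have c: "composable Q q p1" and z: "zero_path Q I (qcomp q p1)" using that(3) by (simp_all add: zr_iff)
    have "subpath Q (qcomp q p1) (qcomp q p)"
      unfolding subpath_def
    proof (intro exI conjI)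
      show "composable Q (qtarget Q (qcomp q p1), []) (qcomp q p1)"
        using qcomp_in_qpaths[OF c] by (cases p1; cases q) (simp add: composable_qpaths)
      show "composable Q (qcomp q p1) d" using that(1,2) c assms(3)
        by (cases d; cases p1; cases q) (auto simp: nz_def composable_qpaths qpaths_append qtarget_append)
      show "qcomp q p = qcomp (qtarget Q (qcomp q p1), []) (qcomp (qcomp q p1) d)"
        by (cases d; cases p1; cases q) (simp add: that(2))
    qed
    then have eq: "qcomp q p1 = qcomp q p" using min z by blast
    then have "snd d = []" by (cases d; cases p1; cases q) (auto simp: that(2))
    moreover have "fst p1 = fst d" using eq by (cases d; cases p1; cases q) (simp add: that(2))
    ultimately show ?thesis using that(2) by (cases d; cases p1) simp
  qed
  ultimately show "Z.lmin q p \<and> Z.rmin q p" using zr unfolding Z.lmin_def Z.rmin_def by blast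
next
  assume min: "Z.lmin q p \<and> Z.rmin q p"
  then have zr: "Z.zr q p" by (simp add: Z.lmin_def)
  have "r = qcomp q p" if r: "zero_path Q I r" "subpath Q r (qcomp q p)" for r
  proof -
    obtain a b where a: "composable Q a r" and b: "composable Q r b" and ab: "qcomp q p = qcomp a (qcomp r b)"
      using r(2) by (auto simp: subpath_def)
    obtain pv ps where p: "p = (pv, ps)" by (cases p)
    obtain qv qs where q: "q = (qv, qs)" by (cases q)
    obtain av as where a': "a = (av, as)" by (cases a)
    obtain bv bs where b': "b = (bv, bs)" by (cases b)
    obtain rv rs where r': "r = (rv, rs)" by (cases r)
    have eq: "bv = pv" "ps @ qs = bs @ rs @ as" using ab by (simp_all add: p q a' b' r')
    have rI: "path_vec r \<in> I" using r(1) by (simp add: zero_path_def)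
    have pq: "qv = qtarget Q (pv, ps)" "(pv, ps @ qs) \<in> qpaths Q" using assms(3) by (simp_all add: composable_qpaths p q)
    \<comment> \<open>No nonzero path contains \<open>r\<close>. Arrow lists follow the order of
      traversal, so \<open>xs\<close> is the part before \<open>r\<close>.\<close>
    have bad: False if "(v, xs @ rs @ ys) \<in> N" "rv = qtarget Q (v, xs)" for v xs ys
      using that N_prefix[of "qtarget Q (v, xs)" rs ys] N_suffix[of v xs "rs @ ys"] rI by (simp add: N_iff r')
    have rv: "rv = qtarget Q (pv, bs)" using b eq(1) by (simp add: composable_qpaths b' r')
    \<comment> \<open>If \<open>r\<close> ends inside \<open>q\<close>, the initial piece
      \<open>us\<close> of \<open>q\<close> up to that point already has zero product with
      \<open>p\<close>, so minimality leaves nothing beyond it.\<close>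
    have "as = []"
    proof -
      from eq(2) have "ps @ qs = (bs @ rs) @ as" by simp
      then obtain us where "ps = (bs @ rs) @ us \<and> us @ qs = as \<or> ps @ us = bs @ rs \<and> qs = us @ as"
        unfolding append_eq_append_conv2 by blast
      then show ?thesis
      proof
        assume "ps = (bs @ rs) @ us \<and> us @ qs = as"
        then show ?thesis using bad[of pv bs us] assms(1) rv by (simp add: p)
      next
        assume us: "ps @ us = bs @ rs \<and> qs = us @ as"
        let ?q1 = "(qv, us)" and ?d = "(qtarget Q (qv, us), as)"
        have qN: "(qv, us @ as) \<in> N" using assms(2) us by (simp add: q)
        then have "nz ?d ?q1" "q = qcomp ?d ?q1" using us by (simp_all add: nz_Pair q)
        moreover have "Z.zr ?q1 p"
        proof -
          have "\<not> nz ?q1 p" using bad[of pv bs "[]"] us rv by (auto simp: nz_Pair p)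
          then show ?thesis using N_prefix[OF qN] assms(1) pq(1) unfolding Z.zr_def by (simp add: qsource_def p)
        qed
        ultimately have "?q1 = q" using min unfolding Z.lmin_def by blast
        then show ?thesis using us by (simp add: q)
      qed
    qed
    moreover have "bs = []"
    proof -
      from eq(2) obtain us where "ps = bs @ us \<and> us @ qs = rs @ as \<or> ps @ us = bs \<and> qs = us @ rs @ as"
        unfolding append_eq_append_conv2 by blast
      then show ?thesis
      proof
        assume us: "ps = bs @ us \<and> us @ qs = rs @ as"
        let ?p1 = "(qtarget Q (pv, bs), us)" and ?d = "(pv, bs)"
        have pN: "(pv, bs @ us) \<in> N" using assms(1) us by (simp add: p)
        then have "nz ?p1 ?d" "p = qcomp ?p1 ?d" using us by (simp_all add: nz_Pair p)
        moreover have "Z.zr q ?p1"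
        proof -
          have "qtarget Q ?p1 = qv" using target_append[OF pN] pq us by simp
          moreover have "\<not> nz q ?p1"
            using bad[of "qtarget Q (pv, bs)" "[]" as] us rv by (auto simp: nz_Pair q qtarget_Nil)
          ultimately show ?thesis using N_suffix[OF pN] assms(2) unfolding Z.zr_def by (simp add: qsource_def q)
        qed
        ultimately have "?p1 = p" using min unfolding Z.rmin_def by blast
        then show ?thesis using us by (simp add: p)
      next
        \<comment> \<open>Here \<open>r\<close> starts only after \<open>p\<close> and would lie
          inside \<open>q\<close>.\<close>
        assume us: "ps @ us = bs \<and> qs = us @ rs @ as"
        have "(pv, bs @ (rs @ as)) \<in> qpaths Q" using pq(2) eq(2) by simp
        then have "(pv, ps @ us) \<in> qpaths Q" using qpaths_append us by simp
        then have "qtarget Q (qv, us) = rv" using qtarget_append[of pv ps us] pq(1) us rv by simp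
        then show ?thesis using bad[of qv us as] assms(2) us by (simp add: q)
      qed
    qed
    ultimately show ?thesis using eq rv by (simp add: p q r' qtarget_Nil)
  qed
  then show "qcomp q p \<in> minimal_paths Q {p. zero_path Q I p}"
    using zr by (auto simp: minimal_paths_def zr_iff)
qed

theorem one_gorenstein_quotient_iff:
  "one_gorenstein (P Quot I) \<longleftrightarrow>
    (\<forall>p. nonzero_path Q I p \<and>
         (\<exists>q. nonzero_path Q I q \<and> composable Q q p \<and> qcomp q p \<in> minimal_paths Q {p. zero_path Q I p}) \<longrightarrow>
         perfect_path Q I p)"
proof -
  have "Z.lmin q p \<and> Z.rmin q p \<longleftrightarrow> nonzero_path Q I p \<and> nonzero_path Q I q \<and> composable Q q p \<and>
      qcomp q p \<in> minimal_paths Q {p. zero_path Q I p}" for p q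
  proof -
    have mem: "x \<in> N \<longleftrightarrow> nonzero_path Q I x" for x by (simp add: N_def)
    have "nonzero_path Q I p \<and> nonzero_path Q I q \<and> composable Q q p" if "Z.lmin q p"
      using that by (simp add: Z.lmin_def zr_iff)
    then show ?thesis using minimal_iff[of p q, unfolded mem] by blast
  qed
  then show ?thesis unfolding M.one_gorenstein_iff perfect_path_iff by blast
qed

end

theorem theorem5p1p4:
  fixes Q :: "('v, 'e) pre_digraph"
    and I :: "(('v, 'e) qpath \<Rightarrow> 'k::alg_closed_field) set"
    and F :: "('v, 'e) qpath set"
  assumes "fin_digraph Q"
    and "monomial_ideal Q I"
    and "F = minimal_paths Q {p. zero_path Q I p}"
  shows "one_gorenstein (path_algebra Q Quot I) \<longleftrightarrow>
    (\<forall>p. nonzero_path Q I p \<and>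
         (\<exists>q. nonzero_path Q I q \<and> composable Q q p \<and> qcomp q p \<in> F) \<longrightarrow>
         perfect_path Q I p)"
proof -
  interpret monomial_quotient Q I
    using assms(1,2) by (intro monomial_quotient.intro monomial_quotient_axioms.intro)
  show ?thesis unfolding assms(3) by (rule one_gorenstein_quotient_iff)
qed

end
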